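(* Let $(x^{(k)})_k$ with $x^{(k)}=(S^{(k)},Q^{(k)},V^{(k)},a^{(k)},b^{(k)})\in\mathcal{M}_t$ be the sequence generated by the geometric modified Polak-Ribière-Polyak algorithm applied to $F$ on $\mathcal{M}_t$, with step sizes given by the line search algorithm (both described in the context). If the algorithm does not stop with $\|\nabla_{\mathcal{M}_t}F(x^{(k_0)})\|_{x^{(k_0)}}=0$ in some step $k_0$, then $$\liminf_{k\to\infty}\bigl\|\nabla_{\mathcal{M}_t}F(x^{(k)})\bigr\|_{x^{(k)}}=0.$$
   Context: Functional. Let $\Lambda=(\lambda_1,\dots,\lambda_n)^{\mathrm T}$ with $\lambda_1,\dots,\lambda_s\in\mathbb{R}$, $\lambda_{s+1},\dots,\lambda_n\in\mathbb{C}\setminus\mathbb{R}$, $\lambda_{s+2j}=\overline{\lambda_{s+2j-1}}$ for $j=1,\dots,t$, $t=(n-s)/2$. $D(\Lambda)=\mathrm{blockdiag}(\lambda_1,\dots,\lambda_s,\lambda_1^{[2]},\dots,\lambda_t^{[2]})$ with $\lambda_j^{[2]}=\begin{pmatrix}\mathrm{Re}(\lambda_{s+2j-1}) & \mathrm{Im}(\lambda_{s+2j-1})\\ -\mathrm{Im}(\lambda_{s+2j-1}) & \mathrm{Re}(\lambda_{s+2j-1})\end{pmatrix}$. $\mathcal{V}_t$: real upper triangular $n\times n$ matrices with zero diagonal and $v_{s+2j-1,s+2j}=0$, $j=1,\dots,t$. $\mathcal{OB}(n)$: matrices $S\in\mathbb{R}^{n,n}$ with all rows of Euclidean norm $1$.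 $\mathrm{O}(n)$: orthogonal matrices. For $a\in\mathbb{R}_{>0}^t$, $b\in\mathbb{R}^t$: $T_{ab}=\mathrm{blockdiag}(I_s,T_{a_1b_1},\dots,T_{a_tb_t})$, $T_{\alpha\beta}=\begin{pmatrix}\alpha&\beta\\0&1/\alpha\end{pmatrix}$. With $\circ$ the componentwise product, $$F(S,Q,V,a,b)=\tfrac12\|S\circ S-Q\,T_{ab}(D(\Lambda)+V)T_{ab}^{-1}Q^{\mathrm T}\|_F^2$$ on $\mathcal{M}_t=\mathcal{OB}(n)\times\mathrm{O}(n)\times\mathcal{V}_t\times\mathbb{R}_{>0}^t\times\mathbb{R}^t$. Geometry. $\mathcal{M}_t$ carries the product Riemannian metric $\langle\cdot,\cdot\rangle_x$, $\|\cdot\|_x$: Euclidean (trace) inner product on the $S,Q,V,b$ factors and $\langle\xi^{(1)},\xi^{(2)}\rangle_a=\sum_k\xi_k^{(1)}\xi_k^{(2)}/a_k^2$ on $\mathbb{R}^t_{>0}$. $\nabla_{\mathcal{M}_t}$, $\nabla^2_{\mathcal{M}_t}$ are the Riemannian gradient and Hessian. Tangent spaces: $T_S\mathcal{OB}(n)=\{\Xi:\mathrm{diag}(S\Xi^{\mathrm T})=0\}$, $T_Q\mathrm{O}(n)=\{Q\Omega:\Omega^{\mathrm T}=-\Omega\}$; here $\mathrm{diag}(X)$ is the diagonal matrix with the diagonal entries of $X$. Orthogonal projections: $\Pi_{T_S\mathcal{OB}(n)}(\Xi)=\Xi-\mathrm{diag}(S\Xi^{\mathrm T})S$, $\Pi_{T_Q\mathrm{O}(n)}(\Xi)=\tfrac12Q(Q^{\mathrm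 T}\Xi-\Xi^{\mathrm T}Q)$. Retraction $\mathcal{R}$ (componentwise): on $\mathcal{V}_t$ and $\mathbb{R}^t$ addition $V+\Xi$, $b+\xi$; on each component of $\mathbb{R}_{>0}^t$, $\mathcal{R}_{a_k}(\xi)=a_ke^{\xi/a_k}$; on $\mathcal{OB}(n)$ either row-wise normalization of $S+\Xi$ or the Riemannian exponential map (row-wise exponential map of the sphere); on $\mathrm{O}(n)$ either $\mathcal{R}_Q(\Xi)=\mathrm{qf}(Q+\Xi)$, where $\mathrm{qf}(A)$ is the orthogonal factor in the unique QR decomposition $A=\hat QR$ with $R$ upper triangular with positive diagonal, or $\exp_Q(\Xi)=Q\,\mathrm{Exp}(Q^{\mathrm T}\Xi)$ with $\mathrm{Exp}$ the matrix exponential. Vector transport $\mathcal{T}_{x,\theta}\xi$ (from $T_x\mathcal{M}_t$ to $T_{\mathcal{R}_x(\theta)}\mathcal{M}_t$, componentwise): orthogonal projections $\Pi_{T_{\mathcal{R}_S(\Theta)}\mathcal{OB}(n)}(\Xi)$ and $\Pi_{T_{\mathcal{R}_Q(\Theta)}\mathrm{O}(n)}(\Xi)$ on the first two factors, and the identity $\xi\mapsto\xi$ on the $V$, $a$ and $b$ factors. Geometric modified Polak-Ribière-Polyak algorithm: start with $x^{(0)}\in\mathcal{M}_t$, $g^{(0)}=\nabla_{\mathcal{M}_t}F(x^{(0)})$, $d^{(0)}=-g^{(0)}$, $k=0$. While $\|g^{(k)}\|_{x^{(k)}}>0$: find a step size $\alpha^{(k)}$ by the line search with input $x=x^{(k)}$,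 $d=d^{(k)}$; set $x^{(k+1)}=\mathcal{R}_{x^{(k)}}(\alpha^{(k)}d^{(k)})$, $g^{(k+1)}=\nabla_{\mathcal{M}_t}F(x^{(k+1)})$, $y^{(k)}=g^{(k+1)}-\mathcal{T}_{x^{(k)},\alpha^{(k)}d^{(k)}}g^{(k)}$, $\tilde d^{(k)}=\mathcal{T}_{x^{(k)},\alpha^{(k)}d^{(k)}}d^{(k)}$, $\beta^{(k)}=\langle g^{(k+1)},y^{(k)}\rangle_{x^{(k+1)}}/\|g^{(k)}\|^2_{x^{(k)}}$, $\theta^{(k)}=\langle g^{(k+1)},\tilde d^{(k)}\rangle_{x^{(k+1)}}/\|g^{(k)}\|^2_{x^{(k)}}$, $d^{(k+1)}=-g^{(k+1)}+\beta^{(k)}\tilde d^{(k)}-\theta^{(k)}y^{(k)}$; increase $k$ by one. Line search algorithm: fixed parameters $0<\tau<1$, $0<\delta<1$, $\alpha^\star>0$. Given $x$ and a descent direction $d\in T_x\mathcal{M}_t$, set $l=0$ and $\tilde\alpha^{(0)}=\left|\langle d,\nabla_{\mathcal{M}_t}F(x)\rangle_x/\langle d,\nabla^2_{\mathcal{M}_t}F(x)d\rangle_x\right|$ if $\langle d,\nabla^2_{\mathcal{M}_t}F(x)d\rangle_x\neq0$, and $\tilde\alpha^{(0)}=\alpha^\star$ otherwise. While $F(\mathcal{R}_x(\tilde\alpha^{(l)}d))-F(x)\ge-\delta(\tilde\alpha^{(l)})^2\|d\|_x^2$, set $\tilde\alpha^{(l+1)}=\tau\tilde\alpha^{(l)}$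 and $l=l+1$. Additional step: if $l=0$ after this loop, then while $F(\mathcal{R}_x(\tilde\alpha^{(l)}d))-F(x)<-\delta(\tilde\alpha^{(l)})^2\|d\|_x^2$ set $\tilde\alpha^{(l+1)}=\tau^{-1}\tilde\alpha^{(l)}$ and $l=l+1$; when this loop ends, set $l=l-1$. Output the step size $\tilde\alpha^{(l)}$. *)

theory Defs
  imports "HOL-Analysis.Analysis"
begin

(* Matrices are real^'n^'n with n = CARD('n).  The linear order on 'n is used only to
   number the indices 1, ..., n: idx i is the number of i, pos k is the k-th index. *)

type_synonym 'n rvec = "real^'n"
type_synonym 'n cvec = "complex^'n"
type_synonym 'n rmat = "real^'n^'n"

definition idx :: "'n::{finite,linorder} \<Rightarrow> nat" where
  "idx i = card {j. j \<le> i}"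

definition pos :: "nat \<Rightarrow> 'n::{finite,linorder}" where
  "pos k = (THE i. idx i = k)"

definition admissible_spectrum :: "nat \<Rightarrow> nat \<Rightarrow> ('n::{finite,linorder}) cvec \<Rightarrow> bool" where
  "admissible_spectrum s t \<Lambda> \<longleftrightarrow>
     s + 2 * t = CARD('n) \<and>
     (\<forall>k\<in>{1..s}. \<Lambda> $ pos k \<in> \<real>) \<and>
     (\<forall>k\<in>{s+1..CARD('n)}. \<Lambda> $ pos k \<notin> \<real>) \<and>
     (\<forall>j\<in>{1..t}. \<Lambda> $ pos (s + 2*j) = cnj (\<Lambda> $ pos (s + 2*j - 1)))"


(* The block diagonal matrix blockdiag(c 1, ..., c s, B 1, ..., B t), where n = s + 2 t.
   The indices s+2j-1 and s+2j belong to the block B j, and are its first and second index. *)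

definition block_no :: "nat \<Rightarrow> 'n::{finite,linorder} \<Rightarrow> nat" where
  "block_no s i = (idx i - s + 1) div 2"

definition block_idx :: "nat \<Rightarrow> 'n::{finite,linorder} \<Rightarrow> 2" where
  "block_idx s i = (if odd (idx i - s) then 1 else 2)"

definition blockdiag ::
  "nat \<Rightarrow> (nat \<Rightarrow> real) \<Rightarrow> (nat \<Rightarrow> real^2^2) \<Rightarrow> ('n::{finite,linorder}) rmat" where
  "blockdiag s c B = (\<chi> i j.
     if idx i \<le> s \<or> idx j \<le> s then (if i = j then c (idx i) else 0)
     else if block_no s i = block_no s j
       then B (block_no s i) $ block_idx s i $ block_idx s j
     else 0)"

definition D_mat :: "nat \<Rightarrow> 'n cvec \<Rightarrow> ('n::{finite,linorder}) rmat" where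
  "D_mat s \<Lambda> = blockdiag s (\<lambda>k. Re (\<Lambda> $ pos k))
     (\<lambda>j. let z = \<Lambda> $ pos (s + 2*j - 1) in
        vector [vector [Re z, Im z], vector [- Im z, Re z]])"

definition T_block :: "real \<Rightarrow> real \<Rightarrow> real^2^2" where
  "T_block \<alpha> \<beta> = vector [vector [\<alpha>, \<beta>], vector [0, 1 / \<alpha>]]"

definition T_mat :: "nat \<Rightarrow> 'n rvec \<Rightarrow> 'n rvec \<Rightarrow> ('n::{finite,linorder}) rmat" where
  "T_mat s a b = blockdiag s (\<lambda>_. 1) (\<lambda>k. T_block (a $ pos k) (b $ pos k))"


(* A vector (u_1, ..., u_t) of R^t (t = 0 allowed, t \<le> n) is represented by the vector of
   R^n with entry u_k at position k for k \<le> t and entry 0 at all other positions. *)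

definition Rvec :: "nat \<Rightarrow> (('n::{finite,linorder}) rvec) set" where
  "Rvec t = {u. \<forall>i. t < idx i \<longrightarrow> u $ i = 0}"

definition Rpos :: "nat \<Rightarrow> (('n::{finite,linorder}) rvec) set" where
  "Rpos t = {u \<in> Rvec t. \<forall>i. idx i \<le> t \<longrightarrow> 0 < u $ i}"

definition OB :: "(('n::finite) rmat) set" where
  "OB = {S. \<forall>i. norm (S $ i) = 1}"

definition Orth :: "(('n::finite) rmat) set" where
  "Orth = {Q. orthogonal_matrix Q}"

definition V_space :: "nat \<Rightarrow> nat \<Rightarrow> (('n::{finite,linorder}) rmat) set" where
  "V_space s t = {V. (\<forall>i j. j \<le> i \<longrightarrow> V $ i $ j = 0) \<and>
     (\<forall>j\<in>{1..t}. V $ pos (s + 2*j - 1) $ pos (s + 2*j) = 0)}"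

type_synonym 'n point =
  "'n rmat \<times> 'n rmat \<times> 'n rmat \<times> 'n rvec \<times> 'n rvec"

definition manifold :: "nat \<Rightarrow> nat \<Rightarrow> ('n::{finite,linorder}) point set" where
  "manifold s t = OB \<times> Orth \<times> V_space s t \<times> Rpos t \<times> Rvec t"

(* On the type real^'n^'n the product * is componentwise and norm is the Frobenius norm. *)

definition objF :: "nat \<Rightarrow> 'n cvec \<Rightarrow> ('n::{finite,linorder}) point \<Rightarrow> real" where
  "objF s \<Lambda> = (\<lambda>(S, Q, V, a, b).
     1/2 * (norm (S * S -
       Q ** T_mat s a b ** (D_mat s \<Lambda> + V) ** matrix_inv (T_mat s a b) ** transpose Q))\<^sup>2)"


definition diag_part :: "'n rmat \<Rightarrow> ('n::finite) rmat" where
  "diag_part X = (\<chi> i j. if i = j then X $ i $ j else 0)"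

definition tangent :: "nat \<Rightarrow> nat \<Rightarrow> ('n::{finite,linorder}) point \<Rightarrow> 'n point set" where
  "tangent s t = (\<lambda>(S, Q, V, a, b).
     {\<Xi>. diag_part (S ** transpose \<Xi>) = 0} \<times>
     {Q ** \<Omega> |\<Omega>. transpose \<Omega> = - \<Omega>} \<times>
     V_space s t \<times> Rvec t \<times> Rvec t)"

definition proj_OB :: "'n rmat \<Rightarrow> 'n rmat \<Rightarrow> ('n::finite) rmat" where
  "proj_OB S \<Xi> = \<Xi> - diag_part (S ** transpose \<Xi>) ** S"

definition proj_Orth :: "'n rmat \<Rightarrow> 'n rmat \<Rightarrow> ('n::finite) rmat" where
  "proj_Orth Q \<Xi> = (1/2) *\<^sub>R (Q ** (transpose Q ** \<Xi> - transpose \<Xi> ** Q))"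

definition riem_metric :: "nat \<Rightarrow> ('n::{finite,linorder}) point \<Rightarrow> 'n point \<Rightarrow> 'n point \<Rightarrow> real" where
  "riem_metric t = (\<lambda>(S, Q, V, a, b) (\<Xi>S, \<Xi>Q, \<Xi>V, \<xi>a, \<xi>b) (HS, HQ, HV, \<eta>a, \<eta>b).
     \<Xi>S \<bullet> HS + \<Xi>Q \<bullet> HQ + \<Xi>V \<bullet> HV +
     (\<Sum>k=1..t. \<xi>a $ pos k * \<eta>a $ pos k / (a $ pos k)\<^sup>2) + \<xi>b \<bullet> \<eta>b)"

definition rnorm :: "nat \<Rightarrow> ('n::{finite,linorder}) point \<Rightarrow> 'n point \<Rightarrow> real" where
  "rnorm t x \<xi> = sqrt (riem_metric t x \<xi> \<xi>)"

(* The gradient is the tangent vector representing the differential of f at x.  A derivative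
   D within the manifold is determined by f on the tangent space only, which suffices here. *)

definition rgrad ::
  "nat \<Rightarrow> nat \<Rightarrow> (('n::{finite,linorder}) point \<Rightarrow> real) \<Rightarrow> 'n point \<Rightarrow> 'n point" where
  "rgrad s t f x = (THE g. g \<in> tangent s t x \<and>
     (\<exists>D. (f has_derivative D) (at x within manifold s t) \<and>
          (\<forall>\<xi>\<in>tangent s t x. riem_metric t x g \<xi> = D \<xi>)))"

(* Levi-Civita connection of the product metric at x, in direction \<xi>, of a vector field that
   has value \<eta> at x and classical directional derivative d\<eta>.  The factors OB(n) and O(n)
   carry the metric of their ambient space, hence the orthogonal projections; the metric
   \<xi> \<eta> / a^2 on the positive reals has Christoffel symbol -1/a; the factors for V and b
   are flat.  In the padding positions of the a-factor one gets 0 * 0 / 0 = 0. *)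

definition levi_civita ::
  "('n::finite) point \<Rightarrow> 'n point \<Rightarrow> 'n point \<Rightarrow> 'n point \<Rightarrow> 'n point" where
  "levi_civita = (\<lambda>(S, Q, V, a, b) (\<Xi>S, \<Xi>Q, \<Xi>V, \<xi>a, \<xi>b) (HS, HQ, HV, \<eta>a, \<eta>b)
       (dS, dQ, dV, da, db).
     (proj_OB S dS, proj_Orth Q dQ, dV, (\<chi> i. da $ i - \<xi>a $ i * \<eta>a $ i / a $ i), db))"

(* The covariant derivative of the gradient in direction \<xi>, for \<xi> tangent at x. *)

definition rhess ::
  "nat \<Rightarrow> nat \<Rightarrow> (('n::{finite,linorder}) point \<Rightarrow> real) \<Rightarrow> 'n point \<Rightarrow> 'n point \<Rightarrow> 'n point" where
  "rhess s t f x \<xi> = (THE \<eta>.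
     \<exists>D. (rgrad s t f has_derivative D) (at x within manifold s t) \<and>
         \<eta> = levi_civita x \<xi> (rgrad s t f x) (D \<xi>))"


definition retr_OB_normalize :: "'n rmat \<Rightarrow> 'n rmat \<Rightarrow> ('n::finite) rmat" where
  "retr_OB_normalize S \<Xi> = (\<chi> i. (1 / norm (S $ i + \<Xi> $ i)) *\<^sub>R (S $ i + \<Xi> $ i))"

(* Row-wise exponential map of the unit sphere; a zero row of \<Xi> gives the row of S. *)
definition retr_OB_exp :: "'n rmat \<Rightarrow> 'n rmat \<Rightarrow> ('n::finite) rmat" where
  "retr_OB_exp S \<Xi> = (\<chi> i. cos (norm (\<Xi> $ i)) *\<^sub>R S $ i
     + (sin (norm (\<Xi> $ i)) / norm (\<Xi> $ i)) *\<^sub>R \<Xi> $ i)"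

definition qf :: "'n rmat \<Rightarrow> ('n::{finite,linorder}) rmat" where
  "qf A = (THE Q. orthogonal_matrix Q \<and>
     (\<exists>R. (\<forall>i j. j < i \<longrightarrow> R $ i $ j = 0) \<and> (\<forall>i. 0 < R $ i $ i) \<and> A = Q ** R))"

definition mat_exp :: "'n rmat \<Rightarrow> ('n::finite) rmat" where
  "mat_exp A = (\<Sum>k. (1 / fact k) *\<^sub>R (((**) A ^^ k) (mat 1)))"

definition retr_Orth_qr :: "'n rmat \<Rightarrow> 'n rmat \<Rightarrow> ('n::{finite,linorder}) rmat" where
  "retr_Orth_qr Q \<Xi> = qf (Q + \<Xi>)"

definition retr_Orth_exp :: "'n rmat \<Rightarrow> 'n rmat \<Rightarrow> ('n::{finite,linorder}) rmat" where
  "retr_Orth_exp Q \<Xi> = Q ** mat_exp (transpose Q ** \<Xi>)"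

definition retraction_map ::
  "('n rmat \<Rightarrow> 'n rmat \<Rightarrow> 'n rmat) \<Rightarrow> ('n rmat \<Rightarrow> 'n rmat \<Rightarrow> 'n rmat) \<Rightarrow>
   ('n::finite) point \<Rightarrow> 'n point \<Rightarrow> 'n point" where
  "retraction_map rS rQ = (\<lambda>(S, Q, V, a, b) (\<Xi>S, \<Xi>Q, \<Xi>V, \<xi>a, \<xi>b).
     (rS S \<Xi>S, rQ Q \<Xi>Q, V + \<Xi>V, (\<chi> i. a $ i * exp (\<xi>a $ i / a $ i)), b + \<xi>b))"

definition is_retraction_choice :: "(('n::{finite,linorder}) point \<Rightarrow> 'n point \<Rightarrow> 'n point) \<Rightarrow> bool" where
  "is_retraction_choice R \<longleftrightarrow>
     (\<exists>rS\<in>{retr_OB_normalize, retr_OB_exp}. \<exists>rQ\<in>{retr_Orth_qr, retr_Orth_exp}.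
        R = retraction_map rS rQ)"

(* Transport of a tangent vector at x to the tangent space at R x \<theta>. *)
definition transport ::
  "(('n::finite) point \<Rightarrow> 'n point \<Rightarrow> 'n point) \<Rightarrow> 'n point \<Rightarrow> 'n point \<Rightarrow> 'n point \<Rightarrow> 'n point" where
  "transport R x \<theta> = (case R x \<theta> of (S, Q, V, a, b) \<Rightarrow>
     (\<lambda>(\<Xi>S, \<Xi>Q, \<Xi>V, \<xi>a, \<xi>b). (proj_OB S \<Xi>S, proj_Orth Q \<Xi>Q, \<Xi>V, \<xi>a, \<xi>b)))"


definition initial_step ::
  "nat \<Rightarrow> nat \<Rightarrow> (('n::{finite,linorder}) point \<Rightarrow> real) \<Rightarrow> real \<Rightarrow> 'n point \<Rightarrow> 'n point \<Rightarrow> real" where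
  "initial_step s t f \<alpha>star x d =
     (if riem_metric t x d (rhess s t f x d) \<noteq> 0
      then \<bar>riem_metric t x d (rgrad s t f x) / riem_metric t x d (rhess s t f x d)\<bar>
      else \<alpha>star)"

definition sufficient_decrease ::
  "nat \<Rightarrow> (('n::{finite,linorder}) point \<Rightarrow> 'n point \<Rightarrow> 'n point) \<Rightarrow> ('n point \<Rightarrow> real) \<Rightarrow>
   real \<Rightarrow> 'n point \<Rightarrow> 'n point \<Rightarrow> real \<Rightarrow> bool" where
  "sufficient_decrease t R f \<delta> x d \<alpha> \<longleftrightarrow>
     f (R x (\<alpha> *\<^sub>R d)) - f x < - \<delta> * \<alpha>\<^sup>2 * (rnorm t x d)\<^sup>2"

(* l1 and l2 are the values of l at which the first and the second loop end.  The second
   loop is run only if l1 = 0; then l2 > 0, because the trial step for l = 0 satisfies the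
   decrease condition.  LEAST does not presuppose that the loops end: the value is
   unspecified if one of them does not. *)

definition line_search ::
  "nat \<Rightarrow> nat \<Rightarrow> (('n::{finite,linorder}) point \<Rightarrow> 'n point \<Rightarrow> 'n point) \<Rightarrow> ('n point \<Rightarrow> real) \<Rightarrow>
   real \<Rightarrow> real \<Rightarrow> real \<Rightarrow> 'n point \<Rightarrow> 'n point \<Rightarrow> real" where
  "line_search s t R f \<tau> \<delta> \<alpha>star x d =
     (let \<alpha>0 = initial_step s t f \<alpha>star x d;
          l1 = (LEAST l. sufficient_decrease t R f \<delta> x d (\<tau> ^ l * \<alpha>0));
          l2 = (LEAST l. \<not> sufficient_decrease t R f \<delta> x d ((1 / \<tau>) ^ l * \<alpha>0))
      in if 0 < l1 then \<tau> ^ l1 * \<alpha>0 else (1 / \<tau>) ^ (l2 - 1) * \<alpha>0)"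

end

theory Submission
  imports Defs
begin

text \<open>
  By construction \<open>\<langle>g_k, d_k\<rangle> = - \<parallel>g_k\<parallel>\<^sup>2\<close>, so backtracking ends, \<open>F(x_k)\<close> decreases and
  \<open>\<alpha>_k \<parallel>d_k\<parallel> \<rightarrow> 0\<close>. The iterates stay in a sublevel set of \<open>F\<close>, which is compact: \<open>S \<circ> S\<close> is bounded on
  \<open>OB(n)\<close>, hence so is \<open>T (D + V) T\<^sup>-\<^sup>1\<close>, and the off-diagonal entries of its diagonal blocks are
  \<open>- Im \<lambda> / a\<^sup>2\<close> and \<open>Im \<lambda> (a\<^sup>2 + b\<^sup>2)\<close> with \<open>Im \<lambda> \<noteq> 0\<close>. If \<open>\<parallel>g_k\<parallel>\<close> were bounded away from \<open>0\<close>, then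
  \<open>y_k \<rightarrow> 0\<close> by uniform continuity and the recursion for \<open>d_k\<close> would keep \<open>d_k\<close> bounded. The additional
  step of the line search ensures that \<open>\<alpha>_k / \<tau>\<close> always violates the decrease condition; the first order
  expansion of \<open>F\<close> along the retraction, uniform on the sublevel set, then yields
  \<open>\<parallel>g_k\<parallel>\<^sup>2 \<le> o(1) \<parallel>d_k\<parallel> + \<delta> \<alpha>_k \<parallel>d_k\<parallel>\<^sup>2 / \<tau> \<rightarrow> 0\<close>, a contradiction. Of the Hessian only the positivity
  of the resulting trial step matters.
\<close>

section \<open>Convergence of the conjugate gradient iteration on a compact set\<close>

text \<open>No abstract manifold theory enters. Everything lives in the ambient Euclidean space of
  five-tuples, tangent spaces form a set-valued map, and the iteration is analysed in the locale
  \<open>prp_setting\<close>, whose assumptions are then verified on the sublevel set of the initial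
  value. All choices of the retraction are treated alike through two facts: \<open>R x \<xi>\<close>
  stays on the manifold, and \<open>R x \<xi>\<close> is \<open>x + \<xi>\<close> up to an error
  that is small compared with \<open>norm \<xi>\<close>, uniformly as long as the entries of
  \<open>a\<close> stay away from 0. The transport need not preserve lengths; its bound only enters
  a constant in front of \<open>norm (y k)\<close>, which tends to 0. Two definitions by description
  have to be made usable. \<open>rgrad\<close> refers to a derivative within a set with empty
  interior, which is determined only in tangent directions; curves
  \<open>R x (h *\<^sub>R \<xi>)\<close> give uniqueness there. \<open>qf\<close> is characterized
  by uniqueness of the QR decomposition, so its first order behaviour is drawn from the Gram matrix
  of the triangular factor.\<close>

lemma line_search_result:
  fixes \<tau> \<alpha>0 :: real and P :: "real \<Rightarrow> bool"
  assumes \<tau>: "0 < \<tau>" "\<tau> < 1" and \<alpha>0: "0 < \<alpha>0"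
    and small: "0 < \<eta>" "\<And>\<alpha>. 0 < \<alpha> \<Longrightarrow> \<alpha> < \<eta> \<Longrightarrow> P \<alpha>"
    and large: "\<And>\<alpha>. N < \<alpha> \<Longrightarrow> \<not> P \<alpha>"
  defines "l1 \<equiv> (LEAST l. P (\<tau> ^ l * \<alpha>0))" and "l2 \<equiv> (LEAST l. \<not> P ((1 / \<tau>) ^ l * \<alpha>0))"
  defines "\<alpha> \<equiv> (if 0 < l1 then \<tau> ^ l1 * \<alpha>0 else (1 / \<tau>) ^ (l2 - 1) * \<alpha>0)"
  shows "0 < \<alpha>" "P \<alpha>" "\<not> P (\<alpha> / \<tau>)"
proof -
  show "0 < \<alpha>" using \<tau> \<alpha>0 by (simp add: \<alpha>_def)
  obtain l where "\<tau> ^ l < \<eta> / \<alpha>0"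
    using real_arch_pow_inv[of "\<eta> / \<alpha>0" \<tau>] \<tau> \<alpha>0 small by auto
  then have "P (\<tau> ^ l * \<alpha>0)" using \<tau> \<alpha>0 by (intro small) (auto simp: field_simps)
  then have l1: "P (\<tau> ^ l1 * \<alpha>0)" unfolding l1_def by (rule LeastI)
  obtain l' where "N / \<alpha>0 < (1 / \<tau>) ^ l'"
    using real_arch_pow[of "1 / \<tau>" "N / \<alpha>0"] \<tau> by auto
  then have "\<not> P ((1 / \<tau>) ^ l' * \<alpha>0)" using \<tau> \<alpha>0 by (intro large) (auto simp: field_simps)
  then have l2: "\<not> P ((1 / \<tau>) ^ l2 * \<alpha>0)" unfolding l2_def by (rule LeastI)
  have "P \<alpha> \<and> \<not> P (\<alpha> / \<tau>)"
  proof (cases "0 < l1")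
    case True
    \<comment> \<open>Every trial before \<open>l1\<close> was rejected, so
      \<open>\<alpha> / \<tau>\<close> is the last rejected one.\<close>
    have "\<not> P (\<tau> ^ (l1 - 1) * \<alpha>0)"
      using not_less_Least[of "l1 - 1" "\<lambda>l. P (\<tau> ^ l * \<alpha>0)"] True by (simp add: l1_def)
    moreover have "\<alpha> / \<tau> = \<tau> ^ (l1 - 1) * \<alpha>0"
      using True \<tau> by (simp add: \<alpha>_def power_eq_if)
    ultimately show ?thesis using l1 True by (simp add: \<alpha>_def)
  next
    case False
    then have "P \<alpha>0" using l1 by simp
    \<comment> \<open>\<open>\<alpha>0\<close> itself is accepted, so \<open>l2 - 1\<close> does not
      truncate: \<open>\<alpha>\<close> is the last accepted trial and
      \<open>\<alpha> / \<tau>\<close> the first rejected one.\<close>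
    then have "0 < l2" using l2 by (cases l2) auto
    then have "P ((1 / \<tau>) ^ (l2 - 1) * \<alpha>0)"
      using not_less_Least[of "l2 - 1" "\<lambda>l. \<not> P ((1 / \<tau>) ^ l * \<alpha>0)"] by (simp add: l2_def)
    moreover have "\<alpha> / \<tau> = (1 / \<tau>) ^ l2 * \<alpha>0"
      using False \<open>0 < l2\<close> \<tau> by (simp add: \<alpha>_def power_eq_if)
    ultimately show ?thesis using l2 False by (simp add: \<alpha>_def)
  qed
  then show "P \<alpha>" "\<not> P (\<alpha> / \<tau>)" by auto
qed

lemma eventually_bounded_contraction:
  fixes a :: "nat \<Rightarrow> real"
  assumes "\<And>k. N \<le> k \<Longrightarrow> a (Suc k) \<le> G + a k / 2" "\<And>k. 0 \<le> a k"
  obtains B where "0 < B" "\<And>k. N \<le> k \<Longrightarrow> a k \<le> B"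
proof
  have "0 \<le> G + a N / 2" using assms order_trans[OF assms(2)] by blast
  \<comment> \<open>The map sending \<open>u\<close> to \<open>G + u / 2\<close> has the fixed point
    \<open>2 * G\<close>, so a level above it and above \<open>a N\<close> is never exceeded; the 1
    makes it positive.\<close>
  then show "0 < \<bar>2 * G\<bar> + a N + 1" using assms(2)[of N] by linarith
  fix k assume "N \<le> k"
  then show "a k \<le> \<bar>2 * G\<bar> + a N + 1"
  proof (induction k rule: dec_induct)
    case (step k)
    then show ?case using assms(1)[of k] assms(2)[of N] by linarith
  qed auto
qed

text \<open>\<open>K\<close> stands for a sublevel set, \<open>T\<close> for the tangent spaces,
  \<open>m\<close> for the metric and \<open>P x\<close> for the transport into the tangent space at
  \<open>x\<close>; the transport depends on its direction only through the end point, hence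
  \<open>P\<close> takes just that point. On \<open>K\<close> the metric is comparable with the
  Euclidean norm, so estimates are made in the latter. \<open>f_first_order\<close> is uniform in
  \<open>x\<close> and does not ask \<open>R x \<xi>\<close> to lie in \<open>K\<close>, since
  rejected trial points may leave it.\<close>

locale prp_setting =
  fixes K :: "'e::euclidean_space set" and T :: "'e \<Rightarrow> 'e set"
    and m :: "'e \<Rightarrow> 'e \<Rightarrow> 'e \<Rightarrow> real" and R P :: "'e \<Rightarrow> 'e \<Rightarrow> 'e"
    and f :: "'e \<Rightarrow> real" and grad :: "'e \<Rightarrow> 'e" and c C B :: real
  assumes compact_K: "compact K"
    and T_subspace: "\<And>x. x \<in> K \<Longrightarrow> subspace (T x)"
    and m_bilinear: "\<And>x. bilinear (m x)"
    and m_sym: "\<And>x \<xi> \<eta>. m x \<xi> \<eta> = m x \<eta> \<xi>"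
    and c_pos: "0 < c"
    and m_lower: "\<And>x \<xi>. x \<in> K \<Longrightarrow> \<xi> \<in> T x \<Longrightarrow> c * (norm \<xi>)\<^sup>2 \<le> m x \<xi> \<xi>"
    and m_upper: "\<And>x \<xi> \<eta>. x \<in> K \<Longrightarrow> \<bar>m x \<xi> \<eta>\<bar> \<le> C * norm \<xi> * norm \<eta>"
    and grad_in: "\<And>x. x \<in> K \<Longrightarrow> grad x \<in> T x"
    and grad_cont: "continuous_on K grad"
    and P_in: "\<And>x y \<xi>. x \<in> K \<Longrightarrow> y \<in> K \<Longrightarrow> \<xi> \<in> T y \<Longrightarrow> P x \<xi> \<in> T x"
    and P_id: "\<And>x \<xi>. x \<in> K \<Longrightarrow> \<xi> \<in> T x \<Longrightarrow> P x \<xi> = \<xi>"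
    and P_bound: "\<And>x \<xi>. x \<in> K \<Longrightarrow> norm (P x \<xi>) \<le> B * norm \<xi>"
    and P_cont: "continuous_on (K \<times> UNIV) (\<lambda>(x, \<xi>). P x \<xi>)"
    and R_near: "\<exists>\<eta>>0. \<forall>x\<in>K. \<forall>\<xi>\<in>T x. norm \<xi> < \<eta> \<longrightarrow> norm (R x \<xi> - x) \<le> 2 * norm \<xi>"
    and f_first_order: "\<And>\<epsilon>. 0 < \<epsilon> \<Longrightarrow> \<exists>\<eta>>0. \<forall>x\<in>K. \<forall>\<xi>\<in>T x. norm \<xi> < \<eta> \<longrightarrow>
          \<bar>f (R x \<xi>) - f x - m x (grad x) \<xi>\<bar> \<le> \<epsilon> * norm \<xi>"
    and f_nonneg: "\<And>x \<xi>. x \<in> K \<Longrightarrow> \<xi> \<in> T x \<Longrightarrow> 0 \<le> f (R x \<xi>)"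
    and sublevel: "\<And>x \<xi>. x \<in> K \<Longrightarrow> \<xi> \<in> T x \<Longrightarrow> f (R x \<xi>) \<le> f x \<Longrightarrow> R x \<xi> \<in> K"
begin

abbreviation decrease :: "real \<Rightarrow> 'e \<Rightarrow> 'e \<Rightarrow> real \<Rightarrow> bool" where
  "decrease \<delta> x d \<alpha> \<equiv> f (R x (\<alpha> *\<^sub>R d)) - f x < - \<delta> * \<alpha>\<^sup>2 * m x d d"

lemma m_nonneg: "x \<in> K \<Longrightarrow> \<xi> \<in> T x \<Longrightarrow> 0 \<le> m x \<xi> \<xi>"
  using m_lower[of x \<xi>] c_pos by (meson mult_nonneg_nonneg less_imp_le order_trans zero_le_power2)

lemma C_nonneg:
  fixes \<xi> :: 'e
  shows "x \<in> K \<Longrightarrow> \<xi> \<noteq> 0 \<Longrightarrow> 0 \<le> C"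
proof -
  assume "x \<in> K" "\<xi> \<noteq> 0"
  then have "0 \<le> C * norm \<xi> * norm \<xi>" using m_upper[of x \<xi> \<xi>] by linarith
  then show ?thesis using \<open>\<xi> \<noteq> 0\<close> by (simp add: zero_le_mult_iff)
qed

text \<open>The linear term \<open>- \<alpha> * p\<close> dominates: half of it absorbs the first
  order error, the other half the quadratic term.\<close>

lemma decrease_small:
  assumes "x \<in> K" "d \<in> T x" "m x (grad x) d < 0" "0 \<le> \<delta>"
  shows "\<exists>\<eta>>0. \<forall>\<alpha>. 0 < \<alpha> \<and> \<alpha> < \<eta> \<longrightarrow> decrease \<delta> x d \<alpha>"
proof -
  define p where "p = - m x (grad x) d"
  have p: "0 < p" using assms by (simp add: p_def)
  have d: "d \<noteq> 0" using assms(3) bilinear_rzero[OF m_bilinear] by force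
  obtain \<eta> where \<eta>: "0 < \<eta>" "\<And>\<xi>. \<xi> \<in> T x \<Longrightarrow> norm \<xi> < \<eta> \<Longrightarrow>
      \<bar>f (R x \<xi>) - f x - m x (grad x) \<xi>\<bar> \<le> (p / (2 * norm d)) * norm \<xi>"
    using f_first_order[of "p / (2 * norm d)"] p d assms(1) by auto
  \<comment> \<open>The first bound makes the expansion applicable; the second keeps
    \<open>\<alpha> * (\<delta> * m x d d)\<close> below \<open>p / 2\<close>, with 1 added against
    division by zero.\<close>
  define \<mu> where "\<mu> = min (\<eta> / norm d) (p / (2 * (\<delta> * m x d d + 1)))"
  have q: "0 \<le> \<delta> * m x d d" using assms m_nonneg by simp
  have "0 < \<mu>" using \<eta> d p q by (simp add: \<mu>_def)
  moreover have "decrease \<delta> x d \<alpha>" if \<alpha>: "0 < \<alpha>" "\<alpha> < \<mu>" for \<alpha>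
  proof -
    have "norm (\<alpha> *\<^sub>R d) < \<eta>" using \<alpha> d by (simp add: \<mu>_def field_simps)
    moreover have "\<alpha> *\<^sub>R d \<in> T x" using T_subspace assms subspace_scale by blast
    ultimately have "\<bar>f (R x (\<alpha> *\<^sub>R d)) - f x - m x (grad x) (\<alpha> *\<^sub>R d)\<bar>
        \<le> (p / (2 * norm d)) * norm (\<alpha> *\<^sub>R d)" by (rule \<eta>(2)[rotated])
    also have "\<dots> = \<alpha> * p / 2" using d \<alpha> by (simp add: field_simps)
    finally have 1: "f (R x (\<alpha> *\<^sub>R d)) - f x \<le> \<alpha> * p / 2 - \<alpha> * p"
      by (simp add: bilinear_rmul[OF m_bilinear] p_def)
    have "\<alpha> * (\<delta> * m x d d + 1) < p / 2" using \<alpha> q by (simp add: \<mu>_def field_simps)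
    then have "\<alpha> * (\<delta> * m x d d) < p / 2" using \<alpha> by (simp add: distrib_left)
    then have "\<alpha> * (\<alpha> * (\<delta> * m x d d)) < \<alpha> * (p / 2)" using \<alpha> mult_strict_left_mono by blast
    then show ?thesis using 1 by (simp add: power2_eq_square algebra_simps)
  qed
  ultimately show ?thesis by blast
qed

text \<open>\<open>f\<close> is bounded below by 0 along the retraction while the demanded decrease
  grows quadratically; hence the enlarging loop of the line search ends.\<close>

lemma decrease_not_large:
  assumes "x \<in> K" "d \<in> T x" "d \<noteq> 0" "0 < \<delta>"
  shows "\<exists>N. \<forall>\<alpha>>N. \<not> decrease \<delta> x d \<alpha>"
proof -
  have q: "0 < \<delta> * m x d d" using m_lower[of x d] assms c_pos
    by (smt (verit) mult_pos_pos zero_less_norm_iff zero_less_power)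
  have "\<not> decrease \<delta> x d \<alpha>" if \<alpha>: "max 1 (f x / (\<delta> * m x d d)) < \<alpha>" for \<alpha>
  proof -
    have "f x < \<alpha> * (\<delta> * m x d d)" using \<alpha> q by (simp add: field_simps)
    also have "\<dots> \<le> \<alpha>\<^sup>2 * (\<delta> * m x d d)"
      using \<alpha> q by (intro mult_right_mono) (auto simp: power2_eq_square)
    finally have "f x < \<alpha>\<^sup>2 * (\<delta> * m x d d)" .
    moreover have "0 \<le> f (R x (\<alpha> *\<^sub>R d))"
      using f_nonneg assms T_subspace subspace_scale by blast
    ultimately show ?thesis by (simp add: algebra_simps)
  qed
  then show ?thesis by blast
qed

theorem liminf_zero:
  fixes x d y dt :: "nat \<Rightarrow> 'e" and \<alpha> \<beta> \<theta> :: "nat \<Rightarrow> real" and init :: "'e \<Rightarrow> 'e \<Rightarrow> real"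
  defines "g \<equiv> \<lambda>k. grad (x k)"
  assumes params: "0 < \<tau>" "\<tau> < 1" "0 < \<delta>"
    and x_0: "x 0 \<in> K"
    and d_0: "d 0 = - g 0"
    and init: "\<And>x d. x \<in> K \<Longrightarrow> m x d (grad x) \<noteq> 0 \<Longrightarrow> 0 < init x d"
    and \<alpha>: "\<And>k. \<alpha> k =
      (let \<alpha>0 = init (x k) (d k);
          l1 = (LEAST l. decrease \<delta> (x k) (d k) (\<tau> ^ l * \<alpha>0));
          l2 = (LEAST l. \<not> decrease \<delta> (x k) (d k) ((1 / \<tau>) ^ l * \<alpha>0))
      in if 0 < l1 then \<tau> ^ l1 * \<alpha>0 else (1 / \<tau>) ^ (l2 - 1) * \<alpha>0)"
    and x_Suc: "\<And>k. x (Suc k) = R (x k) (\<alpha> k *\<^sub>R d k)"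
    and y: "\<And>k. y k = g (Suc k) - P (x (Suc k)) (g k)"
    and dt: "\<And>k. dt k = P (x (Suc k)) (d k)"
    and \<beta>: "\<And>k. \<beta> k = m (x (Suc k)) (g (Suc k)) (y k) / m (x k) (g k) (g k)"
    and \<theta>: "\<And>k. \<theta> k = m (x (Suc k)) (g (Suc k)) (dt k) / m (x k) (g k) (g k)"
    and d_Suc: "\<And>k. d (Suc k) = - g (Suc k) + \<beta> k *\<^sub>R dt k - \<theta> k *\<^sub>R y k"
    and no_stop: "\<And>k. 0 < m (x k) (g k) (g k)"
  shows "liminf (\<lambda>k. ereal (sqrt (m (x k) (g k) (g k)))) = 0"
proof -
  \<comment> \<open>Stated under the invariant at \<open>k\<close>, because the induction for
    \<open>inv\<close> uses it at \<open>k\<close> to reach \<open>Suc k\<close>.\<close>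
  have step: "0 < \<alpha> k" "decrease \<delta> (x k) (d k) (\<alpha> k)" "\<not> decrease \<delta> (x k) (d k) (\<alpha> k / \<tau>)"
    if k: "x k \<in> K" "d k \<in> T (x k)" "m (x k) (g k) (d k) = - m (x k) (g k) (g k)" for k
  proof -
    have neg: "m (x k) (g k) (d k) < 0" using k no_stop by simp
    then have "d k \<noteq> 0" using bilinear_rzero[OF m_bilinear] by force
    obtain \<eta> where \<eta>: "0 < \<eta>" "\<And>\<alpha>. 0 < \<alpha> \<Longrightarrow> \<alpha> < \<eta> \<Longrightarrow> decrease \<delta> (x k) (d k) \<alpha>"
      using decrease_small[OF k(1,2), of \<delta>] neg params by (auto simp: g_def)
    obtain N where N: "\<And>\<alpha>. N < \<alpha> \<Longrightarrow> \<not> decrease \<delta> (x k) (d k) \<alpha>"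
      using decrease_not_large[OF k(1,2) \<open>d k \<noteq> 0\<close>] params by auto
    have i: "0 < init (x k) (d k)"
      using neg by (intro init k) (auto simp: m_sym g_def)
    note 1 = line_search_result[where P = "decrease \<delta> (x k) (d k)", OF params(1,2) i \<eta> N]
    show "0 < \<alpha> k" "decrease \<delta> (x k) (d k) (\<alpha> k)" "\<not> decrease \<delta> (x k) (d k) (\<alpha> k / \<tau>)"
      unfolding \<alpha> Let_def using 1 by blast+
  qed
  have inv: "x k \<in> K \<and> d k \<in> T (x k) \<and> m (x k) (g k) (d k) = - m (x k) (g k) (g k)" for k
  proof (induction k)
    case 0
    show ?case using x_0 grad_in[OF x_0] T_subspace[OF x_0]
      by (auto simp: d_0 g_def subspace_neg bilinear_rneg[OF m_bilinear])
  next
    case (Suc k)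
    let ?x = "x (Suc k)" and ?m = "m (x (Suc k)) (g (Suc k))"
    have "\<alpha> k *\<^sub>R d k \<in> T (x k)" using Suc T_subspace subspace_scale by blast
    moreover have "f ?x \<le> f (x k)"
    proof -
      have "0 \<le> \<delta> * (\<alpha> k)\<^sup>2 * m (x k) (d k) (d k)" using params m_nonneg Suc by simp
      then show ?thesis using step(2) Suc unfolding x_Suc by fastforce
    qed
    ultimately have x: "?x \<in> K" using sublevel Suc by (simp add: x_Suc)
    have g: "g (Suc k) \<in> T ?x" using grad_in x by (simp add: g_def)
    have dt': "dt k \<in> T ?x" using P_in[OF x] Suc by (auto simp: dt)
    have y': "y k \<in> T ?x"
      using P_in[OF x] Suc grad_in g T_subspace[OF x] by (auto simp: y g_def intro!: subspace_diff)
    have d: "d (Suc k) \<in> T ?x" unfolding d_Suc using g dt' y' T_subspace[OF x]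
      by (intro subspace_diff subspace_add subspace_neg subspace_scale)
    \<comment> \<open>\<open>\<beta> k * ?m (dt k)\<close> and \<open>\<theta> k * ?m (y k)\<close>
      are both \<open>?m (y k) * ?m (dt k)\<close> divided by the same number, so they
      cancel.\<close>
    have "?m (d (Suc k)) = - ?m (g (Suc k)) + \<beta> k * ?m (dt k) - \<theta> k * ?m (y k)"
      unfolding d_Suc by (simp add: bilinear_radd[OF m_bilinear] bilinear_rsub[OF m_bilinear]
          bilinear_rmul[OF m_bilinear] bilinear_rneg[OF m_bilinear])
    also have "\<dots> = - ?m (g (Suc k))" by (simp add: \<beta> \<theta>)
    finally show ?case using x d by blast
  qed
  then have xK: "x k \<in> K" and dT: "d k \<in> T (x k)"
    and gd: "m (x k) (g k) (d k) = - m (x k) (g k) (g k)" for k by auto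
  note st = step[OF xK dT gd]
  have gT: "g k \<in> T (x k)" for k using grad_in xK by (simp add: g_def)
  have g_nz: "g k \<noteq> 0" for k using no_stop[of k] bilinear_rzero[OF m_bilinear] by force
  have C: "0 \<le> C" using C_nonneg[OF xK g_nz] .
  have B: "0 \<le> B" using P_bound[OF xK, of 0 "g 0"] g_nz[of 0]
    by (smt (verit) norm_ge_zero zero_le_mult_iff zero_less_norm_iff)

  define s where "s k = \<alpha> k * norm (d k)" for k
  have s0: "0 \<le> s k" for k using st(1)[of k] by (simp add: s_def)
  \<comment> \<open>Accepted steps lower \<open>f\<close> by at least a multiple of
    \<open>(s k)\<^sup>2\<close>. The values \<open>f (x k)\<close> converge, so their differences
    and hence \<open>s\<close> tend to 0.\<close>
  have decr: "\<delta> * c * (s k)\<^sup>2 \<le> f (x k) - f (x (Suc k))" for k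
  proof -
    have "\<delta> * (\<alpha> k)\<^sup>2 * (c * (norm (d k))\<^sup>2) \<le> \<delta> * (\<alpha> k)\<^sup>2 * m (x k) (d k) (d k)"
      using params m_lower[OF xK dT] by (intro mult_left_mono) auto
    then show ?thesis using st(2)[of k]
      by (simp add: x_Suc s_def power_mult_distrib algebra_simps)
  qed
  have fx0: "0 \<le> f (x (Suc k))" for k
    unfolding x_Suc using f_nonneg xK dT T_subspace subspace_scale by blast
  have "f (x (Suc k)) \<le> f (x k)" for k
    using decr[of k] params c_pos
    by (smt (verit) mult_nonneg_nonneg zero_le_power2)
  then have "decseq (\<lambda>k. f (x k))" by (simp add: decseq_Suc_iff)
  \<comment> \<open>\<open>f_nonneg\<close> speaks of points \<open>R x \<xi>\<close>, so the value
    at \<open>x 0\<close> is compared with that at its successor.\<close>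
  moreover have "\<forall>k. 0 \<le> f (x k)"
    using fx0 \<open>\<And>k. f (x (Suc k)) \<le> f (x k)\<close> order_trans by blast
  ultimately obtain L where L: "(\<lambda>k. f (x k)) \<longlonglongrightarrow> L" by (rule decseq_convergent)
  have up: "(\<lambda>k. (f (x k) - f (x (Suc k))) / (\<delta> * c)) \<longlonglongrightarrow> 0"
    using tendsto_divide_zero[OF tendsto_diff[OF L LIMSEQ_Suc[OF L], simplified]] .
  have "(\<lambda>k. (s k)\<^sup>2) \<longlonglongrightarrow> 0"
  proof (rule tendsto_sandwich[OF _ _ tendsto_const up])
    show "\<forall>\<^sub>F k in sequentially. (s k)\<^sup>2 \<le> (f (x k) - f (x (Suc k))) / (\<delta> * c)"
      using decr params c_pos by (simp add: field_simps)
  qed auto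
  then have s_lim: "s \<longlonglongrightarrow> 0"
    using tendsto_real_sqrt[of "\<lambda>k. (s k)\<^sup>2" 0 sequentially] s0 by simp
  obtain \<eta> where \<eta>: "0 < \<eta>"
    "\<And>x \<xi>. x \<in> K \<Longrightarrow> \<xi> \<in> T x \<Longrightarrow> norm \<xi> < \<eta> \<Longrightarrow> norm (R x \<xi> - x) \<le> 2 * norm \<xi>"
    using R_near by blast
  have scaleT: "r *\<^sub>R d k \<in> T (x k)" for r k using T_subspace xK dT subspace_scale by blast
  have norm_\<alpha>d: "norm (\<alpha> k *\<^sub>R d k) = s k" for k using st(1)[of k] by (simp add: s_def)
  have dist_lim: "(\<lambda>k. dist (x k, x (Suc k)) (x k, x k)) \<longlonglongrightarrow> 0"
  proof (rule tendsto_sandwich[OF _ _ tendsto_const])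
    show "\<forall>\<^sub>F k in sequentially. dist (x k, x (Suc k)) (x k, x k) \<le> 2 * s k"
      using order_tendstoD(2)[OF s_lim \<eta>(1)]
    proof eventually_elim
      case (elim k)
      then show ?case using \<eta>(2)[OF xK scaleT, of "\<alpha> k" k]
        by (simp add: dist_Pair_Pair x_Suc dist_norm norm_\<alpha>d del: norm_scaleR)
    qed
    show "(\<lambda>k. 2 * s k) \<longlonglongrightarrow> 0" using tendsto_mult_right_zero[OF s_lim, of 2] by simp
  qed simp
  \<comment> \<open>\<open>y k\<close> is the value of \<open>h\<close> at
    \<open>(x k, x (Suc k))\<close>, a pair whose distance to the diagonal tends to 0, and
    \<open>h\<close> vanishes on the diagonal since \<open>P x\<close> fixes the tangent vectors at
    \<open>x\<close>.\<close>
  define h where "h = (\<lambda>(u, v). grad v - P v (grad u))"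
  have "continuous_on (K \<times> K) (\<lambda>p. (\<lambda>(x, \<xi>). P x \<xi>) (snd p, grad (fst p)))"
    by (rule continuous_on_compose2[OF P_cont])
      (auto intro!: continuous_intros continuous_on_compose2[OF grad_cont])
  then have "continuous_on (K \<times> K) h"
    unfolding h_def case_prod_unfold
    by (intro continuous_on_diff continuous_on_compose2[OF grad_cont] continuous_on_snd
        continuous_on_id) auto
  then have "uniformly_continuous_on (K \<times> K) h"
    using compact_K compact_Times compact_uniformly_continuous by blast
  then have "(\<lambda>k. dist (h (x k, x (Suc k))) (h (x k, x k))) \<longlonglongrightarrow> 0"
    unfolding uniformly_continuous_on_sequentially using dist_lim xK by auto
  moreover have "h (x k, x k) = 0" for k using P_id[OF xK gT] by (simp add: h_def g_def)
  ultimately have "(\<lambda>k. norm (h (x k, x (Suc k)))) \<longlonglongrightarrow> 0" by simp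
  moreover have "h (x k, x (Suc k)) = y k" for k by (simp add: h_def y g_def)
  ultimately have y_lim: "(\<lambda>k. norm (y k)) \<longlonglongrightarrow> 0" by simp
  have "bounded (grad ` K)"
    using compact_K grad_cont compact_continuous_image compact_imp_bounded by blast
  then obtain G where G: "0 < G" "\<And>k. norm (g k) \<le> G"
    unfolding bounded_pos using xK by (auto simp: g_def)
  show ?thesis
  proof (rule ccontr)
    let ?l = "liminf (\<lambda>k. ereal (sqrt (m (x k) (g k) (g k))))"
    assume "?l \<noteq> 0"
    moreover have "0 \<le> ?l"
      by (rule Liminf_bounded) (use no_stop less_imp_le in \<open>auto intro!: always_eventually\<close>)
    ultimately have "0 < ?l" by simp
    then obtain e where e: "0 < e" "ereal e < ?l"
      using ereal_dense2[of 0 ?l] by auto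
    from less_LiminfD[OF e(2)] obtain N1 where N1: "\<And>k. N1 \<le> k \<Longrightarrow> e < sqrt (m (x k) (g k) (g k))"
      unfolding eventually_sequentially by auto
    have gg: "e\<^sup>2 \<le> m (x k) (g k) (g k)" if "N1 \<le> k" for k
      using N1[OF that] e by (metis less_imp_le not_less real_le_lsqrt)
    \<comment> \<open>\<open>\<beta> k *\<^sub>R dt k\<close> and
      \<open>\<theta> k *\<^sub>R y k\<close> each have norm at most
      \<open>C * G * B / e\<^sup>2 * norm (y k) * norm (d k)\<close>: \<open>y k\<close> enters the
      first through \<open>\<beta> k\<close> and the second directly.\<close>
    define A where "A = 2 * (C * G * B / e\<^sup>2)"
    have A: "0 \<le> A" using C B G by (simp add: A_def)
    have d_le: "norm (d (Suc k)) \<le> G + (A * norm (y k)) * norm (d k)" if k: "N1 \<le> k" for k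
    proof -
      have P: "norm (dt k) \<le> B * norm (d k)" using P_bound xK by (simp add: dt)
      have m': "\<bar>m (x (Suc k)) (g (Suc k)) z\<bar> \<le> C * G * norm z" for z
      proof -
        have "C * norm (g (Suc k)) * norm z \<le> C * G * norm z"
          using C G by (intro mult_right_mono mult_left_mono) auto
        then show ?thesis using m_upper[OF xK, of "Suc k" "g (Suc k)" z] by linarith
      qed
      have quot: "\<bar>a / m (x k) (g k) (g k)\<bar> \<le> b / e\<^sup>2" if "\<bar>a\<bar> \<le> b" for a b
        unfolding abs_divide using gg[OF k] e that by (intro frac_le) auto
      have "norm (\<beta> k *\<^sub>R dt k) \<le> (C * G * norm (y k) / e\<^sup>2) * (B * norm (d k))"
        unfolding norm_scaleR \<beta> by (intro mult_mono quot m' P) (use C G in auto)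
      moreover have "norm (\<theta> k *\<^sub>R y k) \<le> (C * G * (B * norm (d k)) / e\<^sup>2) * norm (y k)"
        unfolding norm_scaleR \<theta>
      proof (intro mult_right_mono quot order_trans[OF m'])
        show "C * G * norm (dt k) \<le> C * G * (B * norm (d k))"
          using P C G by (intro mult_left_mono) auto
      qed auto
      moreover have "norm (d (Suc k)) \<le> norm (g (Suc k)) + norm (\<beta> k *\<^sub>R dt k) + norm (\<theta> k *\<^sub>R y k)"
        unfolding d_Suc by (metis (no_types, opaque_lifting) add_mono norm_minus_cancel norm_triangle_ineq
            norm_triangle_ineq4 order_refl order_trans)
      ultimately have "norm (d (Suc k)) \<le> G + (C * G * norm (y k) / e\<^sup>2) * (B * norm (d k))
          + (C * G * (B * norm (d k)) / e\<^sup>2) * norm (y k)"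
        using G(2)[of "Suc k"] by linarith
      also have "\<dots> = G + (A * norm (y k)) * norm (d k)" by (simp add: A_def field_simps)
      finally show ?thesis .
    qed
    have Ay: "(\<lambda>k. A * norm (y k)) \<longlonglongrightarrow> 0" using tendsto_mult_right_zero[OF y_lim] .
    then obtain N2 where N2: "\<And>k. N2 \<le> k \<Longrightarrow> A * norm (y k) < 1 / 2"
      using order_tendstoD(2)[OF Ay, of "1/2"] unfolding eventually_sequentially by auto
    define N where "N = max N1 N2"
    have "norm (d (Suc k)) \<le> G + norm (d k) / 2" if "N \<le> k" for k
    proof -
      have "(A * norm (y k)) * norm (d k) \<le> 1 / 2 * norm (d k)"
        using N2[of k] that by (intro mult_right_mono) (auto simp: N_def)
      then show ?thesis using d_le[of k] that by (auto simp: N_def)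
    qed
    from eventually_bounded_contraction[where a = "\<lambda>k. norm (d k)", OF this norm_ge_zero]
    obtain E where E: "0 < E" "\<And>k. N \<le> k \<Longrightarrow> norm (d k) \<le> E" by metis
    \<comment> \<open>Along a step \<open>r *\<^sub>R d k\<close>, of length at most
      \<open>r * E\<close>, this tolerance costs at most \<open>r * e\<^sup>2 / 4\<close>.\<close>
    obtain \<mu> where \<mu>: "0 < \<mu>" "\<And>x \<xi>. x \<in> K \<Longrightarrow> \<xi> \<in> T x \<Longrightarrow> norm \<xi> < \<mu> \<Longrightarrow>
        \<bar>f (R x \<xi>) - f x - m x (grad x) \<xi>\<bar> \<le> e\<^sup>2 / (4 * E) * norm \<xi>"
      using f_first_order[of "e\<^sup>2 / (4 * E)"] e E by auto
    have "\<delta> * C * E / \<tau> \<ge> 0" using params C E by simp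
    have s_lim': "(\<lambda>k. s k / \<tau>) \<longlonglongrightarrow> 0" "(\<lambda>k. \<delta> * C * E * (s k / \<tau>)) \<longlonglongrightarrow> 0"
      using tendsto_divide_zero[OF s_lim, of \<tau>] tendsto_mult_right_zero by blast+
    have "\<forall>\<^sub>F k in sequentially. s k / \<tau> < \<mu> \<and> \<delta> * C * E * (s k / \<tau>) < e\<^sup>2 / 4 \<and> N \<le> k"
      using \<mu>(1) e(1) by (intro eventually_conj order_tendstoD(2)[OF s_lim'(1)]
          order_tendstoD(2)[OF s_lim'(2)] eventually_ge_at_top) auto
    then obtain k where k: "s k / \<tau> < \<mu>" "\<delta> * C * E * (s k / \<tau>) < e\<^sup>2 / 4" "N \<le> k"
      using eventually_happens'[OF sequentially_bot] by blast
    \<comment> \<open>The rejected trial. The choice of \<open>k\<close> brings it into the range of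
      the expansion and will force \<open>\<delta> * r * m (x k) (d k) (d k)\<close> below
      \<open>e\<^sup>2 / 4\<close>.\<close>
    define r where "r = \<alpha> k / \<tau>"
    have r: "0 < r" using st(1)[of k] params by (simp add: r_def)
    have rs: "norm (r *\<^sub>R d k) = s k / \<tau>" using st(1)[of k] params by (simp add: r_def s_def)
    have rd: "norm (r *\<^sub>R d k) \<le> r * E" using r E(2)[OF k(3)] by simp
    have "\<bar>f (R (x k) (r *\<^sub>R d k)) - f (x k) - m (x k) (g k) (r *\<^sub>R d k)\<bar> \<le> e\<^sup>2 / (4 * E) * norm (r *\<^sub>R d k)"
      unfolding g_def by (rule \<mu>(2)[OF xK scaleT]) (simp only: rs k(1))
    also have "\<dots> \<le> e\<^sup>2 / (4 * E) * (r * E)" using rd E by (intro mult_left_mono) auto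
    also have "\<dots> = r * e\<^sup>2 / 4" using E by simp
    finally have "f (R (x k) (r *\<^sub>R d k)) - f (x k) \<le> r * e\<^sup>2 / 4 + r * m (x k) (g k) (d k)"
      unfolding bilinear_rmul[OF m_bilinear] abs_le_iff by simp
    moreover have "- \<delta> * r\<^sup>2 * m (x k) (d k) (d k) \<le> f (R (x k) (r *\<^sub>R d k)) - f (x k)"
      using st(3)[of k] by (simp add: r_def)
    moreover have "r * e\<^sup>2 \<le> r * m (x k) (g k) (g k)" using gg[of k] k(3) r by (simp add: N_def)
    \<comment> \<open>Rejection means that \<open>f\<close> drops by at most the demanded quadratic
      amount, whereas the expansion predicts a drop of at least
      \<open>r * (3/4 * e\<^sup>2)\<close>.\<close>
    ultimately have "r * (3/4 * e\<^sup>2) \<le> r * (\<delta> * r * m (x k) (d k) (d k))"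
      unfolding gd by (simp add: power2_eq_square algebra_simps)
    then have 1: "3/4 * e\<^sup>2 \<le> \<delta> * r * m (x k) (d k) (d k)" using r by simp
    have "m (x k) (d k) (d k) \<le> C * norm (d k) * E"
    proof -
      have "C * norm (d k) * norm (d k) \<le> C * norm (d k) * E"
        using E(2)[OF k(3)] C by (intro mult_left_mono) auto
      then show ?thesis using m_upper[OF xK, of k "d k" "d k"] by linarith
    qed
    then have "\<delta> * r * m (x k) (d k) (d k) \<le> \<delta> * r * (C * norm (d k) * E)"
      using params r by (intro mult_left_mono) auto
    also have "\<dots> = \<delta> * C * E * (s k / \<tau>)" by (simp add: r_def s_def)
    also have "\<dots> < e\<^sup>2 / 4" by (rule k(2))
    finally show False using 1 zero_le_power2[of e] by linarith
  qed
qed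

end

section \<open>Continuously differentiable functions\<close>

text \<open>The derivative is represented by its gradient vector, so that its continuity is plain
  continuity of \<open>G\<close>. It is the full derivative at \<open>x\<close>, not one within
  \<open>U\<close>; the set it is applied to is open.\<close>

definition C1_on :: "'a::euclidean_space set \<Rightarrow> ('a \<Rightarrow> real) \<Rightarrow> bool" where
  "C1_on U f \<longleftrightarrow> (\<exists>G. continuous_on U G \<and> (\<forall>x\<in>U. (f has_derivative (\<lambda>h. G x \<bullet> h)) (at x)))"

lemma C1_on_const [intro]: "C1_on U (\<lambda>x. c)"
  unfolding C1_on_def
  by (intro exI[of _ "\<lambda>_. 0"] conjI ballI has_derivative_eq_rhs[OF has_derivative_const]) auto

lemma C1_on_linear:
  assumes "linear f"
  shows "C1_on U f"
proof -
  have "(f has_derivative f) (at x)" for x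
    using assms linear_conv_bounded_linear bounded_linear_imp_has_derivative by blast
  moreover have "f = (\<lambda>h. adjoint f 1 \<bullet> h)"
    using adjoint_works[OF assms, of _ 1] by (auto simp: fun_eq_iff inner_commute)
  ultimately show ?thesis unfolding C1_on_def
    by (intro exI[of _ "\<lambda>_. adjoint f 1"]) auto
qed

lemma C1_on_continuous: "C1_on U f \<Longrightarrow> continuous_on U f"
  unfolding C1_on_def
  by (metis continuous_at_imp_continuous_on has_derivative_continuous)

lemma C1_on_add [intro]:
  assumes "C1_on U f" "C1_on U g"
  shows "C1_on U (\<lambda>x. f x + g x)"
proof -
  from assms obtain F G where "continuous_on U F" "continuous_on U G"
    "\<And>x. x \<in> U \<Longrightarrow> (f has_derivative (\<lambda>h. F x \<bullet> h)) (at x)"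
    "\<And>x. x \<in> U \<Longrightarrow> (g has_derivative (\<lambda>h. G x \<bullet> h)) (at x)"
    unfolding C1_on_def by metis
  then show ?thesis unfolding C1_on_def
    by (intro exI[of _ "\<lambda>x. F x + G x"])
      (auto intro!: continuous_intros derivative_eq_intros simp: inner_add_left)
qed

lemma C1_on_mult [intro]:
  assumes "C1_on U f" "C1_on U g"
  shows "C1_on U (\<lambda>x. f x * g x)"
proof -
  from assms obtain F G where "continuous_on U F" "continuous_on U G"
    "\<And>x. x \<in> U \<Longrightarrow> (f has_derivative (\<lambda>h. F x \<bullet> h)) (at x)"
    "\<And>x. x \<in> U \<Longrightarrow> (g has_derivative (\<lambda>h. G x \<bullet> h)) (at x)"
    unfolding C1_on_def by metis
  then show ?thesis unfolding C1_on_def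
    by (intro exI[of _ "\<lambda>x. g x *\<^sub>R F x + f x *\<^sub>R G x"])
      (auto intro!: continuous_intros derivative_eq_intros C1_on_continuous assms
        simp: inner_add_left algebra_simps)
qed

lemma C1_on_inverse [intro]:
  assumes "C1_on U f" "\<And>x. x \<in> U \<Longrightarrow> f x \<noteq> 0"
  shows "C1_on U (\<lambda>x. 1 / f x)"
proof -
  from assms obtain F where F: "continuous_on U F"
    "\<And>x. x \<in> U \<Longrightarrow> (f has_derivative (\<lambda>h. F x \<bullet> h)) (at x)"
    unfolding C1_on_def by metis
  show ?thesis unfolding C1_on_def
  proof (intro exI[of _ "\<lambda>x. (- 1 / (f x)\<^sup>2) *\<^sub>R F x"] conjI ballI)
    show "continuous_on U (\<lambda>x. (- 1 / (f x)\<^sup>2) *\<^sub>R F x)"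
      using assms F by (intro continuous_intros C1_on_continuous) auto
    fix x assume "x \<in> U"
    then show "((\<lambda>x. 1 / f x) has_derivative (\<bullet>) ((- 1 / (f x)\<^sup>2) *\<^sub>R F x)) (at x)"
      using assms by (auto intro!: derivative_eq_intros F simp: power2_eq_square)
  qed
qed

lemma C1_on_minus [intro]: "C1_on U f \<Longrightarrow> C1_on U (\<lambda>x. - f x)"
  using C1_on_mult[OF C1_on_const[of U "-1"]] by simp

lemma C1_on_diff [intro]: "C1_on U f \<Longrightarrow> C1_on U g \<Longrightarrow> C1_on U (\<lambda>x. f x - g x)"
  using C1_on_add[of U f "\<lambda>x. - g x"] C1_on_minus by auto

lemma C1_on_sum [intro]:
  "(\<And>i. i \<in> I \<Longrightarrow> C1_on U (f i)) \<Longrightarrow> C1_on U (\<lambda>x. \<Sum>i\<in>I. f i x)"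
  by (induction I rule: infinite_finite_induct) auto

lemma C1_on_cong:
  assumes "open U" "\<And>x. x \<in> U \<Longrightarrow> f x = g x" "C1_on U f"
  shows "C1_on U g"
  using assms has_derivative_transform_within_open[of f _ _ UNIV U g]
  unfolding C1_on_def by metis

definition C1_mat_on :: "'a::euclidean_space set \<Rightarrow> ('a \<Rightarrow> real^'n^'m) \<Rightarrow> bool" where
  "C1_mat_on U A \<longleftrightarrow> (\<forall>i j. C1_on U (\<lambda>x. A x $ i $ j))"

lemma C1_mat_on_mult [intro]:
  "C1_mat_on U A \<Longrightarrow> C1_mat_on U B \<Longrightarrow> C1_mat_on U (\<lambda>x. A x ** B x)"
  unfolding C1_mat_on_def matrix_matrix_mult_def
  by (simp, intro allI C1_on_sum C1_on_mult, auto)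

lemma C1_mat_on_add [intro]:
  "C1_mat_on U A \<Longrightarrow> C1_mat_on U B \<Longrightarrow> C1_mat_on U (\<lambda>x. A x + B x)"
  unfolding C1_mat_on_def by auto

lemma C1_mat_on_diff [intro]:
  "C1_mat_on U A \<Longrightarrow> C1_mat_on U B \<Longrightarrow> C1_mat_on U (\<lambda>x. A x - B x)"
  unfolding C1_mat_on_def by auto

lemma C1_mat_on_times [intro]:
  "C1_mat_on U A \<Longrightarrow> C1_mat_on U B \<Longrightarrow> C1_mat_on U (\<lambda>x. A x * B x)"
  unfolding C1_mat_on_def by auto

lemma C1_mat_on_transpose [intro]: "C1_mat_on U A \<Longrightarrow> C1_mat_on U (\<lambda>x. transpose (A x))"
  unfolding C1_mat_on_def transpose_def by auto

lemma C1_mat_on_const [intro]: "C1_mat_on U (\<lambda>x. A)"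
  unfolding C1_mat_on_def by auto

lemma C1_mat_on_linear: "linear A \<Longrightarrow> C1_mat_on U A"
  unfolding C1_mat_on_def
  by (auto intro!: C1_on_linear simp: linear_iff)

lemma C1_on_norm_squared:
  assumes "C1_mat_on U A"
  shows "C1_on U (\<lambda>x. (norm (A x))\<^sup>2)"
proof -
  have "(\<lambda>x. (norm (A x))\<^sup>2) = (\<lambda>x. \<Sum>i\<in>UNIV. \<Sum>j\<in>UNIV. A x $ i $ j * A x $ i $ j)"
    by (simp add: power2_norm_eq_inner inner_vec_def)
  then show ?thesis using assms unfolding C1_mat_on_def
    by (simp only:) (intro C1_on_sum C1_on_mult, auto)
qed

text \<open>Mean value inequality on a ball around \<open>x\<close>. The radius is uniform because
  it is a Lebesgue number of a cover of \<open>K\<close> by balls inside \<open>U\<close> on which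
  \<open>G\<close> varies little; \<open>z\<close> is not confined to \<open>K\<close>.\<close>

lemma C1_uniform_expansion:
  fixes f :: "'a::euclidean_space \<Rightarrow> real"
  assumes "open U" "compact K" "K \<subseteq> U" and G: "continuous_on U G"
    and der: "\<And>x. x \<in> U \<Longrightarrow> (f has_derivative (\<lambda>h. G x \<bullet> h)) (at x)" and "0 < \<epsilon>"
  shows "\<exists>\<eta>>0. \<forall>x\<in>K. \<forall>z. dist z x < \<eta> \<longrightarrow> \<bar>f z - f x - G x \<bullet> (z - x)\<bar> \<le> \<epsilon> * norm (z - x)"
proof -
  have "\<exists>r>0. ball x r \<subseteq> U \<and> (\<forall>z\<in>ball x r. norm (G z - G x) < \<epsilon> / 2)" if "x \<in> K" for x
  proof -
    have "x \<in> U" using that assms by auto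
    then obtain r1 where "0 < r1" "ball x r1 \<subseteq> U" using \<open>open U\<close> open_contains_ball by blast
    moreover obtain r2 where "0 < r2" "\<And>z. z \<in> U \<Longrightarrow> dist z x < r2 \<Longrightarrow> norm (G z - G x) < \<epsilon> / 2"
      using G \<open>x \<in> U\<close> \<open>0 < \<epsilon>\<close> unfolding continuous_on_iff dist_norm
      by (metis half_gt_zero)
    ultimately show ?thesis
      by (intro exI[of _ "min r1 r2"]) (auto simp: dist_commute subset_iff)
  qed
  then obtain r where r: "\<And>x. x \<in> K \<Longrightarrow> 0 < r x" "\<And>x. x \<in> K \<Longrightarrow> ball x (r x) \<subseteq> U"
    "\<And>x z. x \<in> K \<Longrightarrow> z \<in> ball x (r x) \<Longrightarrow> norm (G z - G x) < \<epsilon> / 2"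
    by metis
  have cover: "K \<subseteq> \<Union>((\<lambda>x. ball x (r x)) ` K)" using r(1) by auto
  obtain \<eta> where \<eta>: "0 < \<eta>" "\<And>x. x \<in> K \<Longrightarrow> \<exists>B\<in>(\<lambda>x. ball x (r x)) ` K. ball x \<eta> \<subseteq> B"
  proof (rule Heine_Borel_lemma[OF \<open>compact K\<close> cover])
    show "open B" if "B \<in> (\<lambda>x. ball x (r x)) ` K" for B using that by auto
  qed (rule that)
  have "\<bar>f z - f x - G x \<bullet> (z - x)\<bar> \<le> \<epsilon> * norm (z - x)" if "x \<in> K" "dist z x < \<eta>" for x z
  proof -
    obtain w where w: "w \<in> K" "ball x \<eta> \<subseteq> ball w (r w)" using \<eta>(2)[OF \<open>x \<in> K\<close>] by blast
    have "norm (f z - f x - G x \<bullet> (z - x)) \<le> norm (z - x) * \<epsilon>"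
    proof (rule differentiable_bound_linearization[where S = "ball x \<eta>" and f' = "\<lambda>u h. G u \<bullet> h"])
      show "x + t *\<^sub>R (z - x) \<in> ball x \<eta>" if "t \<in> {0..1}" for t
      proof -
        have "\<bar>t\<bar> * norm (z - x) \<le> 1 * norm (z - x)" using that by (intro mult_right_mono) auto
        then show ?thesis using \<open>dist z x < \<eta>\<close> by (simp add: dist_norm)
      qed
      show "(f has_derivative (\<bullet>) (G u)) (at u within ball x \<eta>)" if "u \<in> ball x \<eta>" for u
        using that w(2) r(2)[OF w(1)] by (blast intro: has_derivative_at_withinI[OF der])
      show "onorm ((\<bullet>) (G u) - (\<bullet>) (G x)) \<le> \<epsilon>" if "u \<in> ball x \<eta>" for u
      proof (rule onorm_bound)
        \<comment> \<open>\<open>u\<close> and \<open>x\<close> share a ball of the cover, so both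
          gradients differ from the one at its centre \<open>w\<close> by less than
          \<open>\<epsilon> / 2\<close>.\<close>
        have "u \<in> ball w (r w)" "x \<in> ball w (r w)"
          using that w(2) \<eta>(1) centre_in_ball by blast+
        then have "norm (G u - G w) < \<epsilon> / 2" "norm (G x - G w) < \<epsilon> / 2"
          using r(3)[OF w(1)] by blast+
        then have "norm (G u - G x) \<le> \<epsilon>"
          using norm_triangle_ineq4[of "G u - G w" "G x - G w"] by simp
        then have "norm (G u - G x) * norm h \<le> \<epsilon> * norm h" for h :: 'a
          by (intro mult_right_mono) auto
        then show "norm (((\<bullet>) (G u) - (\<bullet>) (G x)) h) \<le> \<epsilon> * norm h" for h
          unfolding fun_diff_def inner_diff_left[symmetric] real_norm_def
          by (rule order_trans[OF Cauchy_Schwarz_ineq2])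
        show "0 \<le> \<epsilon>" using \<open>0 < \<epsilon>\<close> by simp
      qed
      show "x \<in> ball x \<eta>" using \<eta>(1) by simp
    qed
    then show ?thesis by (simp only: real_norm_def mult.commute[of \<epsilon>])
  qed
  then show ?thesis using \<eta>(1) by blast
qed

section \<open>Block diagonal matrices\<close>

lemma idx_less: "i < i' \<Longrightarrow> idx i < idx (i' :: 'n::{finite,linorder})"
  unfolding idx_def by (intro psubset_card_mono) (auto simp: not_le[symmetric] intro: order_trans)

lemma idx_eq_iff: "idx i = idx i' \<longleftrightarrow> i = (i' :: 'n::{finite,linorder})"
  by (metis idx_less less_irrefl linorder_cases)

lemma idx_range: "1 \<le> idx i" "idx (i :: 'n::{finite,linorder}) \<le> CARD('n)"
proof -
  have "i \<in> {j. j \<le> i}" by simp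
  then show "1 \<le> idx i" unfolding idx_def
    by (metis One_nat_def Suc_leI card_gt_0_iff empty_iff finite)
  show "idx i \<le> CARD('n)" unfolding idx_def by (simp add: card_mono)
qed

lemma pos_idx [simp]: "pos (idx i) = i"
  unfolding pos_def by (auto simp: idx_eq_iff)

text \<open>\<open>idx\<close> is injective into the numbers from 1 to n, hence onto them by
  counting.\<close>

lemma idx_pos:
  assumes "1 \<le> k" "k \<le> CARD('n)"
  shows "idx (pos k :: 'n::{finite,linorder}) = k"
proof -
  have "range (idx :: 'n \<Rightarrow> nat) = {1..CARD('n)}"
    by (intro card_subset_eq) (auto simp: card_image inj_on_def idx_eq_iff idx_range
        intro: idx_range(1)[unfolded One_nat_def])
  then obtain i :: 'n where "idx i = k" using assms by (metis atLeastAtMost_iff rangeE)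
  then show ?thesis by auto
qed

section \<open>Frobenius norm estimates and inverses\<close>

lemma norm_matrix_le_rows: "norm (A :: real^'n^'m) \<le> (\<Sum>i\<in>UNIV. norm (A $ i))"
  unfolding norm_vec_def by (rule L2_set_le_sum) auto

lemma norm_matrix_le_entries:
  fixes A :: "real^'n^'m"
  assumes "\<And>i j. \<bar>A $ i $ j\<bar> \<le> e"
  shows "norm A \<le> real CARD('m) * (real CARD('n) * e)"
proof -
  have "norm (A $ i) \<le> real CARD('n) * e" for i
    using order_trans[OF norm_le_l1_cart sum_bounded_above[of UNIV "\<lambda>j. \<bar>A $ i $ j\<bar>" e]] assms
    by simp
  then show ?thesis
    using order_trans[OF norm_matrix_le_rows sum_bounded_above[of UNIV "\<lambda>i. norm (A $ i)"]]
    by simp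
qed

lemma entry_le_norm: "\<bar>(A :: real^'n^'m) $ i $ j\<bar> \<le> norm A"
  by (metis Finite_Cartesian_Product.norm_nth_le order_trans real_norm_def)

lemma norm_matrix_squared: "(norm (A :: real^'n^'m))\<^sup>2 = (\<Sum>i\<in>UNIV. (norm (A $ i))\<^sup>2)"
  by (simp add: power2_norm_eq_inner inner_vec_def)

lemma norm_transpose [simp]: "norm (transpose A) = norm (A :: real^'n^'m)"
proof -
  have "(norm (transpose A))\<^sup>2 = (norm A)\<^sup>2"
    unfolding power2_norm_eq_inner inner_vec_def
    by (simp add: transpose_def) (rule sum.swap)
  then show ?thesis by simp
qed

text \<open>Each entry of the product is an inner product of a row of \<open>A\<close> and a column
  of \<open>B\<close>; Cauchy-Schwarz is applied to it and the squares are summed.\<close>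

lemma norm_matrix_mult_le: "norm (A ** B) \<le> norm (A :: real^'k^'m) * norm (B :: real^'n^'k)"
proof -
  have entry: "(A ** B) $ i $ j = A $ i \<bullet> transpose B $ j" for i j
    by (simp add: matrix_matrix_mult_def transpose_def inner_vec_def)
  have "(norm (A ** B))\<^sup>2 = (\<Sum>i\<in>UNIV. \<Sum>j\<in>UNIV. (A $ i \<bullet> transpose B $ j)\<^sup>2)"
    unfolding power2_norm_eq_inner inner_vec_def[of "A ** B"] inner_vec_def[of "(A ** B) $ i" for i]
    by (simp add: entry power2_eq_square)
  also have "\<dots> \<le> (\<Sum>i\<in>UNIV. \<Sum>j\<in>UNIV. (norm (A $ i))\<^sup>2 * (norm (transpose B $ j))\<^sup>2)"
    by (intro sum_mono) (metis Cauchy_Schwarz_ineq power2_norm_eq_inner)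
  also have "\<dots> = (norm A)\<^sup>2 * (norm (transpose B))\<^sup>2"
    by (simp only: norm_matrix_squared sum_product)
  finally show ?thesis
    by (simp add: power_mult_distrib[symmetric] abs_le_square_iff[symmetric] abs_mult)
qed

lemma matrix_inv_eq:
  assumes "A ** A' = mat 1" "A' ** A = mat (1 :: real)"
  shows "matrix_inv A = (A' :: real^'n^'n)"
proof -
  have "A ** matrix_inv A = mat 1 \<and> matrix_inv A ** A = mat 1"
    unfolding matrix_inv_def by (rule someI[of _ A']) (use assms in auto)
  then show ?thesis using assms by (metis matrix_mul_assoc matrix_mul_lid matrix_mul_rid)
qed

section \<open>Entries of block diagonal matrices\<close>

locale spectrum =
  fixes s t :: nat and \<Lambda> :: "('n::{finite,linorder}) cvec"
  assumes adm: "admissible_spectrum s t \<Lambda>"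
begin

text \<open>\<open>p j\<close> and \<open>q j\<close> are the first and the second index of block
  \<open>j\<close>. Together with the indices numbered up to \<open>s\<close> they exhaust the index
  type, and block matrices are computed by this case distinction
  (\<open>index_cases\<close>).\<close>

definition p :: "nat \<Rightarrow> 'n" where "p j = pos (s + 2 * j - 1)"
definition q :: "nat \<Rightarrow> 'n" where "q j = pos (s + 2 * j)"

lemma card_n: "CARD('n) = s + 2 * t"
  using adm by (simp add: admissible_spectrum_def)

lemma idx_p: "j \<in> {1..t} \<Longrightarrow> idx (p j) = s + 2 * j - 1"
  unfolding p_def by (intro idx_pos) (auto simp: card_n)

lemma idx_q: "j \<in> {1..t} \<Longrightarrow> idx (q j) = s + 2 * j"
  unfolding q_def by (intro idx_pos) (auto simp: card_n)

lemma idx_pos_k: "j \<in> {1..t} \<Longrightarrow> idx (pos j :: 'n) = j"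
  by (intro idx_pos) (auto simp: card_n)

lemma index_cases:
  fixes i :: 'n
  obtains "idx i \<le> s" | j where "j \<in> {1..t}" "i = p j" | j where "j \<in> {1..t}" "i = q j"
proof (cases "idx i \<le> s")
  case False
  define k where "k = idx i - s"
  have k: "idx i = s + k" "1 \<le> k" "k \<le> 2 * t" using False idx_range(2)[of i] by (auto simp: k_def card_n)
  show ?thesis
  proof (cases "odd k")
    case True
    then obtain l where "k = 2 * l + 1" by (rule oddE)
    then have "Suc l \<in> {1..t}" "idx i = idx (p (Suc l))" using k by (auto simp: idx_p)
    then show ?thesis using that(2) idx_eq_iff by blast
  next
    case False
    then obtain l where "k = 2 * l" by (auto elim: evenE)
    then have "l \<in> {1..t}" "idx i = idx (q l)" using k by (auto simp: idx_q)
    then show ?thesis using that(3) idx_eq_iff by blast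
  qed
qed (rule that(1))

lemma pq_neq:
  assumes "j \<in> {1..t}" "j' \<in> {1..t}"
  shows "p j = p j' \<longleftrightarrow> j = j'" "q j = q j' \<longleftrightarrow> j = j'" "p j \<noteq> q j'" "q j \<noteq> p j'"
  using assms unfolding idx_eq_iff[symmetric, where 'n = 'n]
  by (simp_all add: idx_p idx_q del: One_nat_def) presburger+

lemma small_neq:
  assumes "j \<in> {1..t}" "idx l \<le> s"
  shows "l \<noteq> p j" "l \<noteq> q j"
  using assms idx_p[of j] idx_q[of j] by auto

lemma not_small:
  assumes "j \<in> {1..t}"
  shows "\<not> idx (p j) \<le> s" "\<not> idx (q j) \<le> s"
  using assms idx_p[of j] idx_q[of j] by auto

lemma p_less_q: "j \<in> {1..t} \<Longrightarrow> p j < q j"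
  using idx_p idx_q idx_less[of "q j" "p j"] pq_neq(3)[of j j]
  by (metis Suc_leI diff_le_self linorder_neqE not_less)

lemma block_p: "j \<in> {1..t} \<Longrightarrow> block_no s (p j) = j" "j \<in> {1..t} \<Longrightarrow> block_idx s (p j) = 1"
  by (auto simp: block_no_def block_idx_def idx_p)

lemma block_q: "j \<in> {1..t} \<Longrightarrow> block_no s (q j) = j" "j \<in> {1..t} \<Longrightarrow> block_idx s (q j) = 2"
  by (auto simp: block_no_def block_idx_def idx_q)

lemma blockdiag_small:
  assumes "idx i \<le> s \<or> idx l \<le> s"
  shows "(blockdiag s c B :: 'n rmat) $ i $ l = (if i = l then c (idx i) else 0)"
  using assms by (auto simp: blockdiag_def)

lemma blockdiag_blocks:
  assumes "j \<in> {1..t}" "j' \<in> {1..t}"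
  shows "(blockdiag s c B :: 'n rmat) $ p j $ p j' = (if j = j' then B j $ 1 $ 1 else 0)"
    "(blockdiag s c B :: 'n rmat) $ p j $ q j' = (if j = j' then B j $ 1 $ 2 else 0)"
    "(blockdiag s c B :: 'n rmat) $ q j $ p j' = (if j = j' then B j $ 2 $ 1 else 0)"
    "(blockdiag s c B :: 'n rmat) $ q j $ q j' = (if j = j' then B j $ 2 $ 2 else 0)"
  using assms by (simp_all add: blockdiag_def block_p block_q not_small)

text \<open>Rows and columns through a block are written as sums of two deltas, so that
  \<open>sum_two_deltas\<close> turns a matrix product into two terms.\<close>

lemma blockdiag_row_p:
  assumes "j \<in> {1..t}"
  shows "(blockdiag s c B :: 'n rmat) $ p j $ l
    = (if l = p j then B j $ 1 $ 1 else 0) + (if l = q j then B j $ 1 $ 2 else 0)"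
  using assms
  by (cases l rule: index_cases)
    (auto simp: blockdiag_blocks pq_neq blockdiag_small small_neq not_small)

lemma blockdiag_row_q:
  assumes "j \<in> {1..t}"
  shows "(blockdiag s c B :: 'n rmat) $ q j $ l
    = (if l = p j then B j $ 2 $ 1 else 0) + (if l = q j then B j $ 2 $ 2 else 0)"
  using assms
  by (cases l rule: index_cases)
    (auto simp: blockdiag_blocks pq_neq blockdiag_small small_neq not_small)

lemma blockdiag_col_p:
  assumes "j \<in> {1..t}"
  shows "(blockdiag s c B :: 'n rmat) $ l $ p j
    = (if l = p j then B j $ 1 $ 1 else 0) + (if l = q j then B j $ 2 $ 1 else 0)"
  using assms
  by (cases l rule: index_cases)
    (auto simp: blockdiag_blocks pq_neq blockdiag_small small_neq not_small)

lemma blockdiag_col_q: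
  assumes "j \<in> {1..t}"
  shows "(blockdiag s c B :: 'n rmat) $ l $ q j
    = (if l = p j then B j $ 1 $ 2 else 0) + (if l = q j then B j $ 2 $ 2 else 0)"
  using assms
  by (cases l rule: index_cases)
    (auto simp: blockdiag_blocks pq_neq blockdiag_small small_neq not_small)

lemma sum_two_deltas:
  fixes f :: "'n \<Rightarrow> real"
  shows "(\<Sum>k\<in>UNIV. ((if k = u then a else 0) + (if k = v then b else 0)) * f k) = a * f u + b * f v"
    "(\<Sum>k\<in>UNIV. f k * ((if k = u then a else 0) + (if k = v then b else 0))) = f u * a + f v * b"
  by (simp_all add: distrib_right distrib_left sum.distrib if_distrib[of "\<lambda>x. x * _"]
      if_distrib[of "\<lambda>x. _ * x"] cong: if_cong)

lemma T_block_entries [simp]: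
  "T_block \<alpha> \<beta> $ 1 $ 1 = \<alpha>" "T_block \<alpha> \<beta> $ 1 $ 2 = \<beta>"
  "T_block \<alpha> \<beta> $ 2 $ 1 = 0" "T_block \<alpha> \<beta> $ 2 $ 2 = 1 / \<alpha>"
  by (simp_all add: T_block_def)

abbreviation T :: "'n rvec \<Rightarrow> 'n rvec \<Rightarrow> 'n rmat" where "T \<equiv> T_mat s"
abbreviation D :: "'n rmat" where "D \<equiv> D_mat s \<Lambda>"

text \<open>The inverse of \<open>T_block \<alpha> \<beta>\<close> is
  \<open>T_block (1 / \<alpha>) (- \<beta>)\<close>, so the inverse of \<open>T a b\<close> is again
  of the form \<open>T\<close> with parameters \<open>inv_vec a\<close> and \<open>- b\<close>.
  Since \<open>1 / 0 = 0\<close>, padding entries stay 0.\<close>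

definition inv_vec :: "'n rvec \<Rightarrow> 'n rvec" where "inv_vec a = (\<chi> i. 1 / a $ i)"

lemma inv_vec_nth [simp]: "inv_vec a $ i = 1 / a $ i"
  by (simp add: inv_vec_def)

lemma inv_vec_inv_vec [simp]: "inv_vec (inv_vec a) = a"
  by (simp add: vec_eq_iff)

lemma T_mult_left:
  fixes X :: "'n rmat"
  shows "idx i \<le> s \<Longrightarrow> (T a b ** X) $ i $ l = X $ i $ l"
    "j \<in> {1..t} \<Longrightarrow> (T a b ** X) $ p j $ l = a $ pos j * X $ p j $ l + b $ pos j * X $ q j $ l"
    "j \<in> {1..t} \<Longrightarrow> (T a b ** X) $ q j $ l = 1 / a $ pos j * X $ q j $ l"
  unfolding T_mat_def
  by (simp_all add: matrix_matrix_mult_def blockdiag_row_p blockdiag_row_q sum_two_deltas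
      blockdiag_small if_distrib[of "\<lambda>x. x * _"] cong: if_cong)

lemma T_mult_right:
  fixes X :: "'n rmat"
  shows "j \<in> {1..t} \<Longrightarrow> (X ** T a b) $ l $ p j = X $ l $ p j * a $ pos j"
    "j \<in> {1..t} \<Longrightarrow> (X ** T a b) $ l $ q j = X $ l $ p j * b $ pos j + X $ l $ q j * (1 / a $ pos j)"
  unfolding T_mat_def
  by (simp_all add: matrix_matrix_mult_def blockdiag_col_p blockdiag_col_q sum_two_deltas)

lemma T_mult_inverse:
  assumes "\<And>j. j \<in> {1..t} \<Longrightarrow> a $ pos j \<noteq> 0"
  shows "T a b ** T (inv_vec a) (- b) = mat 1"
proof -
  have "(T a b ** T (inv_vec a) (- b)) $ i $ l = mat 1 $ i $ l" for i l
  proof (cases i rule: index_cases)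
    case 1
    then show ?thesis
      by (simp add: T_mult_left) (simp add: T_mat_def blockdiag_small mat_def)
  next
    case (2 j)
    then show ?thesis using assms[of j] pq_neq[of j j]
      by (auto simp: T_mult_left) (auto simp: T_mat_def blockdiag_row_p blockdiag_row_q mat_def)
  next
    case (3 j)
    then show ?thesis using assms[of j] pq_neq[of j j]
      by (auto simp: T_mult_left) (auto simp: T_mat_def blockdiag_row_p blockdiag_row_q mat_def)
  qed
  then show ?thesis by (simp add: vec_eq_iff)
qed

lemma T_inverse:
  assumes "\<And>j. j \<in> {1..t} \<Longrightarrow> a $ pos j \<noteq> 0"
  shows "matrix_inv (T a b) = T (inv_vec a) (- b)"
proof (rule matrix_inv_eq)
  show "T a b ** T (inv_vec a) (- b) = mat 1" using assms by (rule T_mult_inverse)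
  \<comment> \<open>Inverting the parameters twice is the identity, so the same lemma also yields
    the product in the other order.\<close>
  show "T (inv_vec a) (- b) ** T a b = mat 1"
    using T_mult_inverse[of "inv_vec a" "- b"] assms by simp
qed

lemma Im_nonzero:
  assumes "j \<in> {1..t}"
  shows "Im (\<Lambda> $ p j) \<noteq> 0"
proof -
  have "s + 2 * j - 1 \<in> {s + 1..CARD('n)}" using assms by (auto simp: card_n)
  then have "\<Lambda> $ p j \<notin> \<real>" using adm unfolding admissible_spectrum_def p_def by blast
  then show ?thesis by (simp add: complex_is_Real_iff)
qed

lemma D_entries:
  assumes "j \<in> {1..t}"
  shows "D $ p j $ p j = Re (\<Lambda> $ p j)" "D $ p j $ q j = Im (\<Lambda> $ p j)"
    "D $ q j $ p j = - Im (\<Lambda> $ p j)" "D $ q j $ q j = Re (\<Lambda> $ p j)"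
  using assms unfolding D_mat_def
  by (simp_all add: blockdiag_blocks Let_def) (simp_all add: p_def)

lemma V_entries:
  assumes "j \<in> {1..t}" "V \<in> V_space s t"
  shows "V $ p j $ p j = 0" "V $ p j $ q j = 0" "V $ q j $ p j = 0" "V $ q j $ q j = 0"
  using assms p_less_q[of j] unfolding V_space_def by (auto simp: p_def q_def)

definition N :: "'n rmat \<Rightarrow> 'n rvec \<Rightarrow> 'n rvec \<Rightarrow> 'n rmat" where
  "N V a b = T a b ** (D + V) ** T (inv_vec a) (- b)"

text \<open>\<open>V\<close> vanishes on the diagonal blocks and conjugation by \<open>T\<close>
  acts within pairs of blocks, so \<open>V\<close> drops out of these entries. As the imaginary
  parts are nonzero, they control \<open>1 / a\<close>, \<open>a\<close> and \<open>b\<close>: this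
  is the coercivity of the objective.\<close>

lemma N_entries:
  assumes j: "j \<in> {1..t}" and V: "V \<in> V_space s t" and a: "a $ pos j \<noteq> 0"
  shows "N V a b $ q j $ p j = - Im (\<Lambda> $ p j) / (a $ pos j)\<^sup>2"
    "N V a b $ p j $ q j = Im (\<Lambda> $ p j) * ((a $ pos j)\<^sup>2 + (b $ pos j)\<^sup>2)"
  using j a unfolding N_def
  by (simp_all add: T_mult_left T_mult_right D_entries V_entries[OF j V] power2_eq_square algebra_simps)

end

section \<open>Retractions of the sphere and of the orthogonal group\<close>

lemma derivative_zero_bound:
  fixes f :: "real \<Rightarrow> real"
  assumes "(f has_real_derivative c) (at 0)" "0 < \<epsilon>"
  shows "\<exists>\<eta>>0. \<forall>u. \<bar>u\<bar> < \<eta> \<longrightarrow> \<bar>f u - f 0 - c * u\<bar> \<le> \<epsilon> * \<bar>u\<bar>"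
  using assms unfolding has_field_derivative_def has_derivative_at_alt by auto

text \<open>By Pythagoras the length r of \<open>u + v\<close> satisfies
  \<open>r\<^sup>2 = 1 + (norm v)\<^sup>2\<close>. The error is
  \<open>(1 / r - 1) *\<^sub>R (u + v)\<close>, of norm \<open>r - 1\<close>, which is at most
  \<open>(norm v)\<^sup>2\<close>.\<close>

lemma norm_normalize:
  fixes u v :: "'a::real_inner"
  assumes "norm u = 1" "u \<bullet> v = 0"
  shows "norm ((1 / norm (u + v)) *\<^sub>R (u + v)) = 1"
    "norm ((1 / norm (u + v)) *\<^sub>R (u + v) - u - v) \<le> norm v * norm v"
proof -
  let ?r = "norm (u + v)"
  have r2: "?r\<^sup>2 = 1 + (norm v)\<^sup>2"
    using norm_add_Pythagorean[of u v] assms by (simp add: orthogonal_def)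
  have r: "1 \<le> ?r" by (rule power2_le_imp_le) (auto simp: r2)
  then show "norm ((1 / ?r) *\<^sub>R (u + v)) = 1" by auto
  have "(1 / ?r) *\<^sub>R (u + v) - u - v = (1 / ?r - 1) *\<^sub>R (u + v)"
    by (simp add: scaleR_left_diff_distrib)
  then have "norm ((1 / ?r) *\<^sub>R (u + v) - u - v) = \<bar>1 / ?r - 1\<bar> * ?r" by simp
  also have "\<dots> = ?r - 1"
  proof -
    have "u + v \<noteq> 0" using r norm_eq_zero[of "u + v"] by linarith
    moreover from this have "1 / ?r \<le> 1" using r by (simp add: divide_simps)
    ultimately show ?thesis by (simp add: left_diff_distrib)
  qed
  also have "\<dots> \<le> norm v * norm v"
  proof -
    have "?r \<le> 1 + (norm v)\<^sup>2"
      by (rule power2_le_imp_le) (simp_all add: r2 power2_sum)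
    then show ?thesis by (simp add: power2_eq_square)
  qed
  finally show "norm ((1 / ?r) *\<^sub>R (u + v) - u - v) \<le> norm v * norm v" .
qed

lemma norm_sphere_exp:
  fixes u v :: "'a::real_inner"
  assumes "norm u = 1" "u \<bullet> v = 0"
  shows "norm (cos (norm v) *\<^sub>R u + (sin (norm v) / norm v) *\<^sub>R v) = 1"
proof -
  have "(norm (cos (norm v) *\<^sub>R u + (sin (norm v) / norm v) *\<^sub>R v))\<^sup>2
      = (norm (cos (norm v) *\<^sub>R u))\<^sup>2 + (norm ((sin (norm v) / norm v) *\<^sub>R v))\<^sup>2"
    using assms by (intro norm_add_Pythagorean) (simp add: orthogonal_def)
  also have "\<dots> = (cos (norm v))\<^sup>2 + (sin (norm v))\<^sup>2"
    using assms by (cases "v = 0") (simp_all add: power_mult_distrib)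
  finally show ?thesis by (simp add: power2_eq_1_iff) (metis norm_ge_zero not_one_le_zero neg_0_le_iff_le zero_le_one order_trans)
qed

text \<open>The derivatives at 0 make \<open>cos r - 1\<close> and \<open>sin r - r\<close> small
  compared with r; each contributes half of \<open>\<epsilon>\<close>.\<close>

lemma sphere_exp_near:
  assumes "0 < \<epsilon>"
  shows "\<exists>\<eta>>0. \<forall>u v :: 'a::real_inner. norm u = 1 \<longrightarrow> norm v < \<eta> \<longrightarrow>
    norm (cos (norm v) *\<^sub>R u + (sin (norm v) / norm v) *\<^sub>R v - u - v) \<le> \<epsilon> * norm v"
proof -
  have "(cos has_real_derivative 0) (at 0)" "(sin has_real_derivative 1) (at 0)"
    by (auto intro!: derivative_eq_intros)
  from this[THEN derivative_zero_bound, of "\<epsilon> / 2"] assms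
  obtain \<eta>1 \<eta>2 where \<eta>: "0 < \<eta>1" "0 < \<eta>2" "\<And>r. \<bar>r\<bar> < \<eta>1 \<Longrightarrow> \<bar>cos r - 1\<bar> \<le> \<epsilon> / 2 * \<bar>r\<bar>"
    "\<And>r. \<bar>r\<bar> < \<eta>2 \<Longrightarrow> \<bar>sin r - r\<bar> \<le> \<epsilon> / 2 * \<bar>r\<bar>" by auto
  have "norm (cos (norm v) *\<^sub>R u + (sin (norm v) / norm v) *\<^sub>R v - u - v) \<le> \<epsilon> * norm v"
    if u: "norm u = 1" and v: "norm v < min \<eta>1 \<eta>2" for u v :: 'a
  proof -
    have "cos (norm v) *\<^sub>R u + (sin (norm v) / norm v) *\<^sub>R v - u - v
        = (cos (norm v) - 1) *\<^sub>R u + (sin (norm v) / norm v - 1) *\<^sub>R v"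
      by (simp add: scaleR_left_diff_distrib)
    then have "norm (cos (norm v) *\<^sub>R u + (sin (norm v) / norm v) *\<^sub>R v - u - v)
        \<le> \<bar>cos (norm v) - 1\<bar> + \<bar>sin (norm v) / norm v - 1\<bar> * norm v"
      using norm_triangle_ineq[of "(cos (norm v) - 1) *\<^sub>R u" "(sin (norm v) / norm v - 1) *\<^sub>R v"] u
      by simp
    also have "\<bar>sin (norm v) / norm v - 1\<bar> * norm v = \<bar>sin (norm v) - norm v\<bar>"
    proof (cases "v = 0")
      case False
      then have "\<bar>sin (norm v) / norm v - 1\<bar> * norm v = \<bar>(sin (norm v) / norm v - 1) * norm v\<bar>"
        by (simp add: abs_mult)
      then show ?thesis using False by (simp add: left_diff_distrib)
    qed simp
    finally show ?thesis using \<eta>(3,4)[of "norm v"] v by simp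
  qed
  then show ?thesis using \<eta>(1,2) by (intro exI[of _ "min \<eta>1 \<eta>2"]) auto
qed

section \<open>The matrix exponential\<close>

definition mpow :: "real^'n^'n \<Rightarrow> nat \<Rightarrow> real^'n^'n" where
  "mpow A k = ((**) A ^^ k) (mat 1)"

lemma mpow_0 [simp]: "mpow A 0 = mat 1" and mpow_Suc: "mpow A (Suc k) = A ** mpow A k"
  by (simp_all add: mpow_def)

lemma mpow_1 [simp]: "mpow A (Suc 0) = A"
  by (simp add: mpow_Suc)

lemma mpow_add: "mpow A (j + k) = mpow A j ** mpow A k"
  by (induction j) (simp_all add: mpow_Suc matrix_mul_assoc)

lemma mat_exp_eq: "mat_exp A = (\<Sum>k. (1 / fact k) *\<^sub>R mpow A k)"
  by (simp add: mat_exp_def mpow_def)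

text \<open>The second factor is the Frobenius norm of the identity, which is 1 only in dimension
  1.\<close>

lemma norm_mpow_le: "norm (mpow A k) \<le> norm A ^ k * norm (mat 1 :: real^'n^'n)"
  for A :: "real^'n^'n"
proof (induction k)
  case (Suc k)
  have "norm (mpow A (Suc k)) \<le> norm A * norm (mpow A k)"
    unfolding mpow_Suc by (rule norm_matrix_mult_le)
  also have "\<dots> \<le> norm A * (norm A ^ k * norm (mat 1 :: real^'n^'n))"
    using Suc by (intro mult_left_mono) auto
  finally show ?case by simp
qed simp

lemma summable_norm_mpow: "summable (\<lambda>k. norm ((1 / fact k) *\<^sub>R mpow A k))"
proof (rule summable_comparison_test')
  show "summable (\<lambda>k. norm A ^ k /\<^sub>R fact k * norm (mat 1 :: real^'a^'a))"
    by (intro summable_mult2 summable_exp_generic)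
  show "norm (norm ((1 / fact k) *\<^sub>R mpow A k)) \<le> norm A ^ k /\<^sub>R fact k * norm (mat 1 :: real^'a^'a)"
    if "0 \<le> k" for k
    using norm_mpow_le[of A k] by (simp add: divide_simps)
qed

text \<open>The left side is the tail of the series from degree 2. As \<open>norm A \<le> 1\<close>,
  two powers of \<open>norm A\<close> can be split off and the rest bounded by 1;
  \<open>fact k \<le> fact (k + 2)\<close> then leaves the series of \<open>exp 1\<close>.\<close>

lemma mat_exp_near:
  fixes A :: "real^'n^'n"
  assumes "norm A \<le> 1"
  shows "norm (mat_exp A - mat 1 - A) \<le> (norm A)\<^sup>2 * (exp 1 * norm (mat 1 :: real^'n^'n))"
proof -
  let ?c = "norm (mat 1 :: real^'n^'n)"
  define u where "u k = (1 / fact k) *\<^sub>R mpow A k" for k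
  have su: "summable (\<lambda>k. norm (u k))" unfolding u_def by (rule summable_norm_mpow)
  then have su2: "summable (\<lambda>k. norm (u (k + 2)))" by (subst summable_iff_shift)
  have "mat_exp A - mat 1 - A = (\<Sum>k. u (k + 2))"
    unfolding mat_exp_eq u_def[symmetric]
    by (subst suminf_minus_initial_segment[OF summable_norm_cancel[OF su]])
      (simp add: u_def numeral_2_eq_2 diff_diff_eq)
  also have "norm \<dots> \<le> (\<Sum>k. norm (u (k + 2)))" by (rule summable_norm[OF su2])
  also have "\<dots> \<le> (\<Sum>k. (norm A)\<^sup>2 * (1 ^ k /\<^sub>R fact k * ?c))"
  proof (rule suminf_le[OF _ su2])
    show "summable (\<lambda>k. (norm A)\<^sup>2 * (1 ^ k /\<^sub>R fact k * ?c))"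
      by (intro summable_mult summable_mult2 summable_exp_generic)
    fix k
    have "norm A ^ k \<le> 1" using assms by (simp add: power_le_one)
    from mult_left_mono[OF this zero_le_power2[of "norm A"]]
    have A2: "norm A ^ (k + 2) \<le> (norm A)\<^sup>2"
      by (simp only: power_add mult.commute mult_1_right)
    have "norm (u (k + 2)) = norm (mpow A (k + 2)) / fact (k + 2)" by (simp add: u_def)
    also have "\<dots> \<le> (norm A)\<^sup>2 * ?c / fact k"
    proof (rule frac_le)
      show "norm (mpow A (k + 2)) \<le> (norm A)\<^sup>2 * ?c"
        using norm_mpow_le[of A "k + 2"] mult_right_mono[OF A2 norm_ge_zero, of "mat 1 :: real^'n^'n"]
        by linarith
      show "fact k \<le> (fact (k + 2) :: real)" by (rule fact_mono) simp
    qed auto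
    finally show "norm (u (k + 2)) \<le> (norm A)\<^sup>2 * (1 ^ k /\<^sub>R fact k * ?c)"
      by (simp add: field_simps)
  qed
  also have "\<dots> = (norm A)\<^sup>2 * (exp 1 * ?c)"
    unfolding exp_def
    by (simp only: suminf_mult[OF summable_mult2[OF summable_exp_generic]]
        suminf_mult2[OF summable_exp_generic])
  finally show ?thesis .
qed

lemma transpose_mpow:
  fixes A :: "real^'n^'n"
  assumes "transpose A = - A"
  shows "transpose (mpow A k) = (- 1) ^ k *\<^sub>R mpow A k"
proof (induction k)
  case (Suc k)
  have "transpose (mpow A (Suc k)) = transpose (mpow A k) ** transpose A"
    by (simp add: mpow_Suc matrix_transpose_mul)
  also have "\<dots> = (- 1) ^ Suc k *\<^sub>R (mpow A k ** A)"
    unfolding Suc assms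
    by (simp add: matrix_matrix_mult_def vec_eq_iff sum_negf sum_distrib_left mult.assoc)
  also have "mpow A k ** A = mpow A (Suc k)"
    using mpow_add[of A k "Suc 0"] by simp
  finally show ?case .
qed (simp add: transpose_mat)

text \<open>Matrices form no normed algebra here (\<open>*\<close> is the componentwise product), so the product of the
  two exponential series is computed entry by entry.\<close>

lemma mat_exp_orthogonal:
  fixes A :: "real^'n^'n"
  assumes "transpose A = - A"
  shows "orthogonal_matrix (mat_exp A)"
proof -
  define e where "e i j k = mpow A k $ i $ j / fact k" for i j k
  have norm_e: "summable (\<lambda>k. norm (e i j k))" for i j
    by (rule summable_comparison_test'[OF summable_norm_mpow[of A]])
      (auto simp: e_def divide_right_mono entry_le_norm)
  have E: "mat_exp A $ i $ j = (\<Sum>k. e i j k)" for i j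
  proof -
    have "(\<lambda>k. (1 / fact k) *\<^sub>R mpow A k) sums mat_exp A"
      unfolding mat_exp_eq by (rule summable_sums[OF summable_norm_cancel[OF summable_norm_mpow]])
    then have "(\<lambda>k. ((1 / fact k) *\<^sub>R mpow A k) $ i $ j) sums (mat_exp A $ i $ j)"
      by (intro bounded_linear.sums[OF bounded_linear_vec_nth])
    then show ?thesis by (simp add: e_def sums_iff)
  qed
  have "(transpose (mat_exp A) ** mat_exp A) $ i $ j = mat 1 $ i $ j" for i j
  proof -
    have "(\<lambda>n. \<Sum>k\<le>n. e l i k * e l j (n - k)) sums (mat_exp A $ l $ i * mat_exp A $ l $ j)" for l
      unfolding E by (rule Cauchy_product_sums[OF norm_e norm_e])
    then have "(\<lambda>n. \<Sum>l\<in>UNIV. \<Sum>k\<le>n. e l i k * e l j (n - k))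
        sums (\<Sum>l\<in>UNIV. mat_exp A $ l $ i * mat_exp A $ l $ j)"
      by (intro sums_sum)
    \<comment> \<open>The part of degree \<open>n\<close>: transposing a power of the skew matrix
      gives a sign, so it is \<open>mpow A n / fact n\<close> times the alternating sum of binomial
      coefficients, which vanishes for \<open>n > 0\<close>.\<close>
    moreover have "(\<Sum>l\<in>UNIV. \<Sum>k\<le>n. e l i k * e l j (n - k)) = (if n = 0 then mat 1 $ i $ j else 0)" for n
    proof -
      have "(\<Sum>l\<in>UNIV. e l i k * e l j (n - k)) = mpow A n $ i $ j / fact n * ((- 1) ^ k * real (n choose k))"
        if "k \<le> n" for k
      proof -
        have "mpow A k $ l $ i = (- 1) ^ k * mpow A k $ i $ l" for l
          using arg_cong[OF transpose_mpow[OF assms, of k], of "\<lambda>M. M $ i $ l"]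
          by (simp add: transpose_def)
        then have "(\<Sum>l\<in>UNIV. mpow A k $ l $ i * mpow A (n - k) $ l $ j)
            = (- 1) ^ k * (mpow A k ** mpow A (n - k)) $ i $ j"
          by (simp add: matrix_matrix_mult_def sum_distrib_left mult.assoc)
        also have "mpow A k ** mpow A (n - k) = mpow A n"
          using that by (simp add: mpow_add[symmetric])
        finally have "(\<Sum>l\<in>UNIV. mpow A k $ l $ i * mpow A (n - k) $ l $ j) = (- 1) ^ k * mpow A n $ i $ j" .
        then have "(\<Sum>l\<in>UNIV. e l i k * e l j (n - k)) = (- 1) ^ k * mpow A n $ i $ j / (fact k * fact (n - k))"
          by (simp add: e_def sum_divide_distrib[symmetric])
        then show ?thesis using that by (simp add: binomial_fact)
      qed
      then have "(\<Sum>l\<in>UNIV. \<Sum>k\<le>n. e l i k * e l j (n - k))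
          = (\<Sum>k\<le>n. mpow A n $ i $ j / fact n * ((- 1) ^ k * real (n choose k)))"
        by (subst sum.swap) simp
      also have "\<dots> = mpow A n $ i $ j / fact n * (\<Sum>k\<le>n. (- 1) ^ k * real (n choose k))"
        by (simp add: sum_distrib_left)
      finally show ?thesis using choose_alternating_sum[of n, where 'a = real] by auto
    qed
    ultimately have "(\<lambda>n. if n = 0 then mat 1 $ i $ j else 0)
        sums (\<Sum>l\<in>UNIV. mat_exp A $ l $ i * mat_exp A $ l $ j)" by simp
    then have "(\<Sum>l\<in>UNIV. mat_exp A $ l $ i * mat_exp A $ l $ j) = mat 1 $ i $ j"
      by (rule sums_unique2[OF _ sums_single[of 0 "\<lambda>_. mat 1 $ i $ j"]])
    then show ?thesis by (simp add: matrix_matrix_mult_def transpose_def)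
  qed
  then show ?thesis by (simp add: orthogonal_matrix vec_eq_iff)
qed

section \<open>QR decomposition and its first order behaviour\<close>

definition upper :: "('n::{finite,linorder}) rmat \<Rightarrow> bool" where
  "upper R \<longleftrightarrow> (\<forall>i j. j < i \<longrightarrow> R $ i $ j = 0)"

lemma gram_entry: "(transpose A ** B) $ i $ j = (\<Sum>k\<in>UNIV. A $ k $ i * B $ k $ j)"
  by (simp add: matrix_matrix_mult_def transpose_def)

text \<open>Gram-Schmidt without recursion: \<open>w j\<close> is the component of column
  \<open>j\<close> orthogonal to the span of the earlier columns, and the diagonal entries of
  \<open>R\<close> are the lengths of the \<open>w j\<close>.\<close>

lemma qr_exists:
  fixes A :: "('n::{finite,linorder}) rmat"
  assumes "invertible A"
  shows "\<exists>Q R. orthogonal_matrix Q \<and> upper R \<and> (\<forall>i. 0 < R $ i $ i) \<and> A = Q ** R"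
proof -
  define U where "U j = span ((\<lambda>k. column k A) ` {..<j})" for j
  have "\<exists>w. column j A - w \<in> U j \<and> (\<forall>u\<in>U j. orthogonal w u)" for j
  proof -
    obtain y z where "y \<in> U j" "\<And>w. w \<in> U j \<Longrightarrow> orthogonal z w" "column j A = y + z"
      unfolding U_def by (rule orthogonal_subspace_decomp_exists) blast
    then show ?thesis by (intro exI[of _ z]) simp
  qed
  then obtain w where w: "\<And>j. column j A - w j \<in> U j" "\<And>j u. u \<in> U j \<Longrightarrow> orthogonal (w j) u"
    by metis
  \<comment> \<open>A combination of earlier columns is \<open>A *v z\<close> with \<open>z\<close>
    in the span of earlier unit vectors. Injectivity of \<open>A\<close> would make \<open>z\<close>
    the unit vector at \<open>j\<close>, although its entry at \<open>j\<close> is 0.\<close>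
  have col_notin: "column j A \<notin> U j" for j
  proof
    assume "column j A \<in> U j"
    moreover have "(\<lambda>k. column k A) ` {..<j} = (*v) A ` (\<lambda>k. axis k 1) ` {..<j}"
      by (simp add: image_image matrix_vector_mult_basis)
    ultimately obtain z where z: "z \<in> span ((\<lambda>k. axis k 1) ` {..<j})" "column j A = A *v z"
      unfolding U_def by (auto simp: linear_span_image[OF matrix_vector_mul_linear])
    have "subspace {v :: 'n rvec. v $ j = 0}" by (simp add: subspace_def)
    then have "span ((\<lambda>k. axis k 1) ` {..<j}) \<subseteq> {v :: 'n rvec. v $ j = 0}"
      by (intro span_minimal) (auto simp: axis_def)
    then have "z $ j = 0" using z by auto
    moreover have "axis j 1 = z"
      using z(2) assms inj_matrix_vector_mult by (metis injD matrix_vector_mult_basis)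
    ultimately show False by auto
  qed
  have w_nz: "w j \<noteq> 0" for j using w(1)[of j] col_notin[of j] by force
  have U_mono: "i < j \<Longrightarrow> U i \<subseteq> U j" for i j unfolding U_def by (intro span_mono image_mono) auto
  have col_U: "i < j \<Longrightarrow> column i A \<in> U j" for i j unfolding U_def by (intro span_base) auto
  have w_U: "w i \<in> U j" if "i < j" for i j
  proof -
    have "column i A - w i \<in> U j" using w(1)[of i] U_mono[OF that] by blast
    with col_U[OF that] have "column i A - (column i A - w i) \<in> U j"
      unfolding U_def by (rule span_diff)
    then show ?thesis by simp
  qed
  define Q :: "'n rmat" where "Q = (\<chi> i j. w j $ i / norm (w j))"
  have col_Q: "column j Q = (1 / norm (w j)) *\<^sub>R w j" for j
    by (simp add: Q_def column_def vec_eq_iff)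
  have "orthogonal (w i) (w j)" if "i \<noteq> j" for i j
    using that w(2) w_U by (metis linorder_neqE orthogonal_commute)
  then have Q: "orthogonal_matrix Q"
    using w_nz by (simp add: orthogonal_matrix_orthonormal_columns col_Q orthogonal_def)
  define R where "R = transpose Q ** A"
  have R: "R $ i $ j = (w i \<bullet> column j A) / norm (w i)" for i j
    by (simp add: R_def gram_entry Q_def inner_vec_def column_def sum_divide_distrib)
  have "upper R" unfolding upper_def R
    using w(2) col_U by (simp add: orthogonal_def)
  moreover have "0 < R $ i $ i" for i
  proof -
    have "w i \<bullet> column i A = w i \<bullet> w i"
      using w(2)[OF w(1), of i] by (simp add: orthogonal_def inner_diff_right)
    then show ?thesis using w_nz by (simp add: R)
  qed
  moreover have "A = Q ** R"
    using Q unfolding R_def orthogonal_matrix_def by (simp add: matrix_mul_assoc)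
  ultimately show ?thesis using Q by blast
qed

text \<open>Rows are determined one after the other: given the earlier rows, row \<open>i\<close> of
  the Gram matrix yields \<open>R $ i $ i * R $ i $ j\<close> for all \<open>j\<close>, in
  particular the diagonal entry through its square. Diagonal entries of \<open>R1\<close> may be 0
  here, so that the lemma applies on a closed set in \<open>cholesky_near\<close>.\<close>

lemma cholesky_unique:
  fixes R1 R2 :: "('n::{finite,linorder}) rmat"
  assumes up: "upper R1" "upper R2" and diag: "\<And>i. 0 \<le> R1 $ i $ i" "\<And>i. 0 < R2 $ i $ i"
    and eq: "transpose R1 ** R1 = transpose R2 ** R2"
  shows "R1 = R2"
proof -
  have "R1 $ i = R2 $ i" for i
  proof (induction "idx i" arbitrary: i rule: less_induct)
    case less
    then have prev: "R1 $ k = R2 $ k" if "k < i" for k using that idx_less by blast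
    have row: "(transpose R ** R) $ i $ j = (\<Sum>k\<in>{..<i}. R $ k $ i * R $ k $ j) + R $ i $ i * R $ i $ j"
      if "upper R" for R j
    proof -
      have "(transpose R ** R) $ i $ j = (\<Sum>k\<in>insert i {..<i}. R $ k $ i * R $ k $ j)"
        unfolding gram_entry using that
        by (intro sum.mono_neutral_right) (auto simp: upper_def)
      then show ?thesis by simp
    qed
    have *: "R1 $ i $ i * R1 $ i $ j = R2 $ i $ i * R2 $ i $ j" for j
      using row[OF up(1), of j] row[OF up(2), of j] eq prev by simp
    then have "(R1 $ i $ i)\<^sup>2 = (R2 $ i $ i)\<^sup>2" by (simp add: power2_eq_square)
    then have ii: "R1 $ i $ i = R2 $ i $ i" using diag less_imp_le by (metis power2_eq_imp_eq)
    then have "R1 $ i $ j = R2 $ i $ j" for j using *[of j] diag(2)[of i] by simp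
    then show ?case by (simp add: vec_eq_iff)
  qed
  then show ?thesis by (simp add: vec_eq_iff)
qed

lemma orthogonal_matrix_invertible:
  "orthogonal_matrix (Q :: real^'n^'n) \<Longrightarrow> invertible Q"
  unfolding invertible_def orthogonal_matrix_def by blast

lemma gram_orthogonal_mult:
  fixes Q R :: "real^'n^'n"
  assumes "orthogonal_matrix Q"
  shows "transpose (Q ** R) ** (Q ** R) = transpose R ** R"
proof -
  have "transpose (Q ** R) ** (Q ** R) = transpose R ** (transpose Q ** Q) ** R"
    by (simp add: matrix_transpose_mul matrix_mul_assoc)
  then show ?thesis using assms by (simp add: orthogonal_matrix)
qed

text \<open>Two decompositions have triangular factors with the same Gram matrix, that of
  \<open>A\<close>, so these factors agree by \<open>cholesky_unique\<close>; cancelling the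
  invertible \<open>R\<close> identifies the orthogonal factors.\<close>

lemma qf_eqI:
  fixes A :: "('n::{finite,linorder}) rmat"
  assumes inv: "invertible A" and Q: "orthogonal_matrix Q" and R: "upper R" "\<And>i. 0 < R $ i $ i"
    and A: "A = Q ** R"
  shows "qf A = Q"
  unfolding qf_def
proof (rule the_equality)
  show "orthogonal_matrix Q \<and> (\<exists>R. (\<forall>i j. j < i \<longrightarrow> R $ i $ j = 0) \<and> (\<forall>i. 0 < R $ i $ i) \<and> A = Q ** R)"
    by (intro conjI exI[of _ R]) (use Q R A in \<open>simp_all add: upper_def\<close>)
  fix Q'
  assume "orthogonal_matrix Q' \<and> (\<exists>R. (\<forall>i j. j < i \<longrightarrow> R $ i $ j = 0) \<and> (\<forall>i. 0 < R $ i $ i) \<and> A = Q' ** R)"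
  then obtain R' where Q': "orthogonal_matrix Q'" and R': "upper R'" "\<And>i. 0 < R' $ i $ i" "A = Q' ** R'"
    unfolding upper_def by blast
  have "transpose R' ** R' = transpose A ** A"
    unfolding R'(3) by (rule gram_orthogonal_mult[OF Q', symmetric])
  also have "\<dots> = transpose R ** R"
    unfolding A by (rule gram_orthogonal_mult[OF Q])
  finally have "R' = R"
    by (rule cholesky_unique[OF R'(1) R(1) less_imp_le[OF R'(2)] R(2)])
  have "R = transpose Q ** A"
    using Q unfolding A orthogonal_matrix by (simp add: matrix_mul_assoc)
  moreover have "invertible (transpose Q ** A)"
    using Q by (intro invertible_mult inv orthogonal_matrix_invertible)
      (simp add: orthogonal_matrix_transpose)
  ultimately have "invertible R" by simp
  then obtain B where B: "R ** B = mat 1" unfolding invertible_def by blast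
  have "Q' ** R ** B = Q ** R ** B" using A R'(3) unfolding \<open>R' = R\<close> by simp
  then show "Q' = Q" using B by (simp add: matrix_mul_assoc[symmetric])
qed

lemma transpose_add: "transpose (A + B) = transpose A + transpose B"
  by (simp add: transpose_def vec_eq_iff)

lemma matrix_diff_ldistrib: "A ** (B - C) = A ** B - A ** (C :: real^'n^'m)"
  by (simp add: matrix_matrix_mult_def vec_eq_iff right_diff_distrib sum_subtractf)

lemma matrix_add_rdistrib: "(A + B) ** C = A ** C + B ** (C :: real^'n^'m)"
  by (simp add: matrix_matrix_mult_def vec_eq_iff distrib_right sum.distrib)

lemma skew_inner:
  fixes x :: "real^'n"
  assumes "transpose \<Omega> = - \<Omega>"
  shows "x \<bullet> (\<Omega> *v x) = 0"
proof -
  have "x \<bullet> (\<Omega> *v x) = (transpose \<Omega> *v x) \<bullet> x"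
    by (simp add: dot_lmul_matrix[symmetric])
  also have "(transpose \<Omega> *v x) = - (\<Omega> *v x)"
    unfolding assms by (simp add: vec_eq_iff matrix_vector_mult_def sum_negf)
  finally show ?thesis by (simp add: inner_commute)
qed

text \<open>Makes the QR retraction meaningful on the whole tangent space: \<open>x\<close> is
  orthogonal to \<open>\<Omega> *v x\<close>, so the kernel is trivial.\<close>

lemma invertible_add_skew:
  fixes \<Omega> :: "real^'n^'n"
  assumes "transpose \<Omega> = - \<Omega>"
  shows "invertible (mat 1 + \<Omega>)"
proof -
  have "x = 0" if "(mat 1 + \<Omega>) *v x = 0" for x
  proof -
    have "0 = x \<bullet> ((mat 1 + \<Omega>) *v x)" using that by simp
    also have "\<dots> = x \<bullet> x"
      using skew_inner[OF assms] by (simp add: matrix_vector_mult_add_rdistrib inner_add_right)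
    finally show ?thesis by simp
  qed
  then show ?thesis
    using invertible_left_inverse matrix_left_invertible_ker by blast
qed

text \<open>With \<open>P = R - 1\<close> one has \<open>P + P\<^sup>T = (R\<^sup>T R - 1) - P\<^sup>T P\<close>, and \<open>\<parallel>P\<parallel> \<le> \<parallel>P + P\<^sup>T\<parallel>\<close> because \<open>P\<close> is
  triangular; that \<open>P\<close> is small at all follows by compactness from uniqueness.\<close>

lemma cholesky_near:
  shows "\<exists>\<eta>>0. \<forall>R :: ('n::{finite,linorder}) rmat. upper R \<longrightarrow> (\<forall>i. 0 \<le> R $ i $ i) \<longrightarrow>
    norm (transpose R ** R - mat 1) < \<eta> \<longrightarrow> norm (R - mat 1) \<le> 2 * norm (transpose R ** R - mat 1)"
proof -
  let ?e = "\<lambda>R :: 'n rmat. norm (transpose R ** R - mat 1)"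
  \<comment> \<open>Matrices with Gram matrix close to the identity that are themselves far from it.
    On this compact set \<open>?e\<close> is positive by uniqueness, so its minimum gives a
    threshold below which \<open>norm (R - mat 1) < 1 / 2\<close>.\<close>
  define K where "K = {R :: 'n rmat. upper R \<and> (\<forall>i. 0 \<le> R $ i $ i) \<and> ?e R \<le> 1 \<and> 1 / 2 \<le> norm (R - mat 1)}"
  have cont: "continuous_on UNIV (\<lambda>R :: 'n rmat. transpose R ** R)"
    unfolding matrix_matrix_mult_def transpose_def by (intro continuous_intros)
  have cont_e: "continuous_on UNIV ?e" by (intro continuous_intros cont)
  have "closed {R :: 'n rmat. \<forall>i j. j < i \<longrightarrow> R $ i $ j = 0}"
    by (intro closed_Collect_all closed_Collect_imp open_Collect_const closed_Collect_eq continuous_intros)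
  moreover have "closed {R :: 'n rmat. \<forall>i. 0 \<le> R $ i $ i}"
    by (intro closed_Collect_all closed_Collect_le continuous_intros)
  moreover have "closed {R. ?e R \<le> 1}"
    by (intro closed_Collect_le cont_e continuous_on_const)
  moreover have "closed {R :: 'n rmat. 1 / 2 \<le> norm (R - mat 1)}"
    by (intro closed_Collect_le continuous_intros)
  ultimately have "closed K" unfolding K_def upper_def by (intro closed_Collect_conj)
  moreover have "bounded K" unfolding bounded_iff
  proof (intro exI[of _ "real CARD('n) * (real CARD('n) * 2)"] ballI norm_matrix_le_entries)
    fix R i j assume "R \<in> K"
    have "\<bar>(transpose R ** R - mat 1) $ j $ j\<bar> \<le> 1"
      using \<open>R \<in> K\<close> entry_le_norm order_trans unfolding K_def by blast
    then have "(\<Sum>k\<in>UNIV. R $ k $ j * R $ k $ j) \<le> 2"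
      by (simp add: gram_entry mat_def)
    moreover have "R $ i $ j * R $ i $ j \<le> (\<Sum>k\<in>UNIV. R $ k $ j * R $ k $ j)"
      by (rule member_le_sum) auto
    ultimately show "\<bar>R $ i $ j\<bar> \<le> 2"
      using abs_le_square_iff[of "R $ i $ j" 2] by (simp add: power2_eq_square)
  qed
  ultimately have "compact K" using compact_eq_bounded_closed by blast
  have pos: "0 < ?e R" if "R \<in> K" for R
  proof -
    have "transpose R ** R \<noteq> transpose (mat 1) ** mat 1"
    proof
      assume "transpose R ** R = transpose (mat 1) ** mat 1"
      have "R = mat 1"
        by (rule cholesky_unique[OF _ _ _ _ \<open>transpose R ** R = _\<close>])
          (use that in \<open>auto simp: K_def upper_def mat_def\<close>)
      then show False using that by (simp add: K_def)
    qed
    then show ?thesis by (simp add: transpose_mat)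
  qed
  obtain \<eta> where \<eta>: "0 < \<eta>" "\<And>R. R \<in> K \<Longrightarrow> \<eta> \<le> ?e R"
  proof (cases "K = {}")
    case False
    obtain R0 where "R0 \<in> K" "\<And>R. R \<in> K \<Longrightarrow> ?e R0 \<le> ?e R"
      using continuous_attains_inf[OF \<open>compact K\<close> False continuous_on_subset[OF cont_e]] by blast
    then show ?thesis using that[OF pos] by blast
  qed (use that[of 1] in auto)
  have "norm (R - mat 1) \<le> 2 * ?e R"
    if R: "upper R" "\<forall>i. 0 \<le> R $ i $ i" and e: "?e R < min \<eta> 1" for R
  proof -
    define P where "P = R - mat 1"
    have "norm P < 1 / 2" 
    proof (rule ccontr)
      assume "\<not> norm P < 1 / 2"
      then have "R \<in> K" using R e by (simp add: K_def P_def)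
      then show False using \<eta>(2) e by fastforce
    qed
    have "norm P \<le> norm (P + transpose P)"
    proof (rule power2_le_imp_le)
      \<comment> \<open>Off the diagonal at least one of the entries of \<open>P\<close> at
        \<open>(i, j)\<close> and \<open>(j, i)\<close> is 0; on the diagonal the sum doubles the
        entry.\<close>
      have "\<bar>P $ i $ j\<bar> \<le> \<bar>(P + transpose P) $ i $ j\<bar>" for i j
        using R(1) by (cases i j rule: linorder_cases)
          (auto simp: P_def upper_def mat_def transpose_def)
      then have "P $ i $ j * P $ i $ j \<le> (P + transpose P) $ i $ j * (P + transpose P) $ i $ j" for i j
        unfolding power2_eq_square[symmetric] abs_le_square_iff[symmetric] .
      then show "(norm P)\<^sup>2 \<le> (norm (P + transpose P))\<^sup>2"
        unfolding power2_norm_eq_inner inner_vec_def inner_real_def by (intro sum_mono)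
    qed simp
    moreover have "P + transpose P = (transpose R ** R - mat 1) - transpose P ** P"
    proof -
      have "transpose R ** R = mat 1 + P + transpose P + transpose P ** P"
      proof -
        have "R = mat 1 + P" by (simp add: P_def)
        then show ?thesis
          by (simp only: matrix_add_ldistrib matrix_add_rdistrib transpose_mat transpose_add
              matrix_mul_lid matrix_mul_rid add_ac)
      qed
      then show ?thesis by simp
    qed
    moreover have "norm (transpose R ** R - mat 1 - transpose P ** P) \<le> ?e R + norm P * norm P"
      using norm_triangle_ineq4[of "transpose R ** R - mat 1" "transpose P ** P"]
        norm_matrix_mult_le[of "transpose P" P] unfolding norm_transpose by linarith
    \<comment> \<open>The preliminary bound 1/2 lets the quadratic term be absorbed on the left,
      which produces the factor 2.\<close>
    moreover have "norm P * norm P \<le> 1 / 2 * norm P"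
      using \<open>norm P < 1 / 2\<close> by (intro mult_right_mono) auto
    ultimately have "norm P \<le> 2 * ?e R" by simp
    then show ?thesis unfolding P_def .
  qed
  then show ?thesis using \<eta>(1) by (intro exI[of _ "min \<eta> 1"]) auto
qed

lemma norm_orthogonal_mult:
  fixes Q A :: "real^'n^'n"
  assumes "orthogonal_matrix Q"
  shows "norm (Q ** A) = norm A" "norm (A ** Q) = norm A"
proof -
  have 1: "norm (Q ** A) = norm A" if "orthogonal_matrix Q" for Q A :: "real^'n^'n"
  proof -
    have "norm (column j (Q ** A)) = norm (column j A)" for j
    proof -
      have "column j (Q ** A) = Q *v column j A"
        by (simp add: column_def matrix_matrix_mult_def matrix_vector_mult_def)
      then show ?thesis using that
        by (metis orthogonal_transformation orthogonal_transformation_matrix matrix_of_matrix_vector_mul matrix_vector_mul_linear)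
    qed
    moreover have "(norm X)\<^sup>2 = (\<Sum>j\<in>UNIV. (norm (column j X))\<^sup>2)" for X :: "real^'n^'n"
      using norm_matrix_squared[of "transpose X"] unfolding norm_transpose
      by (simp add: column_def transpose_def)
    ultimately have "(norm (Q ** A))\<^sup>2 = (norm A)\<^sup>2" by simp
    then show ?thesis by simp
  qed
  show "norm (Q ** A) = norm A" using 1 assms .
  show "norm (A ** Q) = norm A"
    using 1[of "transpose Q" "transpose A"] assms
    by (simp add: orthogonal_matrix_transpose matrix_transpose_mul[symmetric])
qed

text \<open>The Gram matrix of \<open>R\<close> is that of \<open>mat 1 + \<Omega>\<close>, in which
  the linear terms cancel by skewness. Hence \<open>R\<close> differs from the identity only in
  second order.\<close>

lemma qf_add_skew:
  fixes \<Omega> :: "('n::{finite,linorder}) rmat"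
  assumes Q: "orthogonal_matrix Q" and \<Omega>: "transpose \<Omega> = - \<Omega>"
  obtains R where "upper R" "\<And>i. 0 < R $ i $ i" "orthogonal_matrix (qf (Q + Q ** \<Omega>))"
    "Q + Q ** \<Omega> = qf (Q + Q ** \<Omega>) ** R" "transpose R ** R - mat 1 = transpose \<Omega> ** \<Omega>"
proof -
  have QA: "Q + Q ** \<Omega> = Q ** (mat 1 + \<Omega>)" by (simp add: matrix_add_ldistrib)
  have inv: "invertible (Q + Q ** \<Omega>)" unfolding QA
    by (rule invertible_mult[OF orthogonal_matrix_invertible[OF Q] invertible_add_skew[OF \<Omega>]])
  obtain Q' R where QR: "orthogonal_matrix Q'" "upper R" "\<And>i. 0 < R $ i $ i" "Q + Q ** \<Omega> = Q' ** R"
    using qr_exists[OF inv] by blast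
  have qf: "qf (Q + Q ** \<Omega>) = Q'" by (rule qf_eqI[OF inv QR])
  have "transpose R ** R = transpose (Q' ** R) ** (Q' ** R)"
    by (rule gram_orthogonal_mult[OF QR(1), symmetric])
  also have "\<dots> = transpose (mat 1 + \<Omega>) ** (mat 1 + \<Omega>)"
    unfolding QR(4)[symmetric] QA by (rule gram_orthogonal_mult[OF Q])
  also have "\<dots> = mat 1 + transpose \<Omega> ** \<Omega>"
  proof -
    have "transpose (mat 1 + \<Omega>) = mat 1 + - \<Omega>"
      by (simp add: transpose_add transpose_mat \<Omega>)
    then show ?thesis
      by (simp only: matrix_add_rdistrib matrix_add_ldistrib matrix_mul_lid matrix_mul_rid \<Omega>) simp
  qed
  finally show ?thesis using that[of R] QR qf by simp
qed

text \<open>The error equals \<open>- (qf (Q + Q ** \<Omega>) ** (R - mat 1))\<close>, and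
  \<open>norm (R - mat 1)\<close> is at most twice the square of \<open>norm \<Omega>\<close>. The
  bounds 1 and \<open>\<mu>\<close> on \<open>norm \<Omega>\<close> make
  \<open>cholesky_near\<close> applicable, \<open>\<epsilon> / 2\<close> turns the square into
  \<open>\<epsilon> * norm \<Omega>\<close>.\<close>

lemma qf_near:
  assumes "0 < \<epsilon>"
  shows "\<exists>\<eta>>0. \<forall>Q \<Omega> :: ('n::{finite,linorder}) rmat. orthogonal_matrix Q \<longrightarrow> transpose \<Omega> = - \<Omega> \<longrightarrow>
    norm \<Omega> < \<eta> \<longrightarrow> norm (qf (Q + Q ** \<Omega>) - Q - Q ** \<Omega>) \<le> \<epsilon> * norm \<Omega>"
proof -
  obtain \<mu> where \<mu>: "0 < \<mu>" "\<And>R :: 'n rmat. upper R \<Longrightarrow> (\<forall>i. 0 \<le> R $ i $ i) \<Longrightarrow>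
    norm (transpose R ** R - mat 1) < \<mu> \<Longrightarrow> norm (R - mat 1) \<le> 2 * norm (transpose R ** R - mat 1)"
    using cholesky_near by metis
  have "norm (qf (Q + Q ** \<Omega>) - Q - Q ** \<Omega>) \<le> \<epsilon> * norm \<Omega>"
    if Q: "orthogonal_matrix Q" and \<Omega>: "transpose \<Omega> = - \<Omega>" and small: "norm \<Omega> < min 1 (min \<mu> (\<epsilon> / 2))"
    for Q \<Omega> :: "'n rmat"
  proof -
    obtain R where R: "upper R" "\<And>i. 0 < R $ i $ i" "orthogonal_matrix (qf (Q + Q ** \<Omega>))"
      "Q + Q ** \<Omega> = qf (Q + Q ** \<Omega>) ** R" "transpose R ** R - mat 1 = transpose \<Omega> ** \<Omega>"
      using qf_add_skew[OF Q \<Omega>] by blast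
    have sq: "norm (transpose \<Omega> ** \<Omega>) \<le> norm \<Omega> * norm \<Omega>"
      using norm_matrix_mult_le[of "transpose \<Omega>" \<Omega>] by simp
    also have "\<dots> \<le> norm \<Omega> * 1" using small by (intro mult_left_mono) auto
    also have "\<dots> < \<mu>" using small by simp
    finally have "norm (R - mat 1) \<le> 2 * norm (transpose \<Omega> ** \<Omega>)"
      using \<mu>(2)[OF R(1)] R(2) less_imp_le unfolding R(5) by blast
    also have "\<dots> \<le> 2 * norm \<Omega> * norm \<Omega>" using sq by simp
    also have "\<dots> \<le> \<epsilon> * norm \<Omega>" using small by (intro mult_right_mono) auto
    finally have "norm (R - mat 1) \<le> \<epsilon> * norm \<Omega>" .
    moreover have "qf (Q + Q ** \<Omega>) - Q - Q ** \<Omega> = - (qf (Q + Q ** \<Omega>) ** (R - mat 1))"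
    proof -
      have "qf (Q + Q ** \<Omega>) ** (R - mat 1) = qf (Q + Q ** \<Omega>) ** R - qf (Q + Q ** \<Omega>)"
        by (simp add: matrix_diff_ldistrib)
      then show ?thesis unfolding R(4)[symmetric] by simp
    qed
    ultimately show ?thesis using norm_orthogonal_mult(1)[OF R(3)] by simp
  qed
  then show ?thesis using \<mu>(1) assms by (intro exI[of _ "min 1 (min \<mu> (\<epsilon> / 2))"]) auto
qed

section \<open>Tangent spaces and the metric\<close>

abbreviation pS :: "'n point \<Rightarrow> ('n::finite) rmat" where "pS x \<equiv> fst x"
abbreviation pQ :: "'n point \<Rightarrow> ('n::finite) rmat" where "pQ x \<equiv> fst (snd x)"
abbreviation pV :: "'n point \<Rightarrow> ('n::finite) rmat" where "pV x \<equiv> fst (snd (snd x))"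
abbreviation pa :: "'n point \<Rightarrow> ('n::finite) rvec" where "pa x \<equiv> fst (snd (snd (snd x)))"
abbreviation pb :: "'n point \<Rightarrow> ('n::finite) rvec" where "pb x \<equiv> snd (snd (snd (snd x)))"

lemma inner_point: "(x :: ('n::finite) point) \<bullet> y
    = pS x \<bullet> pS y + pQ x \<bullet> pQ y + pV x \<bullet> pV y + pa x \<bullet> pa y + pb x \<bullet> pb y"
  by (simp add: inner_prod_def)

lemma norm_point_components:
  "norm (pS x) \<le> norm (x :: ('n::finite) point)" "norm (pQ x) \<le> norm x" "norm (pV x) \<le> norm x"
  "norm (pa x) \<le> norm x" "norm (pb x) \<le> norm x"
proof -
  have fst: "norm (fst z) \<le> norm z" and snd: "norm (snd z) \<le> norm z"
    for z :: "'a::real_normed_vector \<times> 'b::real_normed_vector"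
    using norm_fst_le[of "fst z" "snd z"] norm_snd_le[of "snd z" "fst z"] by simp_all
  show "norm (pS x) \<le> norm x" by (rule fst)
  show "norm (pQ x) \<le> norm x" using fst[of "snd x"] snd[of x] by linarith
  show "norm (pV x) \<le> norm x" using fst[of "snd (snd x)"] snd[of "snd x"] snd[of x] by linarith
  show "norm (pa x) \<le> norm x"
    using fst[of "snd (snd (snd x))"] snd[of "snd (snd x)"] snd[of "snd x"] snd[of x] by linarith
  show "norm (pb x) \<le> norm x"
    using snd[of "snd (snd (snd x))"] snd[of "snd (snd x)"] snd[of "snd x"] snd[of x] by linarith
qed

lemma norm_point_le:
  "norm (x :: ('n::finite) point) \<le> norm (pS x) + norm (pQ x) + norm (pV x) + norm (pa x) + norm (pb x)"
proof -
  have "norm x \<le> norm (pS x) + norm (snd x)"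
    "norm (snd x) \<le> norm (pQ x) + norm (snd (snd x))"
    "norm (snd (snd x)) \<le> norm (pV x) + norm (snd (snd (snd x)))"
    "norm (snd (snd (snd x))) \<le> norm (pa x) + norm (pb x)"
    by (metis norm_Pair_le prod.collapse)+
  then show ?thesis by linarith
qed

lemma manifold_iff: "x \<in> manifold s t \<longleftrightarrow>
    pS x \<in> OB \<and> pQ x \<in> Orth \<and> pV x \<in> V_space s t \<and> pa x \<in> Rpos t \<and> pb x \<in> Rvec t"
  by (cases x) (auto simp: manifold_def)

lemma proj_OB_nth: "proj_OB S \<Xi> $ i = \<Xi> $ i - (S $ i \<bullet> \<Xi> $ i) *\<^sub>R S $ i"
  by (simp add: proj_OB_def diag_part_def matrix_matrix_mult_def transpose_def vec_eq_iff inner_vec_def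
      if_distrib[of "\<lambda>x. x * _"] cong: if_cong)

lemma tangent_OB_iff: "diag_part (S ** transpose \<Xi>) = 0 \<longleftrightarrow> (\<forall>i. S $ i \<bullet> \<Xi> $ i = 0)"
  by (auto simp: diag_part_def matrix_matrix_mult_def transpose_def vec_eq_iff inner_vec_def)

lemma tangent_iff: "\<xi> \<in> tangent s t x \<longleftrightarrow>
    (\<forall>i. pS x $ i \<bullet> pS \<xi> $ i = 0) \<and> (\<exists>\<Omega>. pQ \<xi> = pQ x ** \<Omega> \<and> transpose \<Omega> = - \<Omega>) \<and>
    pV \<xi> \<in> V_space s t \<and> pa \<xi> \<in> Rvec t \<and> pb \<xi> \<in> Rvec t"
  by (cases x, cases \<xi>) (auto simp: tangent_def tangent_OB_iff)

lemma proj_Orth_eq: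
  assumes "orthogonal_matrix Q"
  shows "proj_Orth Q \<Xi> = (1 / 2) *\<^sub>R (\<Xi> - Q ** transpose \<Xi> ** Q)"
  using assms unfolding proj_Orth_def orthogonal_matrix_def
  by (simp add: matrix_diff_ldistrib matrix_mul_assoc)

lemma matrix_scaleR_right: "A ** (c *\<^sub>R B) = c *\<^sub>R (A ** (B :: real^'n^'m))"
  by (simp add: matrix_matrix_mult_def vec_eq_iff sum_distrib_left mult.left_commute)



lemma inner_matrix_mult: "(A ** B) \<bullet> C = B \<bullet> (transpose A ** (C :: real^'n^'m))"
proof -
  let ?f = "\<lambda>i j k. A $ i $ k * B $ k $ j * C $ i $ j"
  have "(A ** B) \<bullet> C = (\<Sum>i\<in>UNIV. \<Sum>j\<in>UNIV. \<Sum>k\<in>UNIV. ?f i j k)"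
    by (simp add: inner_vec_def matrix_matrix_mult_def sum_distrib_right)
  also have "\<dots> = (\<Sum>i\<in>UNIV. \<Sum>k\<in>UNIV. \<Sum>j\<in>UNIV. ?f i j k)"
    by (rule sum.cong[OF refl]) (rule sum.swap)
  also have "\<dots> = (\<Sum>k\<in>UNIV. \<Sum>i\<in>UNIV. \<Sum>j\<in>UNIV. ?f i j k)" by (rule sum.swap)
  also have "\<dots> = (\<Sum>k\<in>UNIV. \<Sum>j\<in>UNIV. \<Sum>i\<in>UNIV. ?f i j k)"
    by (rule sum.cong[OF refl]) (rule sum.swap)
  also have "\<dots> = B \<bullet> (transpose A ** C)"
    by (simp add: inner_vec_def matrix_matrix_mult_def transpose_def sum_distrib_left
        mult.assoc mult.left_commute)
  finally show ?thesis .
qed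

lemma inner_transpose: "transpose X \<bullet> transpose Y = X \<bullet> (Y :: real^'n^'m)"
  unfolding inner_vec_def by (simp add: transpose_def) (rule sum.swap)

lemma transpose_diff: "transpose (A - B) = transpose A - transpose (B :: real^'n^'m)"
  by (simp add: transpose_def vec_eq_iff)

lemma transpose_scaleR: "transpose (c *\<^sub>R A) = c *\<^sub>R transpose (A :: real^'n^'m)"
  by (simp add: transpose_def vec_eq_iff)

lemma proj_Orth_in:
  fixes Q \<Xi> :: "real^'n^'n"
  shows "\<exists>\<Omega>. proj_Orth Q \<Xi> = Q ** \<Omega> \<and> transpose \<Omega> = - \<Omega>"
proof (intro exI conjI)
  show "proj_Orth Q \<Xi> = Q ** ((1 / 2) *\<^sub>R (transpose Q ** \<Xi> - transpose \<Xi> ** Q))"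
    by (simp add: proj_Orth_def matrix_scaleR_right)
  show "transpose ((1 / 2) *\<^sub>R (transpose Q ** \<Xi> - transpose \<Xi> ** Q))
      = - ((1 / 2) *\<^sub>R (transpose Q ** \<Xi> - transpose \<Xi> ** Q))"
    by (simp add: transpose_diff transpose_scaleR matrix_transpose_mul scaleR_diff_right)
qed

text \<open>\<open>proj_Orth\<close> keeps the skew part of \<open>transpose Q ** G\<close>; the
  symmetric part that it removes is orthogonal to every skew \<open>\<Omega>\<close>.\<close>

lemma inner_proj_Orth:
  fixes Q G \<Omega> :: "real^'n^'n"
  assumes Q: "orthogonal_matrix Q" and \<Omega>: "transpose \<Omega> = - \<Omega>"
  shows "proj_Orth Q G \<bullet> (Q ** \<Omega>) = G \<bullet> (Q ** \<Omega>)"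
proof -
  let ?X = "transpose Q ** G"
  have X: "transpose ?X = transpose G ** Q" by (simp add: matrix_transpose_mul)
  have "proj_Orth Q G \<bullet> (Q ** \<Omega>) = (1 / 2) * ((Q ** (?X - transpose ?X)) \<bullet> (Q ** \<Omega>))"
    unfolding X by (simp add: proj_Orth_def)
  also have "(Q ** (?X - transpose ?X)) \<bullet> (Q ** \<Omega>) = (?X - transpose ?X) \<bullet> \<Omega>"
    using Q by (simp add: inner_matrix_mult matrix_mul_assoc orthogonal_matrix)
  also have "transpose ?X \<bullet> \<Omega> = - (?X \<bullet> \<Omega>)"
    using inner_transpose[of ?X \<Omega>] by (simp add: \<Omega>)
  then have "(?X - transpose ?X) \<bullet> \<Omega> = 2 * (?X \<bullet> \<Omega>)" by (simp add: inner_diff_left)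
  also have "?X \<bullet> \<Omega> = G \<bullet> (Q ** \<Omega>)"
    by (simp add: inner_matrix_mult)
  finally show ?thesis by simp
qed

lemma proj_Orth_id:
  fixes Q \<Omega> :: "real^'n^'n"
  assumes "orthogonal_matrix Q" "transpose \<Omega> = - \<Omega>"
  shows "proj_Orth Q (Q ** \<Omega>) = Q ** \<Omega>"
proof -
  have "transpose Q ** (Q ** \<Omega>) = \<Omega>"
    using assms(1) by (simp add: matrix_mul_assoc orthogonal_matrix)
  moreover have "transpose (Q ** \<Omega>) ** Q = - \<Omega>"
    using assms by (simp add: matrix_transpose_mul matrix_mul_assoc[symmetric] orthogonal_matrix)
  moreover have "\<Omega> - - \<Omega> = 2 *\<^sub>R \<Omega>" by (simp add: scaleR_2)
  ultimately show ?thesis unfolding proj_Orth_def by (simp only: matrix_scaleR_right) simp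
qed

context spectrum
begin

text \<open>Exhibits the space as a coordinate subspace: every condition is the vanishing of one
  entry. This gives its orthogonal projection and its closedness.\<close>

lemma V_space_iff:
  "V \<in> V_space s t \<longleftrightarrow> (\<forall>i j. \<not> (i < j \<and> (\<forall>k\<in>{1..t}. \<not> (i = p k \<and> j = q k))) \<longrightarrow> V $ i $ j = 0)"
  unfolding V_space_def p_def[symmetric] q_def[symmetric] using p_less_q
  by (auto simp: not_less)

text \<open>A 0-1 mask as a constant factor, so that continuity follows from the rules for
  products.\<close>

definition proj_V :: "'n rmat \<Rightarrow> 'n rmat" where
  "proj_V X = (\<chi> i j. (if i < j \<and> (\<forall>k\<in>{1..t}. \<not> (i = p k \<and> j = q k)) then 1 else 0) * X $ i $ j)"

lemma proj_V_in: "proj_V X \<in> V_space s t"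
  by (auto simp: V_space_iff proj_V_def)

lemma inner_proj_V: "V \<in> V_space s t \<Longrightarrow> proj_V X \<bullet> V = X \<bullet> V"
  unfolding inner_vec_def V_space_iff proj_V_def by (intro sum.cong refl) auto

lemma subspace_V: "subspace (V_space s t :: 'n rmat set)"
  unfolding V_space_def subspace_def by auto

lemma subspace_Rvec: "subspace (Rvec t :: 'n rvec set)"
  unfolding Rvec_def subspace_def by auto

lemma subspace_skew_image: "subspace {X. \<exists>\<Omega>. X = Q ** \<Omega> \<and> transpose \<Omega> = - (\<Omega> :: real^'m^'m)}"
proof -
  have "subspace {\<Omega> :: real^'m^'m. transpose \<Omega> = - \<Omega>}"
    by (auto simp: subspace_def transpose_add transpose_scaleR) (simp add: transpose_def vec_eq_iff)
  moreover have "linear ((**) Q)"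
    by (auto intro!: linearI simp: matrix_add_ldistrib matrix_scaleR_right)
  ultimately have "subspace ((**) Q ` {\<Omega>. transpose \<Omega> = - \<Omega>})"
    using linear_subspace_image by blast
  moreover have "(**) Q ` {\<Omega>. transpose \<Omega> = - \<Omega>} = {X. \<exists>\<Omega>. X = Q ** \<Omega> \<and> transpose \<Omega> = - \<Omega>}" by auto
  ultimately show ?thesis by simp
qed

lemma subspace_tangent: "subspace (tangent s t (x :: 'n point))"
proof -
  have "subspace {\<Xi> :: 'n rmat. \<forall>i. pS x $ i \<bullet> \<Xi> $ i = 0}"
    by (auto simp: subspace_def inner_add_right)
  then have "subspace ({\<Xi> :: 'n rmat. \<forall>i. pS x $ i \<bullet> \<Xi> $ i = 0} \<times>
      {X. \<exists>\<Omega>. X = pQ x ** \<Omega> \<and> transpose \<Omega> = - \<Omega>} \<times> (V_space s t :: 'n rmat set) \<times> (Rvec t :: 'n rvec set) \<times> (Rvec t :: 'n rvec set))"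
    by (intro subspace_Times subspace_skew_image subspace_V subspace_Rvec)
  moreover have "tangent s t x = {\<Xi> :: 'n rmat. \<forall>i. pS x $ i \<bullet> \<Xi> $ i = 0} \<times>
      {X. \<exists>\<Omega>. X = pQ x ** \<Omega> \<and> transpose \<Omega> = - \<Omega>} \<times> V_space s t \<times> Rvec t \<times> Rvec t"
    unfolding set_eq_iff tangent_iff by auto
  ultimately show ?thesis by simp
qed

lemma sum_pos: "(\<Sum>k = 1..t. f (pos k :: 'n)) = (\<Sum>i | idx i \<le> t. f i)"
proof (rule sum.reindex_bij_witness[of _ idx pos])
  show "pos k \<in> {i :: 'n. idx i \<le> t}" "idx (pos k :: 'n) = k" if "k \<in> {1..t}" for k
    using idx_pos_k[OF that] that by auto
  show "idx i \<in> {1..t}" if "i \<in> {i :: 'n. idx i \<le> t}" for i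
    using that idx_range(1)[of i] by auto
qed auto

lemma Rpos_D:
  assumes "(u :: 'n rvec) \<in> Rpos t"
  shows "j \<in> {1..t} \<Longrightarrow> 0 < u $ pos j" "u \<in> Rvec t"
  using assms idx_pos_k[of j] by (auto simp: Rpos_def)

lemma riem_metric_eq:
  "riem_metric t x \<xi> \<eta> = pS \<xi> \<bullet> pS \<eta> + pQ \<xi> \<bullet> pQ \<eta> + pV \<xi> \<bullet> pV \<eta>
    + (\<Sum>i | idx i \<le> t. pa \<xi> $ i * pa \<eta> $ i / (pa x $ i)\<^sup>2) + pb \<xi> \<bullet> pb (\<eta> :: 'n point)"
  unfolding sum_pos[symmetric] by (cases x, cases \<xi>, cases \<eta>) (simp add: riem_metric_def)

lemma riem_metric_sym: "riem_metric t x \<xi> \<eta> = riem_metric t x \<eta> (\<xi> :: 'n point)"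
  by (simp add: riem_metric_eq inner_commute mult.commute)

lemma riem_metric_bilinear: "bilinear (riem_metric t (x :: 'n point))"
proof -
  have "linear (riem_metric t x \<xi>)" for \<xi>
    by (rule linearI) (simp_all add: riem_metric_eq inner_add_right sum.distrib distrib_left
        add_divide_distrib sum_distrib_left mult.left_commute)
  moreover have "(\<lambda>\<xi>. riem_metric t x \<xi> \<eta>) = riem_metric t x \<eta>" for \<eta>
    by (rule ext) (rule riem_metric_sym)
  ultimately show ?thesis unfolding bilinear_def by simp
qed

definition proj_R :: "'n rvec \<Rightarrow> 'n rvec" where
  "proj_R u = (\<chi> i. (if idx i \<le> t then 1 else 0) * u $ i)"

lemma proj_R_in: "proj_R u \<in> Rvec t"
  by (auto simp: Rvec_def proj_R_def)

lemma inner_Rvec: "v \<in> Rvec t \<Longrightarrow> u \<bullet> v = (\<Sum>i | idx i \<le> t. u $ i * v $ (i :: 'n))"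
  unfolding inner_vec_def inner_real_def
  by (rule sum.mono_neutral_right) (auto simp: Rvec_def)

text \<open>The Riemannian gradient obtained from a Euclidean gradient \<open>G\<close> at \<open>x\<close>.\<close>

definition riem_of :: "'n point \<Rightarrow> 'n point \<Rightarrow> 'n point" where
  "riem_of x G = (proj_OB (pS x) (pS G), proj_Orth (pQ x) (pQ G), proj_V (pV G),
     proj_R (\<chi> i. (pa x $ i)\<^sup>2 * pa G $ i), proj_R (pb G))"

lemma riem_of_in:
  assumes "x \<in> manifold s t"
  shows "riem_of x G \<in> tangent s t x"
  using assms proj_Orth_in[of "pQ x" "pQ G"]
  by (auto simp: tangent_iff riem_of_def proj_V_in proj_R_in proj_OB_nth inner_diff_right
      manifold_iff OB_def dot_square_norm)

lemma riem_of_inner: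
  assumes x: "x \<in> manifold s t" and \<xi>: "\<xi> \<in> tangent s t x"
  shows "riem_metric t x (riem_of x G) \<xi> = G \<bullet> \<xi>"
proof -
  obtain \<Omega> where \<Omega>: "pQ \<xi> = pQ x ** \<Omega>" "transpose \<Omega> = - \<Omega>" using \<xi> by (auto simp: tangent_iff)
  have Q: "orthogonal_matrix (pQ x)" using x by (simp add: manifold_iff Orth_def)
  have S: "proj_OB (pS x) (pS G) \<bullet> pS \<xi> = pS G \<bullet> pS \<xi>"
    unfolding inner_vec_def[of _ "pS \<xi>"] using \<xi>
    by (simp add: proj_OB_nth inner_diff_left tangent_iff)
  \<comment> \<open>The factor \<open>(pa x $ i)\<^sup>2\<close> in \<open>riem_of\<close> cancels
    the weight of the metric.\<close>
  have a: "(\<Sum>i | idx i \<le> t. proj_R (\<chi> i. (pa x $ i)\<^sup>2 * pa G $ i) $ i * pa \<xi> $ i / (pa x $ i)\<^sup>2) = pa G \<bullet> pa \<xi>"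
  proof -
    have "pa x $ i \<noteq> 0" if "idx i \<le> t" for i using x that by (force simp: manifold_iff Rpos_def)
    then show ?thesis using \<xi> by (subst inner_Rvec) (auto simp: tangent_iff proj_R_def)
  qed
  have b: "proj_R (pb G) \<bullet> pb \<xi> = pb G \<bullet> pb \<xi>"
    using \<xi> by (simp add: inner_Rvec tangent_iff proj_R_def)
  show ?thesis using \<xi> unfolding riem_metric_eq inner_point[of G]
    by (simp add: riem_of_def S a b \<Omega>(1) inner_proj_Orth[OF Q \<Omega>(2)] inner_proj_V tangent_iff)
qed

end

section \<open>The objective function and its sublevel sets\<close>

lemma C1_on_if: "C1_on W f \<Longrightarrow> C1_on W g \<Longrightarrow> C1_on W (\<lambda>x. if P then f x else g x)"
  by (cases P) simp_all

context spectrum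
begin

text \<open>An open neighbourhood of the manifold in the ambient space on which \<open>T\<close> is
  invertible, so that the ordinary differential calculus applies to the objective.\<close>

definition U :: "'n point set" where
  "U = {x. \<forall>j\<in>{1..t}. 0 < pa x $ pos j}"

lemma open_U: "open U"
proof -
  have "U = (\<Inter>j\<in>{1..t}. {x. 0 < pa x $ pos j})" by (auto simp: U_def)
  moreover have "open {x :: 'n point. 0 < pa x $ pos j}" for j
    by (intro open_Collect_less continuous_intros)
  ultimately show ?thesis by (simp add: open_INT)
qed

lemma manifold_subset_U: "manifold s t \<subseteq> U"
  using Rpos_D by (auto simp: U_def manifold_iff)

lemma C1_mat_on_T:
  assumes "\<And>j. j \<in> {1..t} \<Longrightarrow> C1_on W (\<lambda>x. u x $ pos j)" "\<And>j. j \<in> {1..t} \<Longrightarrow> C1_on W (\<lambda>x. v x $ pos j)"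
    and "\<And>j x. j \<in> {1..t} \<Longrightarrow> x \<in> W \<Longrightarrow> u x $ pos j \<noteq> 0"
  shows "C1_mat_on W (\<lambda>x. T (u x) (v x))"
  unfolding C1_mat_on_def T_mat_def
proof (intro allI)
  fix i l :: 'n
  show "C1_on W (\<lambda>x. blockdiag s (\<lambda>_. 1) (\<lambda>k. T_block (u x $ pos k) (v x $ pos k)) $ i $ l)"
  proof (cases i rule: index_cases)
    case 1
    then show ?thesis by (simp add: blockdiag_small C1_on_const)
  next
    case (2 j)
    then show ?thesis unfolding 2(2) blockdiag_row_p[OF 2(1)] T_block_entries
      by (intro C1_on_add C1_on_if C1_on_const assms)
  next
    case (3 j)
    then show ?thesis unfolding 3(2) blockdiag_row_q[OF 3(1)] T_block_entries
      by (intro C1_on_add C1_on_if C1_on_const C1_on_inverse assms)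
  qed
qed

text \<open>Replaces the choice operator behind \<open>matrix_inv\<close> by the explicit inverse;
  the objective becomes a polynomial in the entries of the variables and the numbers
  \<open>1 / a $ pos j\<close>.\<close>

lemma objF_eq:
  assumes "x \<in> U"
  shows "objF s \<Lambda> x = 1 / 2 * (norm (pS x * pS x - pQ x ** N (pV x) (pa x) (pb x) ** transpose (pQ x)))\<^sup>2"
proof -
  have "pa x $ pos j \<noteq> 0" if "j \<in> {1..t}" for j using assms that by (force simp: U_def)
  then have "matrix_inv (T (pa x) (pb x)) = T (inv_vec (pa x)) (- pb x)" by (rule T_inverse)
  then show ?thesis by (simp add: objF_def N_def case_prod_unfold matrix_mul_assoc)
qed

lemma objF_C1: "C1_on U (objF s \<Lambda>)"
proof (rule C1_on_cong[OF open_U objF_eq[symmetric]])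
  have lin: "linear (pS :: 'n point \<Rightarrow> _)" "linear (pQ :: 'n point \<Rightarrow> _)" "linear (pV :: 'n point \<Rightarrow> _)"
    "linear (\<lambda>x :: 'n point. pa x $ i)" "linear (\<lambda>x :: 'n point. pb x $ i)" for i
    by (auto intro!: linearI)
  have T1: "C1_mat_on U (\<lambda>x. T (pa x) (pb x))"
    by (intro C1_mat_on_T C1_on_linear lin) (force simp: U_def)
  have T2: "C1_mat_on U (\<lambda>x. T (inv_vec (pa x)) (- pb x))"
  proof (rule C1_mat_on_T)
    fix j assume j: "j \<in> {1..t}"
    show "C1_on U (\<lambda>x. inv_vec (pa x) $ pos j)"
      unfolding inv_vec_nth using j by (intro C1_on_inverse C1_on_linear lin) (force simp: U_def)
    show "C1_on U (\<lambda>x. (- pb x) $ pos j)"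
      unfolding vector_uminus_component by (intro C1_on_minus C1_on_linear lin)
    show "inv_vec (pa x) $ pos j \<noteq> 0" if "x \<in> U" for x
      using that j by (force simp: U_def)
  qed
  show "C1_on U (\<lambda>x. 1 / 2 * (norm (pS x * pS x - pQ x ** N (pV x) (pa x) (pb x) ** transpose (pQ x)))\<^sup>2)"
    unfolding N_def
    by (intro C1_on_mult C1_on_const C1_on_norm_squared C1_mat_on_diff C1_mat_on_times C1_mat_on_mult
        C1_mat_on_add C1_mat_on_transpose C1_mat_on_const T1 T2 C1_mat_on_linear lin)
qed

lemma objF_nonneg: "0 \<le> objF s \<Lambda> x"
  by (simp add: objF_def case_prod_unfold)

lemma norm_OB_le: "S \<in> OB \<Longrightarrow> norm S \<le> real CARD('n)" for S :: "'n rmat"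
  using norm_matrix_le_rows[of S] by (simp add: OB_def)

lemma norm_Orth_le: "Q \<in> Orth \<Longrightarrow> norm Q \<le> real CARD('n)" for Q :: "'n rmat"
  using norm_matrix_le_rows[of Q] by (simp add: Orth_def orthogonal_matrix_orthonormal_rows row_def)

lemma norm_OB_square_le:
  assumes "S \<in> OB"
  shows "norm (S * S :: 'n rmat) \<le> real CARD('n) * real CARD('n)"
proof -
  have "\<bar>S $ i $ j\<bar> \<le> 1" for i j
    using assms Finite_Cartesian_Product.norm_nth_le[of "S $ i" j] by (simp add: OB_def)
  then have "\<bar>S $ i $ j\<bar> * \<bar>S $ i $ j\<bar> \<le> 1 * 1" for i j by (intro mult_mono) auto
  then show ?thesis using norm_matrix_le_entries[of "S * S" 1] by (simp add: abs_mult)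
qed

text \<open>Orthogonal factors do not change the Frobenius norm, so \<open>N\<close> is as large as
  the matrix compared with \<open>S * S\<close>, which is bounded on \<open>OB\<close>.\<close>

lemma N_bound:
  assumes x: "x \<in> manifold s t" and c: "objF s \<Lambda> x \<le> c"
  shows "norm (N (pV x) (pa x) (pb x)) \<le> real CARD('n) * real CARD('n) + sqrt (2 * c)"
proof -
  let ?N = "pQ x ** N (pV x) (pa x) (pb x) ** transpose (pQ x)"
  have Q: "orthogonal_matrix (pQ x)" using x by (simp add: manifold_iff Orth_def)
  have "norm (N (pV x) (pa x) (pb x)) = norm ?N"
    using Q by (simp add: norm_orthogonal_mult orthogonal_matrix_transpose)
  also have "\<dots> \<le> norm (pS x * pS x) + norm (pS x * pS x - ?N)"
    using norm_triangle_ineq4[of "pS x * pS x" "pS x * pS x - ?N"] by simp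
  also have "norm (pS x * pS x - ?N) \<le> sqrt (2 * c)"
    using c objF_eq[of x] x manifold_subset_U by (intro real_le_rsqrt) auto
  also have "norm (pS x * pS x) \<le> real CARD('n) * real CARD('n)"
    using x by (intro norm_OB_square_le) (simp add: manifold_iff)
  finally show ?thesis by simp
qed

text \<open>Undoes the conjugation: bounds on \<open>N\<close>, on \<open>T\<close> and on its
  inverse then bound \<open>V\<close>.\<close>

lemma D_plus_V_eq:
  assumes "x \<in> manifold s t"
  shows "D + pV x = T (inv_vec (pa x)) (- pb x) ** N (pV x) (pa x) (pb x) ** T (pa x) (pb x)"
proof -
  have "pa x $ pos j \<noteq> 0" if "j \<in> {1..t}" for j
    using assms manifold_subset_U that by (force simp: U_def)
  then have *: "T (inv_vec (pa x)) (- pb x) ** T (pa x) (pb x) = mat 1"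
    using T_mult_inverse[of "inv_vec (pa x)" "- pb x"] by simp
  have "T (inv_vec (pa x)) (- pb x) ** N (pV x) (pa x) (pb x) ** T (pa x) (pb x)
      = (T (inv_vec (pa x)) (- pb x) ** T (pa x) (pb x)) ** (D + pV x) **
        (T (inv_vec (pa x)) (- pb x) ** T (pa x) (pb x))"
    by (simp add: N_def matrix_mul_assoc)
  then show ?thesis by (simp add: *)
qed

lemma T_norm_le:
  assumes "\<And>j. j \<in> {1..t} \<Longrightarrow> \<bar>u $ pos j\<bar> \<le> C" "\<And>j. j \<in> {1..t} \<Longrightarrow> \<bar>v $ pos j\<bar> \<le> C"
    "\<And>j. j \<in> {1..t} \<Longrightarrow> \<bar>1 / u $ pos j\<bar> \<le> C" "1 \<le> C"
  shows "norm (T u v) \<le> real CARD('n) * (real CARD('n) * C)"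
proof (rule norm_matrix_le_entries)
  fix i l :: 'n
  show "\<bar>T u v $ i $ l\<bar> \<le> C" unfolding T_mat_def
    by (cases i rule: index_cases)
      (use assms pq_neq(3) in \<open>auto simp: blockdiag_small blockdiag_row_p blockdiag_row_q\<close>)
qed

lemma Rvec_norm_le:
  assumes "u \<in> Rvec t" "\<And>j. j \<in> {1..t} \<Longrightarrow> \<bar>u $ pos j\<bar> \<le> C" "0 \<le> C"
  shows "norm (u :: 'n rvec) \<le> real CARD('n) * C"
proof -
  have "\<bar>u $ i\<bar> \<le> C" for i
  proof (cases "idx i \<le> t")
    case True
    then show ?thesis using assms(2)[of "idx i"] idx_range(1)[of i] by simp
  qed (use assms in \<open>simp add: Rvec_def\<close>)
  then show ?thesis
    using order_trans[OF norm_le_l1_cart sum_bounded_above[of UNIV "\<lambda>j. \<bar>u $ j\<bar>" C]] by simp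
qed

lemma sublevel_bounds:
  "\<exists>C\<ge>1. \<forall>x\<in>manifold s t. objF s \<Lambda> x \<le> c \<longrightarrow> (\<forall>j\<in>{1..t}.
     \<bar>pa x $ pos j\<bar> \<le> C \<and> \<bar>pb x $ pos j\<bar> \<le> C \<and> \<bar>1 / pa x $ pos j\<bar> \<le> C)"
proof -
  define B where "B = real CARD('n) * real CARD('n) + sqrt (2 * c)"
  \<comment> \<open>A common positive lower bound of the imaginary parts; the inserted 1 keeps the
    set nonempty for \<open>t = 0\<close>.\<close>
  define L where "L = Min (insert 1 ((\<lambda>j. \<bar>Im (\<Lambda> $ p j)\<bar>) ` {1..t}))"
  have "0 < L" unfolding L_def using Im_nonzero by (subst Min_gr_iff) auto
  moreover have "L \<le> \<bar>Im (\<Lambda> $ p j)\<bar>" if "j \<in> {1..t}" for j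
    unfolding L_def using that by (intro Min_le) auto
  ultimately have L: "0 < L" "\<And>j. j \<in> {1..t} \<Longrightarrow> L \<le> \<bar>Im (\<Lambda> $ p j)\<bar>" by auto
  define C where "C = max 1 (B / L)"
  have "\<bar>pa x $ pos j\<bar> \<le> C \<and> \<bar>pb x $ pos j\<bar> \<le> C \<and> \<bar>1 / pa x $ pos j\<bar> \<le> C"
    if x: "x \<in> manifold s t" "objF s \<Lambda> x \<le> c" and j: "j \<in> {1..t}" for x j
  proof -
    let ?a = "pa x $ pos j" and ?b = "pb x $ pos j" and ?l = "\<bar>Im (\<Lambda> $ p j)\<bar>"
    have a: "0 < ?a" using x j manifold_subset_U by (auto simp: U_def)
    have V: "pV x \<in> V_space s t" using x by (simp add: manifold_iff)
    note N = N_bound[OF x, folded B_def]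
    have "\<bar>N (pV x) (pa x) (pb x) $ q j $ p j\<bar> \<le> B" "\<bar>N (pV x) (pa x) (pb x) $ p j $ q j\<bar> \<le> B"
      using N entry_le_norm order_trans by blast+
    then have *: "?l / ?a\<^sup>2 \<le> B" "?l * (?a\<^sup>2 + ?b\<^sup>2) \<le> B"
      using a by (simp_all add: N_entries[OF j V] abs_mult)
    have B: "0 \<le> B" using order_trans[OF norm_ge_zero N] .
    have bound: "z \<le> B / L" if "?l * z \<le> B" "0 \<le> z" for z
    proof -
      have "L * z \<le> ?l * z" using L(2)[OF j] that by (intro mult_right_mono)
      then show ?thesis using that L(1) by (simp add: field_simps)
    qed
    \<comment> \<open>A number above 1 in absolute value is exceeded by its square, so
      \<open>max 1 (B / L)\<close> bounds it without a square root.\<close>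
    have root: "\<bar>z\<bar> \<le> C" if "z\<^sup>2 \<le> B / L" for z
    proof (rule ccontr)
      assume "\<not> \<bar>z\<bar> \<le> C"
      then have "1 < \<bar>z\<bar>" "B / L < \<bar>z\<bar>" by (auto simp: C_def)
      moreover have "\<bar>z\<bar> * 1 \<le> \<bar>z\<bar> * \<bar>z\<bar>" using \<open>1 < \<bar>z\<bar>\<close> by (intro mult_left_mono) auto
      ultimately show False using that by (simp add: power2_eq_square abs_mult[symmetric])
    qed
    have 1: "(1 / ?a)\<^sup>2 \<le> B / L" using *(1) by (intro bound) (simp_all add: power_divide)
    have 2: "?a\<^sup>2 + ?b\<^sup>2 \<le> B / L" using *(2) by (intro bound) auto
    show ?thesis using 1 2 by (intro conjI root) (auto intro: order_trans[rotated])
  qed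
  then show ?thesis by (intro exI[of _ C]) (auto simp: C_def)
qed

definition K :: "real \<Rightarrow> 'n point set" where
  "K c = {x \<in> manifold s t. objF s \<Lambda> x \<le> c}"

text \<open>The bound on \<open>1 / a\<close> keeps sublevel sets away from the boundary of the
  positive orthant. Both their closedness and the uniformity of the retraction expansion rest on
  it.\<close>

lemma K_lower: "\<exists>\<mu>>0. \<forall>x\<in>K c. \<forall>i. idx i \<le> t \<longrightarrow> \<mu> \<le> pa x $ i"
proof -
  obtain C where C: "1 \<le> C" "\<And>x j. x \<in> K c \<Longrightarrow> j \<in> {1..t} \<Longrightarrow> \<bar>1 / pa x $ pos j\<bar> \<le> C"
    using sublevel_bounds[of c] unfolding K_def by blast
  have "1 / C \<le> pa x $ i" if "x \<in> K c" "idx i \<le> t" for x i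
  proof -
    have "idx i \<in> {1..t}" using that idx_range(1)[of i] by simp
    moreover have "0 < pa x $ i" using that by (auto simp: K_def manifold_iff Rpos_def)
    ultimately show ?thesis using C(2)[OF that(1), of "idx i"] C(1) by (simp add: field_simps)
  qed
  then show ?thesis using C(1) by (intro exI[of _ "1 / C"]) auto
qed

lemma bounded_K: "bounded (K c)"
proof -
  obtain C where C: "1 \<le> C" "\<And>x j. x \<in> K c \<Longrightarrow> j \<in> {1..t} \<Longrightarrow>
      \<bar>pa x $ pos j\<bar> \<le> C \<and> \<bar>pb x $ pos j\<bar> \<le> C \<and> \<bar>1 / pa x $ pos j\<bar> \<le> C"
    using sublevel_bounds[of c] unfolding K_def by blast
  define n where "n = real CARD('n)"
  define B where "B = n * n + sqrt (2 * c)"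
  have "norm x \<le> n + n + ((n * (n * C)) * B * (n * (n * C)) + norm D) + n * C + n * C" if x: "x \<in> K c" for x
  proof -
    have M: "x \<in> manifold s t" using x by (simp add: K_def)
    have T: "norm (T (pa x) (pb x)) \<le> n * (n * C)" "norm (T (inv_vec (pa x)) (- pb x)) \<le> n * (n * C)"
      unfolding n_def by (intro T_norm_le; use C(1) C(2)[OF x] in simp)+
    have N: "norm (N (pV x) (pa x) (pb x)) \<le> B"
      unfolding B_def n_def using x by (intro N_bound) (auto simp: K_def)
    have "0 \<le> B" "0 \<le> n * (n * C)"
      using order_trans[OF norm_ge_zero N] C(1) by (simp_all add: n_def)
    then have "norm (D + pV x) \<le> (n * (n * C)) * B * (n * (n * C))"
      unfolding D_plus_V_eq[OF M] using T N
      by (intro order_trans[OF norm_matrix_mult_le] mult_mono) simp_all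
    then have "norm (pV x) \<le> (n * (n * C)) * B * (n * (n * C)) + norm D"
      using norm_triangle_ineq4[of "D + pV x" D] by simp
    moreover have "norm (pa x) \<le> n * C" "norm (pb x) \<le> n * C"
      unfolding n_def using C(2)[OF x] M C(1) by (auto intro!: Rvec_norm_le simp: manifold_iff Rpos_def)
    moreover have "norm (pS x) \<le> n" "norm (pQ x) \<le> n"
      unfolding n_def using M norm_OB_le norm_Orth_le by (auto simp: manifold_iff)
    ultimately show ?thesis using norm_point_le[of x] by linarith
  qed
  then show ?thesis unfolding bounded_iff by blast
qed

text \<open>The manifold is defined with strict inequalities \<open>0 < a\<close>. On the sublevel
  set they may be replaced by \<open>\<mu> \<le> a\<close>, which gives a closed set
  \<open>M\<close>.\<close>

lemma compact_K: "compact (K c)"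
proof -
  obtain \<mu> where \<mu>: "0 < \<mu>" "\<And>x i. x \<in> K c \<Longrightarrow> idx i \<le> t \<Longrightarrow> \<mu> \<le> pa x $ i" using K_lower by blast
  define M where "M = {x :: 'n point. (\<forall>i. norm (pS x $ i) = 1) \<and>
    (\<forall>i j. (\<Sum>k\<in>UNIV. pQ x $ k $ i * pQ x $ k $ j) = (if i = j then 1 else 0)) \<and>
    (\<forall>i j. \<not> (i < j \<and> (\<forall>k\<in>{1..t}. \<not> (i = p k \<and> j = q k))) \<longrightarrow> pV x $ i $ j = 0) \<and>
    (\<forall>i. t < idx i \<longrightarrow> pa x $ i = 0) \<and> (\<forall>i. idx i \<le> t \<longrightarrow> \<mu> \<le> pa x $ i) \<and>
    (\<forall>i. t < idx i \<longrightarrow> pb x $ i = 0)}"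
  have "closed M" unfolding M_def
    by (intro closed_Collect_conj closed_Collect_all closed_Collect_imp open_Collect_const
        closed_Collect_eq closed_Collect_le continuous_intros)
  have Orth_eq: "Orth = {Q :: 'n rmat. \<forall>i j. (\<Sum>k\<in>UNIV. Q $ k $ i * Q $ k $ j) = (if i = j then 1 else 0)}"
    by (simp add: Orth_def orthogonal_matrix vec_eq_iff gram_entry mat_def)
  have M: "M = {x \<in> manifold s t. \<forall>i. idx i \<le> t \<longrightarrow> \<mu> \<le> pa x $ i}"
    unfolding M_def manifold_iff OB_def Orth_eq Rpos_def Rvec_def V_space_iff using \<mu>(1)
    by (auto intro: less_le_trans simp del: not_less split del: if_split)
  then have "M \<subseteq> U" using manifold_subset_U by auto
  then have "continuous_on M (objF s \<Lambda>)"
    using C1_on_continuous[OF objF_C1] continuous_on_subset by blast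
  then have "closed (M \<inter> objF s \<Lambda> -` {..c})"
    using continuous_closed_preimage[OF _ \<open>closed M\<close>] by blast
  moreover have "K c = M \<inter> objF s \<Lambda> -` {..c}"
    using \<mu>(2) by (auto simp: M K_def)
  ultimately show ?thesis using bounded_K compact_eq_bounded_closed by metis
qed

end

section \<open>First order behaviour of the retraction\<close>

lemma continuous_on_matrix_mult [continuous_intros]:
  fixes f :: "'a::topological_space \<Rightarrow> real^'k^'m" and g :: "'a \<Rightarrow> real^'n^'k"
  shows "continuous_on W f \<Longrightarrow> continuous_on W g \<Longrightarrow> continuous_on W (\<lambda>x. f x ** g x)"
  unfolding matrix_matrix_mult_def by (intro continuous_intros)

lemma continuous_on_transpose [continuous_intros]:
  fixes f :: "'a::topological_space \<Rightarrow> real^'k^'m"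
  shows "continuous_on W f \<Longrightarrow> continuous_on W (\<lambda>x. transpose (f x))"
  unfolding transpose_def by (intro continuous_intros)

lemma norm_le_componentwise_scaled:
  fixes x y :: "'a::real_normed_vector^'n"
  assumes "\<And>i. norm (x $ i) \<le> e * norm (y $ i)" "0 \<le> e"
  shows "norm x \<le> e * norm y"
proof -
  have "norm x \<le> norm (e *\<^sub>R y)"
    by (rule norm_le_componentwise_cart) (use assms in simp)
  then show ?thesis using assms(2) by simp
qed

lemma retr_OB_in:
  assumes "rS \<in> {retr_OB_normalize, retr_OB_exp}" "S \<in> OB" "\<And>i. S $ i \<bullet> \<Xi> $ i = 0"
  shows "rS S \<Xi> \<in> OB"
proof -
  have u: "norm (S $ i) = 1" for i using assms(2) by (simp add: OB_def)
  show ?thesis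
    using assms(1) norm_normalize(1)[OF u assms(3)] norm_sphere_exp[OF u assms(3)]
    by (auto simp: OB_def retr_OB_normalize_def retr_OB_exp_def simp del: norm_scaleR)
qed

text \<open>Proved row by row. For the normalization the error of a row is at most the square of its
  length, hence the bound \<open>\<epsilon>\<close> on the length.\<close>

lemma retr_OB_near:
  assumes "rS \<in> {retr_OB_normalize, retr_OB_exp}" "0 < \<epsilon>"
  shows "\<exists>\<eta>>0. \<forall>S \<Xi> :: ('n::finite) rmat. S \<in> OB \<longrightarrow> (\<forall>i. S $ i \<bullet> \<Xi> $ i = 0) \<longrightarrow> norm \<Xi> < \<eta> \<longrightarrow>
    norm (rS S \<Xi> - S - \<Xi>) \<le> \<epsilon> * norm \<Xi>"
proof -
  obtain \<mu> where \<mu>: "0 < \<mu>" "\<And>u v :: 'n rvec. norm u = 1 \<Longrightarrow> norm v < \<mu> \<Longrightarrow>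
      norm (cos (norm v) *\<^sub>R u + (sin (norm v) / norm v) *\<^sub>R v - u - v) \<le> \<epsilon> * norm v"
    using sphere_exp_near[OF assms(2)] by blast
  have "norm (rS S \<Xi> - S - \<Xi>) \<le> \<epsilon> * norm \<Xi>"
    if S: "S \<in> OB" "\<And>i. S $ i \<bullet> \<Xi> $ i = 0" and small: "norm \<Xi> < min \<mu> \<epsilon>" for S \<Xi> :: "'n rmat"
  proof (rule norm_le_componentwise_scaled)
    fix i
    have u: "norm (S $ i) = 1" using S by (simp add: OB_def)
    have v: "norm (\<Xi> $ i) < min \<mu> \<epsilon>"
      using small Finite_Cartesian_Product.norm_nth_le[of \<Xi> i] by linarith
    show "norm ((rS S \<Xi> - S - \<Xi>) $ i) \<le> \<epsilon> * norm (\<Xi> $ i)"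
    proof (cases "rS = retr_OB_normalize")
      case True
      have "norm (\<Xi> $ i) * norm (\<Xi> $ i) \<le> \<epsilon> * norm (\<Xi> $ i)"
        using v by (intro mult_right_mono) auto
      then show ?thesis using norm_normalize(2)[OF u S(2)]
        by (simp add: True retr_OB_normalize_def)
    next
      case False
      then have "rS = retr_OB_exp" using assms(1) by simp
      then show ?thesis using \<mu>(2)[OF u] v by (simp add: retr_OB_exp_def)
    qed
  qed (use assms(2) in simp)
  then show ?thesis using \<mu>(1) assms(2) by (intro exI[of _ "min \<mu> \<epsilon>"]) auto
qed

lemma retr_Orth_exp_mult:
  "orthogonal_matrix Q \<Longrightarrow> retr_Orth_exp Q (Q ** \<Omega>) = Q ** mat_exp \<Omega>"
  by (simp add: retr_Orth_exp_def matrix_mul_assoc orthogonal_matrix)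

lemma retr_Orth_in:
  assumes "rQ \<in> {retr_Orth_qr, retr_Orth_exp}" "orthogonal_matrix Q" "transpose \<Omega> = - \<Omega>"
  shows "orthogonal_matrix (rQ Q (Q ** \<Omega>))"
proof (cases "rQ = retr_Orth_qr")
  case True
  then show ?thesis unfolding True retr_Orth_qr_def using qf_add_skew[OF assms(2,3)] by blast
next
  case False
  then have "rQ = retr_Orth_exp" using assms(1) by simp
  then show ?thesis
    using orthogonal_matrix_mul[OF assms(2) mat_exp_orthogonal[OF assms(3)]]
    by (simp add: retr_Orth_exp_mult assms(2))
qed

lemma retr_Orth_near:
  assumes "rQ \<in> {retr_Orth_qr, retr_Orth_exp}" "0 < \<epsilon>"
  shows "\<exists>\<eta>>0. \<forall>Q \<Omega> :: ('n::{finite,linorder}) rmat. orthogonal_matrix Q \<longrightarrow> transpose \<Omega> = - \<Omega> \<longrightarrow>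
    norm \<Omega> < \<eta> \<longrightarrow> norm (rQ Q (Q ** \<Omega>) - Q - Q ** \<Omega>) \<le> \<epsilon> * norm \<Omega>"
proof (cases "rQ = retr_Orth_qr")
  case True
  then show ?thesis using qf_near[OF assms(2)] by (simp add: retr_Orth_qr_def)
next
  case False
  then have rQ: "rQ = retr_Orth_exp" using assms(1) by simp
  define c where "c = exp 1 * norm (mat 1 :: 'n rmat) + 1"
  have c: "0 < c" unfolding c_def by (intro add_nonneg_pos) auto
  have "norm (rQ Q (Q ** \<Omega>) - Q - Q ** \<Omega>) \<le> \<epsilon> * norm \<Omega>"
    if Q: "orthogonal_matrix Q" and \<Omega>: "norm \<Omega> < min 1 (\<epsilon> / c)" for Q \<Omega> :: "'n rmat"
  proof -
    have "rQ Q (Q ** \<Omega>) - Q - Q ** \<Omega> = Q ** (mat_exp \<Omega> - mat 1 - \<Omega>)"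
      using Q by (simp add: rQ retr_Orth_exp_mult matrix_diff_ldistrib)
    then have "norm (rQ Q (Q ** \<Omega>) - Q - Q ** \<Omega>) = norm (mat_exp \<Omega> - mat 1 - \<Omega>)"
      using norm_orthogonal_mult(1)[OF Q] by simp
    also have "\<dots> \<le> (norm \<Omega>)\<^sup>2 * (exp 1 * norm (mat 1 :: 'n rmat))"
      using \<Omega> by (intro mat_exp_near) simp
    also have "\<dots> \<le> (norm \<Omega>)\<^sup>2 * c" by (intro mult_left_mono) (auto simp: c_def)
    also have "\<dots> = (norm \<Omega> * c) * norm \<Omega>" by (simp add: power2_eq_square)
    also have "\<dots> \<le> \<epsilon> * norm \<Omega>"
      using \<Omega> c by (intro mult_right_mono) (auto simp: field_simps)
    finally show ?thesis .
  qed
  then show ?thesis using c assms(2) by (intro exI[of _ "min 1 (\<epsilon> / c)"]) auto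
qed

text \<open>With \<open>u = \<xi> $ i / a $ i\<close> the error is
  \<open>a $ i * (exp u - 1 - u)\<close>, at most \<open>a $ i * \<epsilon> * \<bar>u\<bar>\<close>,
  in which \<open>a $ i\<close> cancels. The lower bound \<open>\<mu>\<close> makes \<open>u\<close>
  small uniformly; padding entries are 0.\<close>

lemma retr_pos_near:
  assumes "0 < \<mu>" "0 < \<epsilon>"
  shows "\<exists>\<eta>>0. \<forall>a \<xi> :: ('n::{finite,linorder}) rvec. a \<in> Rvec t \<longrightarrow> (\<forall>i. idx i \<le> t \<longrightarrow> \<mu> \<le> a $ i) \<longrightarrow>
    \<xi> \<in> Rvec t \<longrightarrow> norm \<xi> < \<eta> \<longrightarrow> norm ((\<chi> i. a $ i * exp (\<xi> $ i / a $ i)) - a - \<xi>) \<le> \<epsilon> * norm \<xi>"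
proof -
  have "(exp has_real_derivative 1) (at 0)" by (auto intro!: derivative_eq_intros)
  from derivative_zero_bound[OF this assms(2)]
  obtain \<eta> where \<eta>: "0 < \<eta>" "\<And>u. \<bar>u\<bar> < \<eta> \<Longrightarrow> \<bar>exp u - 1 - u\<bar> \<le> \<epsilon> * \<bar>u\<bar>" by auto
  have "norm ((\<chi> i. a $ i * exp (\<xi> $ i / a $ i)) - a - \<xi>) \<le> \<epsilon> * norm \<xi>"
    if a: "a \<in> Rvec t" "\<And>i. idx i \<le> t \<Longrightarrow> \<mu> \<le> a $ i" and \<xi>: "\<xi> \<in> Rvec t" "norm \<xi> < \<eta> * \<mu>"
    for a \<xi> :: "'n rvec"
  proof (rule norm_le_componentwise_scaled)
    fix i
    show "norm (((\<chi> i. a $ i * exp (\<xi> $ i / a $ i)) - a - \<xi>) $ i) \<le> \<epsilon> * norm (\<xi> $ i)"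
    proof (cases "idx i \<le> t")
      case True
      then have ai: "\<mu> \<le> a $ i" "0 < a $ i" using a(2) assms(1) by force+
      have "\<bar>\<xi> $ i\<bar> < \<eta> * \<mu>" using \<xi>(2) component_le_norm_cart[of \<xi> i] by linarith
      also have "\<dots> \<le> \<eta> * a $ i" using ai \<eta> by simp
      finally have "\<bar>\<xi> $ i / a $ i\<bar> < \<eta>" using ai by (simp add: field_simps)
      from mult_left_mono[OF \<eta>(2)[OF this], of "a $ i"]
      have "a $ i * \<bar>exp (\<xi> $ i / a $ i) - 1 - \<xi> $ i / a $ i\<bar> \<le> \<epsilon> * \<bar>\<xi> $ i\<bar>"
        using ai by simp
      also have "a $ i * \<bar>exp (\<xi> $ i / a $ i) - 1 - \<xi> $ i / a $ i\<bar>
          = \<bar>a $ i * (exp (\<xi> $ i / a $ i) - 1 - \<xi> $ i / a $ i)\<bar>"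
        using ai by (simp add: abs_mult)
      also have "a $ i * (exp (\<xi> $ i / a $ i) - 1 - \<xi> $ i / a $ i)
          = a $ i * exp (\<xi> $ i / a $ i) - a $ i - \<xi> $ i"
        using ai by (simp add: right_diff_distrib)
      finally show ?thesis by simp
    next
      case False
      then show ?thesis using a \<xi> by (simp add: Rvec_def)
    qed
  qed (use assms(2) in simp)
  then show ?thesis using \<eta>(1) assms(1) by (intro exI[of _ "\<eta> * \<mu>"]) auto
qed

locale spectrum_retraction = spectrum s t \<Lambda>
  for s t and \<Lambda> :: "('n::{finite,linorder}) cvec" +
  fixes R :: "'n point \<Rightarrow> 'n point \<Rightarrow> 'n point"
  assumes R: "is_retraction_choice R"
begin

lemma R_components:
  obtains rS rQ where "rS \<in> {retr_OB_normalize, retr_OB_exp}" "rQ \<in> {retr_Orth_qr, retr_Orth_exp}"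
    "R = (\<lambda>x \<xi>. (rS (pS x) (pS \<xi>), rQ (pQ x) (pQ \<xi>), pV x + pV \<xi>,
      (\<chi> i. pa x $ i * exp (pa \<xi> $ i / pa x $ i)), pb x + pb \<xi>))"
  using R unfolding is_retraction_choice_def retraction_map_def case_prod_unfold by auto

lemma R_in:
  assumes x: "x \<in> manifold s t" and \<xi>: "\<xi> \<in> tangent s t x"
  shows "R x \<xi> \<in> manifold s t"
proof -
  obtain rS rQ where r: "rS \<in> {retr_OB_normalize, retr_OB_exp}" "rQ \<in> {retr_Orth_qr, retr_Orth_exp}"
    "R = (\<lambda>x \<xi>. (rS (pS x) (pS \<xi>), rQ (pQ x) (pQ \<xi>), pV x + pV \<xi>,
      (\<chi> i. pa x $ i * exp (pa \<xi> $ i / pa x $ i)), pb x + pb \<xi>))" by (rule R_components)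
  obtain \<Omega> where \<Omega>: "pQ \<xi> = pQ x ** \<Omega>" "transpose \<Omega> = - \<Omega>" using \<xi> by (auto simp: tangent_iff)
  have "rS (pS x) (pS \<xi>) \<in> OB"
    by (rule retr_OB_in[OF r(1)]) (use x \<xi> in \<open>auto simp: manifold_iff tangent_iff\<close>)
  moreover have "rQ (pQ x) (pQ \<xi>) \<in> Orth"
    using retr_Orth_in[OF r(2) _ \<Omega>(2)] x by (simp add: Orth_def \<Omega>(1) manifold_iff)
  moreover have "pV x + pV \<xi> \<in> V_space s t" "pb x + pb \<xi> \<in> Rvec t"
    using x \<xi> subspace_add[OF subspace_V] subspace_add[OF subspace_Rvec]
    by (auto simp: manifold_iff tangent_iff)
  moreover have "(\<chi> i. pa x $ i * exp (pa \<xi> $ i / pa x $ i)) \<in> Rpos t"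
    using x by (auto simp: manifold_iff Rpos_def Rvec_def)
  ultimately show ?thesis by (simp add: manifold_iff r(3))
qed

lemma R_near:
  assumes "0 < \<mu>" "0 < \<epsilon>"
  shows "\<exists>\<eta>>0. \<forall>x\<in>manifold s t. (\<forall>i. idx i \<le> t \<longrightarrow> \<mu> \<le> pa x $ i) \<longrightarrow> (\<forall>\<xi>\<in>tangent s t x.
    norm \<xi> < \<eta> \<longrightarrow> norm (R x \<xi> - x - \<xi>) \<le> \<epsilon> * norm \<xi>)"
proof -
  obtain rS rQ where r: "rS \<in> {retr_OB_normalize, retr_OB_exp}" "rQ \<in> {retr_Orth_qr, retr_Orth_exp}"
    "R = (\<lambda>x \<xi>. (rS (pS x) (pS \<xi>), rQ (pQ x) (pQ \<xi>), pV x + pV \<xi>,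
      (\<chi> i. pa x $ i * exp (pa \<xi> $ i / pa x $ i)), pb x + pb \<xi>))" by (rule R_components)
  \<comment> \<open>Three of the five components contribute an error; on \<open>V\<close> and
    \<open>b\<close> the retraction is addition.\<close>
  have e3: "0 < \<epsilon> / 3" using assms by simp
  obtain \<eta>1 where \<eta>1: "0 < \<eta>1" "\<And>S \<Xi>. S \<in> OB \<Longrightarrow> (\<forall>i. S $ i \<bullet> \<Xi> $ i = 0) \<Longrightarrow> norm \<Xi> < \<eta>1 \<Longrightarrow>
    norm (rS S \<Xi> - S - \<Xi>) \<le> \<epsilon> / 3 * norm \<Xi>" using retr_OB_near[OF r(1) e3] by blast
  obtain \<eta>2 where \<eta>2: "0 < \<eta>2" "\<And>Q \<Omega>. orthogonal_matrix Q \<Longrightarrow> transpose \<Omega> = - \<Omega> \<Longrightarrow> norm \<Omega> < \<eta>2 \<Longrightarrow>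
    norm (rQ Q (Q ** \<Omega>) - Q - Q ** \<Omega>) \<le> \<epsilon> / 3 * norm \<Omega>" using retr_Orth_near[OF r(2) e3] by blast
  obtain \<eta>3 where \<eta>3: "0 < \<eta>3" "\<And>(a :: 'n rvec) \<xi>. a \<in> Rvec t \<Longrightarrow> (\<forall>i. idx i \<le> t \<longrightarrow> \<mu> \<le> a $ i) \<Longrightarrow>
    \<xi> \<in> Rvec t \<Longrightarrow> norm \<xi> < \<eta>3 \<Longrightarrow> norm ((\<chi> i. a $ i * exp (\<xi> $ i / a $ i)) - a - \<xi>) \<le> \<epsilon> / 3 * norm \<xi>"
    using retr_pos_near[OF assms(1) e3] by blast
  have "norm (R x \<xi> - x - \<xi>) \<le> \<epsilon> * norm \<xi>"
    if x: "x \<in> manifold s t" "\<forall>i. idx i \<le> t \<longrightarrow> \<mu> \<le> pa x $ i" and \<xi>: "\<xi> \<in> tangent s t x"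
      and small: "norm \<xi> < min \<eta>1 (min \<eta>2 \<eta>3)" for x \<xi>
  proof -
    let ?E = "R x \<xi> - x - \<xi>"
    note comp = norm_point_components[of \<xi>]
    obtain \<Omega> where \<Omega>: "pQ \<xi> = pQ x ** \<Omega>" "transpose \<Omega> = - \<Omega>" using \<xi> by (auto simp: tangent_iff)
    have Q: "orthogonal_matrix (pQ x)" using x by (simp add: manifold_iff Orth_def)
    have n\<Omega>: "norm \<Omega> = norm (pQ \<xi>)" by (simp add: \<Omega>(1) norm_orthogonal_mult(1)[OF Q])
    have mono: "\<epsilon> / 3 * u \<le> \<epsilon> / 3 * norm \<xi>" if "u \<le> norm \<xi>" for u
      using that e3 by (intro mult_left_mono) auto
    have "norm (pS ?E) \<le> \<epsilon> / 3 * norm (pS \<xi>)"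
      using \<eta>1(2)[of "pS x" "pS \<xi>"] x \<xi> small comp(1) by (simp add: r(3) manifold_iff tangent_iff)
    moreover have "norm (pQ ?E) \<le> \<epsilon> / 3 * norm (pQ \<xi>)"
      using \<eta>2(2)[OF Q \<Omega>(2)] small comp(2) by (simp add: r(3) n\<Omega> \<Omega>(1)[symmetric])
    moreover have "norm (pa ?E) \<le> \<epsilon> / 3 * norm (pa \<xi>)"
      using \<eta>3(2)[of "pa x" "pa \<xi>"] x \<xi> small comp(4)
      by (simp add: r(3) manifold_iff tangent_iff Rpos_def)
    moreover have "pV ?E = 0" "pb ?E = 0" by (simp_all add: r(3))
    ultimately have "norm ?E \<le> \<epsilon> / 3 * norm (pS \<xi>) + \<epsilon> / 3 * norm (pQ \<xi>) + \<epsilon> / 3 * norm (pa \<xi>)"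
      using norm_point_le[of ?E] by simp
    also have "\<dots> \<le> \<epsilon> / 3 * norm \<xi> + \<epsilon> / 3 * norm \<xi> + \<epsilon> / 3 * norm \<xi>"
      by (intro add_mono mono comp)
    finally show ?thesis by simp
  qed
  then show ?thesis using \<eta>1(1) \<eta>2(1) \<eta>3(1) by (intro exI[of _ "min \<eta>1 (min \<eta>2 \<eta>3)"]) auto
qed

end

section \<open>Riemannian gradient, transport and the assumptions of the abstract theorem\<close>

lemma inner_le_bound: "norm u \<le> a \<Longrightarrow> norm v \<le> b \<Longrightarrow> \<bar>u \<bullet> v\<bar> \<le> a * b"
  by (rule order_trans[OF Cauchy_Schwarz_ineq2]) (meson mult_mono norm_ge_zero order_trans)

context spectrum_retraction
begin

text \<open>A derivative within the manifold is not unique as a linear map. The curve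
  \<open>R x (h *\<^sub>R \<xi>)\<close> stays in the manifold and has velocity \<open>\<xi>\<close>
  at 0, so by the chain rule any such derivative takes at \<open>\<xi>\<close> the derivative of
  \<open>f\<close> along this curve.\<close>

lemma derivative_on_tangent_unique:
  fixes f :: "'n point \<Rightarrow> real"
  assumes x: "x \<in> manifold s t" and \<xi>: "\<xi> \<in> tangent s t x"
    and f: "(f has_derivative f') (at x within manifold s t)" "(f has_derivative f'') (at x within manifold s t)"
  shows "f' \<xi> = f'' \<xi>"
proof -
  let ?\<gamma> = "\<lambda>h :: real. R x (h *\<^sub>R \<xi>)"
  \<comment> \<open>The sublevel set of its own value supplies the lower bound on the entries of
    \<open>pa x\<close>.\<close>
  have "x \<in> K (objF s \<Lambda> x)" using x by (simp add: K_def)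
  then obtain \<mu> where \<mu>: "0 < \<mu>" "\<forall>i. idx i \<le> t \<longrightarrow> \<mu> \<le> pa x $ i" using K_lower by blast
  have scale: "h *\<^sub>R \<xi> \<in> tangent s t x" for h using subspace_tangent \<xi> subspace_scale by blast
  have near: "\<exists>\<eta>>0. \<forall>\<zeta>\<in>tangent s t x. norm \<zeta> < \<eta> \<longrightarrow> norm (R x \<zeta> - x - \<zeta>) \<le> \<epsilon> * norm \<zeta>" if "0 < \<epsilon>" for \<epsilon>
    using R_near[OF \<mu>(1) that] x \<mu>(2) by blast
  \<comment> \<open>Read off from the expansion at the zero vector, whose error bound is 0, without
    looking at the individual retractions.\<close>
  have \<gamma>0: "?\<gamma> 0 = x" 
  proof -
    obtain \<eta> where "0 < \<eta>" "\<And>\<zeta>. \<zeta> \<in> tangent s t x \<Longrightarrow> norm \<zeta> < \<eta> \<Longrightarrow> norm (R x \<zeta> - x - \<zeta>) \<le> 1 * norm \<zeta>"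
      using near[of 1] by auto
    from this(2)[OF subspace_0[OF subspace_tangent]] this(1) show ?thesis by simp
  qed
  have \<gamma>: "(?\<gamma> has_derivative (\<lambda>h. h *\<^sub>R \<xi>)) (at 0)"
    unfolding has_derivative_at_alt
  proof (intro conjI allI impI)
    fix e :: real assume e: "0 < e"
    define n where "n = norm \<xi> + 1"
    have n: "0 < n" "norm \<xi> \<le> n" by (auto simp: n_def add_nonneg_pos)
    obtain \<eta> where \<eta>: "0 < \<eta>" "\<And>\<zeta>. \<zeta> \<in> tangent s t x \<Longrightarrow> norm \<zeta> < \<eta> \<Longrightarrow> norm (R x \<zeta> - x - \<zeta>) \<le> e / n * norm \<zeta>"
      using near[of "e / n"] e n by auto
    show "\<exists>d>0. \<forall>h. norm (h - 0) < d \<longrightarrow> norm (?\<gamma> h - ?\<gamma> 0 - (h - 0) *\<^sub>R \<xi>) \<le> e * norm (h - 0)"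
    proof (intro exI[of _ "\<eta> / n"] conjI allI impI)
      fix h :: real assume h: "norm (h - 0) < \<eta> / n"
      have le: "norm (h *\<^sub>R \<xi>) \<le> \<bar>h\<bar> * n" using n by (simp add: mult_left_mono)
      also have "\<dots> < \<eta>" using h n by (simp add: field_simps)
      finally have "norm (R x (h *\<^sub>R \<xi>) - x - h *\<^sub>R \<xi>) \<le> e / n * norm (h *\<^sub>R \<xi>)" by (rule \<eta>(2)[OF scale])
      also have "\<dots> \<le> e / n * (\<bar>h\<bar> * n)" using le e n by (intro mult_left_mono) auto
      finally show "norm (?\<gamma> h - ?\<gamma> 0 - (h - 0) *\<^sub>R \<xi>) \<le> e * norm (h - 0)"
        using n unfolding \<gamma>0 by simp
    qed (use \<eta> n in simp)
  qed (rule bounded_linear_scaleR_left)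
  have chain: "((\<lambda>h. f (?\<gamma> h)) has_derivative (\<lambda>h. f' (h *\<^sub>R \<xi>))) (at 0)"
    if "(f has_derivative f') (at x within manifold s t)" for f'
  proof (rule has_derivative_in_compose[OF \<gamma>])
    have "range ?\<gamma> \<subseteq> manifold s t" using R_in[OF x scale] by blast
    from has_derivative_subset[OF that this]
    show "(f has_derivative f') (at (?\<gamma> 0) within range ?\<gamma>)" unfolding \<gamma>0 .
  qed
  from fun_cong[OF has_derivative_unique[OF chain[OF f(1)] chain[OF f(2)]], of 1]
  show ?thesis by simp
qed

text \<open>A choice of the Euclidean gradient. On the open set \<open>U\<close> the derivative
  determines its values.\<close>

definition egrad :: "'n point \<Rightarrow> 'n point" where
  "egrad = (SOME G. continuous_on U G \<and>
     (\<forall>x\<in>U. (objF s \<Lambda> has_derivative (\<lambda>h. G x \<bullet> h)) (at x)))"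

lemma egrad: "continuous_on U egrad" "x \<in> U \<Longrightarrow> (objF s \<Lambda> has_derivative (\<lambda>h. egrad x \<bullet> h)) (at x)"
  using someI_ex[OF objF_C1[unfolded C1_on_def]] unfolding egrad_def[symmetric] by auto

lemma riem_metric_pos:
  fixes x \<xi> :: "'n point"
  assumes "x \<in> manifold s t" "\<xi> \<in> tangent s t x" "riem_metric t x \<xi> \<xi> = 0"
  shows "\<xi> = 0"
proof -
  have nn: "0 \<le> (\<Sum>i | idx i \<le> t. pa \<xi> $ i * pa \<xi> $ i / (pa x $ i)\<^sup>2)"
    by (intro sum_nonneg) simp
  have sum0: "pS \<xi> \<bullet> pS \<xi> + pQ \<xi> \<bullet> pQ \<xi> + pV \<xi> \<bullet> pV \<xi>
      + (\<Sum>i | idx i \<le> t. pa \<xi> $ i * pa \<xi> $ i / (pa x $ i)\<^sup>2) + pb \<xi> \<bullet> pb \<xi> = 0"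
    using assms(3) unfolding riem_metric_eq .
  note nn = nn inner_ge_zero[of "pS \<xi>"] inner_ge_zero[of "pQ \<xi>"] inner_ge_zero[of "pV \<xi>"]
      inner_ge_zero[of "pb \<xi>"]
  have "pS \<xi> \<bullet> pS \<xi> = 0" "pQ \<xi> \<bullet> pQ \<xi> = 0" "pV \<xi> \<bullet> pV \<xi> = 0" "pb \<xi> \<bullet> pb \<xi> = 0"
    and sum_a: "(\<Sum>i | idx i \<le> t. pa \<xi> $ i * pa \<xi> $ i / (pa x $ i)\<^sup>2) = 0"
    using sum0 nn by linarith+
  then have 0: "pS \<xi> = 0" "pQ \<xi> = 0" "pV \<xi> = 0" "pb \<xi> = 0" by simp_all
  have "pa \<xi> $ i = 0" for i
  proof (cases "idx i \<le> t")
    case True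
    moreover have "pa x $ i \<noteq> 0" using True assms(1) by (force simp: manifold_iff Rpos_def)
    ultimately show ?thesis using sum_a by (subst (asm) sum_nonneg_eq_0_iff) auto
  qed (use assms(2) in \<open>simp add: tangent_iff Rvec_def\<close>)
  then have "pa \<xi> = 0" by (simp add: vec_eq_iff)
  with 0 show ?thesis by (simp add: prod_eq_iff)
qed

text \<open>Identifies the description behind \<open>rgrad\<close>. If \<open>g\<close> is another
  candidate, the squared length of its difference to \<open>riem_of x (egrad x)\<close> is the
  difference of two derivatives at a tangent vector, hence 0.\<close>

lemma rgrad_eq:
  assumes x: "x \<in> manifold s t"
  shows "rgrad s t (objF s \<Lambda>) x = riem_of x (egrad x)"
  unfolding rgrad_def
proof (rule the_equality)
  have der: "(objF s \<Lambda> has_derivative (\<lambda>h. egrad x \<bullet> h)) (at x within manifold s t)"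
    using x manifold_subset_U by (intro has_derivative_at_withinI[OF egrad(2)]) auto
  show "riem_of x (egrad x) \<in> tangent s t x \<and> (\<exists>D. (objF s \<Lambda> has_derivative D) (at x within manifold s t) \<and>
      (\<forall>\<xi>\<in>tangent s t x. riem_metric t x (riem_of x (egrad x)) \<xi> = D \<xi>))"
    using der riem_of_in[OF x] riem_of_inner[OF x] by blast
  fix g
  assume "g \<in> tangent s t x \<and> (\<exists>D. (objF s \<Lambda> has_derivative D) (at x within manifold s t) \<and>
      (\<forall>\<xi>\<in>tangent s t x. riem_metric t x g \<xi> = D \<xi>))"
  then obtain D where g: "g \<in> tangent s t x" "(objF s \<Lambda> has_derivative D) (at x within manifold s t)"
    "\<And>\<xi>. \<xi> \<in> tangent s t x \<Longrightarrow> riem_metric t x g \<xi> = D \<xi>" by blast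
  let ?d = "g - riem_of x (egrad x)"
  have d: "?d \<in> tangent s t x" using g(1) riem_of_in[OF x] subspace_diff[OF subspace_tangent] by blast
  have "riem_metric t x ?d ?d = riem_metric t x g ?d - riem_metric t x (riem_of x (egrad x)) ?d"
    by (rule bilinear_lsub[OF riem_metric_bilinear])
  also have "\<dots> = 0"
    using g(3)[OF d] riem_of_inner[OF x d] derivative_on_tangent_unique[OF x d g(2) der] by simp
  finally show "g = riem_of x (egrad x)" using riem_metric_pos[OF x d] by simp
qed

definition tproj :: "'n point \<Rightarrow> 'n point \<Rightarrow> 'n point" where
  "tproj x \<xi> = (proj_OB (pS x) (pS \<xi>), proj_Orth (pQ x) (pQ \<xi>), pV \<xi>, pa \<xi>, pb \<xi>)"

lemma transport_eq: "transport R x \<theta> \<xi> = tproj (R x \<theta>) \<xi>"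
  by (simp add: transport_def tproj_def case_prod_unfold)

lemma tproj_in:
  assumes "x \<in> manifold s t" "\<xi> \<in> tangent s t y"
  shows "tproj x \<xi> \<in> tangent s t x"
  using assms proj_Orth_in[of "pQ x" "pQ \<xi>"]
  by (auto simp: tangent_iff tproj_def proj_OB_nth inner_diff_right manifold_iff OB_def dot_square_norm)

lemma tproj_id:
  assumes "x \<in> manifold s t" "\<xi> \<in> tangent s t x"
  shows "tproj x \<xi> = \<xi>"
proof -
  obtain \<Omega> where \<Omega>: "pQ \<xi> = pQ x ** \<Omega>" "transpose \<Omega> = - \<Omega>" using assms by (auto simp: tangent_iff)
  have "proj_OB (pS x) (pS \<xi>) = pS \<xi>"
    using assms(2) by (simp add: vec_eq_iff[of "proj_OB _ _"] proj_OB_nth tangent_iff)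
  moreover have "proj_Orth (pQ x) (pQ \<xi>) = pQ \<xi>"
    unfolding \<Omega>(1) using assms(1) by (intro proj_Orth_id \<Omega>(2)) (simp add: manifold_iff Orth_def)
  ultimately show ?thesis by (simp add: tproj_def)
qed

text \<open>The constant is 2 for the sphere factor plus 1 for each of the other four
  components.\<close>

lemma tproj_bound:
  assumes "x \<in> manifold s t"
  shows "norm (tproj x \<xi>) \<le> 6 * norm \<xi>"
proof -
  have "norm (proj_OB (pS x) (pS \<xi>)) \<le> 2 * norm (pS \<xi>)"
  proof (rule norm_le_componentwise_scaled)
    fix i
    have u: "norm (pS x $ i) = 1" using assms by (simp add: manifold_iff OB_def)
    have "norm (proj_OB (pS x) (pS \<xi>) $ i) \<le> norm (pS \<xi> $ i) + \<bar>pS x $ i \<bullet> pS \<xi> $ i\<bar>"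
      unfolding proj_OB_nth using norm_triangle_ineq4[of "pS \<xi> $ i" "(pS x $ i \<bullet> pS \<xi> $ i) *\<^sub>R pS x $ i"] u
      by simp
    then show "norm (proj_OB (pS x) (pS \<xi>) $ i) \<le> 2 * norm (pS \<xi> $ i)"
      using Cauchy_Schwarz_ineq2[of "pS x $ i" "pS \<xi> $ i"] u by simp
  qed simp
  moreover have "norm (proj_Orth (pQ x) (pQ \<xi>)) \<le> norm (pQ \<xi>)"
  proof -
    have Q: "orthogonal_matrix (pQ x)" using assms by (simp add: manifold_iff Orth_def)
    have "norm (pQ x ** transpose (pQ \<xi>) ** pQ x) = norm (pQ \<xi>)"
      by (simp add: norm_orthogonal_mult[OF Q])
    then show ?thesis
      using norm_triangle_ineq4[of "pQ \<xi>" "pQ x ** transpose (pQ \<xi>) ** pQ x"]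
      by (simp add: proj_Orth_eq[OF Q])
  qed
  ultimately show ?thesis
    using norm_point_le[of "tproj x \<xi>"] norm_point_components[of \<xi>] by (simp add: tproj_def)
qed

lemma proj_OB_eq: "proj_OB S \<Xi> = (\<chi> i. \<Xi> $ i - (S $ i \<bullet> \<Xi> $ i) *\<^sub>R S $ i)"
  by (simp add: vec_eq_iff[of "proj_OB _ _"] proj_OB_nth)

lemma tproj_continuous: "continuous_on W (\<lambda>(x, \<xi>). tproj x \<xi>)"
  unfolding case_prod_unfold tproj_def proj_OB_eq proj_Orth_def by (intro continuous_intros)

lemma riem_of_continuous:
  assumes "continuous_on W G"
  shows "continuous_on W (\<lambda>x. riem_of x (G x))"
  unfolding riem_of_def proj_OB_eq proj_Orth_def proj_V_def proj_R_def
  by (intro continuous_intros assms)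

lemma rgrad_continuous: "continuous_on (K c) (rgrad s t (objF s \<Lambda>))"
proof -
  have "K c \<subseteq> manifold s t" by (auto simp: K_def)
  then have "continuous_on (K c) (\<lambda>x. riem_of x (egrad x))"
    using manifold_subset_U by (intro riem_of_continuous continuous_on_subset[OF egrad(1)]) auto
  then show ?thesis
    using rgrad_eq \<open>K c \<subseteq> manifold s t\<close> by (subst continuous_on_cong[OF refl]) auto
qed

text \<open>Only the \<open>a\<close> component is weighted; its weight is at least
  \<open>1 / A\<^sup>2\<close> because the entries of \<open>a\<close> are positive and at most
  \<open>A\<close>.\<close>

lemma riem_metric_lower:
  fixes x \<xi> :: "'n point"
  assumes x: "x \<in> manifold s t" "norm x \<le> A" and A: "0 < A" and \<xi>: "\<xi> \<in> tangent s t x"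
  shows "min 1 (1 / A\<^sup>2) * (norm \<xi>)\<^sup>2 \<le> riem_metric t x \<xi> \<xi>"
proof -
  let ?c = "min 1 (1 / A\<^sup>2)"
  have c: "0 \<le> ?c" "?c \<le> 1" by auto
  have shrink: "?c * z \<le> z" if "0 \<le> z" for z using mult_right_mono[OF c(2) that] by simp
  have "?c * (pa \<xi> $ i * pa \<xi> $ i) \<le> pa \<xi> $ i * pa \<xi> $ i / (pa x $ i)\<^sup>2" if "idx i \<le> t" for i
  proof -
    have pos: "0 < pa x $ i" using x(1) that by (simp add: manifold_iff Rpos_def)
    have "pa x $ i \<le> A"
      using component_le_norm_cart[of "pa x" i] norm_point_components(4)[of x] x(2) by linarith
    then have "(pa x $ i)\<^sup>2 \<le> A\<^sup>2" using pos by (intro power_mono) auto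
    then have "1 / A\<^sup>2 \<le> 1 / (pa x $ i)\<^sup>2" using pos A by (intro divide_left_mono) auto
    then have "?c \<le> 1 / (pa x $ i)\<^sup>2" by linarith
    from mult_right_mono[OF this, of "pa \<xi> $ i * pa \<xi> $ i"] show ?thesis by simp
  qed
  then have "?c * (pa \<xi> \<bullet> pa \<xi>) \<le> (\<Sum>i | idx i \<le> t. pa \<xi> $ i * pa \<xi> $ i / (pa x $ i)\<^sup>2)"
    using \<xi> by (subst inner_Rvec) (auto simp: tangent_iff sum_distrib_left intro!: sum_mono)
  then show ?thesis
    using shrink[OF inner_ge_zero, of "pS \<xi>"] shrink[OF inner_ge_zero, of "pQ \<xi>"]
      shrink[OF inner_ge_zero, of "pV \<xi>"] shrink[OF inner_ge_zero, of "pb \<xi>"]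
    unfolding power2_norm_eq_inner inner_point[of \<xi>] riem_metric_eq distrib_left by linarith
qed

text \<open>The 4 counts the unweighted components; the \<open>a\<close> component is a sum of at
  most n terms with weight at most \<open>1 / \<mu>\<^sup>2\<close>.\<close>

lemma riem_metric_upper:
  fixes x \<xi> \<eta> :: "'n point"
  assumes \<mu>: "0 < \<mu>" "\<And>i. idx i \<le> t \<Longrightarrow> \<mu> \<le> pa x $ i"
  shows "\<bar>riem_metric t x \<xi> \<eta>\<bar> \<le> (4 + real CARD('n) * (1 / \<mu>\<^sup>2)) * norm \<xi> * norm \<eta>"
proof -
  let ?B = "norm \<xi> * norm \<eta>"
  note c = norm_point_components
  have "\<bar>pa \<xi> $ i * pa \<eta> $ i / (pa x $ i)\<^sup>2\<bar> \<le> 1 / \<mu>\<^sup>2 * ?B" if "idx i \<le> t" for i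
  proof -
    have "\<mu>\<^sup>2 \<le> (pa x $ i)\<^sup>2" using \<mu>(1) \<mu>(2)[OF that] by (intro power_mono) auto
    moreover have "0 < pa x $ i" using \<mu>(1) \<mu>(2)[OF that] by linarith
    ultimately have 1: "1 / (pa x $ i)\<^sup>2 \<le> 1 / \<mu>\<^sup>2"
      using \<mu>(1) by (intro divide_left_mono) auto
    have 2: "\<bar>pa \<xi> $ i\<bar> * \<bar>pa \<eta> $ i\<bar> \<le> ?B"
      using component_le_norm_cart[of "pa \<xi>" i] component_le_norm_cart[of "pa \<eta>" i]
        c(4)[of \<xi>] c(4)[of \<eta>] by (intro mult_mono) auto
    have "1 / (pa x $ i)\<^sup>2 * (\<bar>pa \<xi> $ i\<bar> * \<bar>pa \<eta> $ i\<bar>) \<le> 1 / \<mu>\<^sup>2 * ?B"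
      by (rule mult_mono[OF 1 2]) auto
    then show ?thesis by (simp add: abs_mult)
  qed
  then have "\<bar>\<Sum>i | idx i \<le> t. pa \<xi> $ i * pa \<eta> $ i / (pa x $ i)\<^sup>2\<bar> \<le> (\<Sum>i | idx (i :: 'n) \<le> t. 1 / \<mu>\<^sup>2 * ?B)"
    by (intro order_trans[OF sum_abs] sum_mono) auto
  also have "\<dots> \<le> real CARD('n) * (1 / \<mu>\<^sup>2 * ?B)"
    by (simp add: card_mono divide_right_mono mult_right_mono)
  finally have "\<bar>riem_metric t x \<xi> \<eta>\<bar> \<le> ?B + ?B + ?B + real CARD('n) * (1 / \<mu>\<^sup>2 * ?B) + ?B"
    unfolding riem_metric_eq
    using inner_le_bound[OF c(1) c(1), of \<xi> \<eta>] inner_le_bound[OF c(2) c(2), of \<xi> \<eta>]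
      inner_le_bound[OF c(3) c(3), of \<xi> \<eta>] inner_le_bound[OF c(5) c(5), of \<xi> \<eta>] by linarith
  also have "\<dots> = (4 + real CARD('n) * (1 / \<mu>\<^sup>2)) * norm \<xi> * norm \<eta>" by (simp add: algebra_simps)
  finally show ?thesis .
qed

text \<open>Two errors of size \<open>\<epsilon> / 2 * norm \<xi>\<close>: the Euclidean expansion
  of the objective from \<open>x\<close> to \<open>R x \<xi>\<close>, where the displacement is at
  most \<open>2 * norm \<xi>\<close>, and the gradient applied to
  \<open>R x \<xi> - x - \<xi>\<close>.\<close>

lemma objF_first_order:
  assumes \<epsilon>: "0 < \<epsilon>"
  shows "\<exists>\<eta>>0. \<forall>x\<in>K c. \<forall>\<xi>\<in>tangent s t x. norm \<xi> < \<eta> \<longrightarrow>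
    \<bar>objF s \<Lambda> (R x \<xi>) - objF s \<Lambda> x - riem_metric t x (rgrad s t (objF s \<Lambda>) x) \<xi>\<bar> \<le> \<epsilon> * norm \<xi>"
proof -
  have KM: "K c \<subseteq> manifold s t" by (auto simp: K_def)
  then have KU: "K c \<subseteq> U" using manifold_subset_U by blast
  obtain \<mu> where \<mu>: "0 < \<mu>" "\<And>x i. x \<in> K c \<Longrightarrow> idx i \<le> t \<Longrightarrow> \<mu> \<le> pa x $ i" using K_lower by blast
  have "bounded (egrad ` K c)"
    using compact_K continuous_on_subset[OF egrad(1) KU] compact_continuous_image compact_imp_bounded by blast
  then obtain B where B: "0 < B" "\<And>x. x \<in> K c \<Longrightarrow> norm (egrad x) \<le> B" unfolding bounded_pos by auto
  have e4: "0 < \<epsilon> / 4" using \<epsilon> by simp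
  obtain \<eta>1 where \<eta>1: "0 < \<eta>1" "\<And>x z. x \<in> K c \<Longrightarrow> dist z x < \<eta>1 \<Longrightarrow>
      \<bar>objF s \<Lambda> z - objF s \<Lambda> x - egrad x \<bullet> (z - x)\<bar> \<le> \<epsilon> / 4 * norm (z - x)"
    using C1_uniform_expansion[OF open_U compact_K KU egrad e4] by blast
  \<comment> \<open>The bound 1 gives the displacement \<open>2 * norm \<xi>\<close>, the other one
    makes the gradient bound \<open>B\<close> times the retraction error at most
    \<open>\<epsilon> / 2 * norm \<xi>\<close>.\<close>
  define \<epsilon>' where "\<epsilon>' = min 1 (\<epsilon> / (2 * B))"
  have \<epsilon>': "0 < \<epsilon>'" "\<epsilon>' \<le> 1" "B * \<epsilon>' \<le> \<epsilon> / 2" using \<epsilon> B(1) by (auto simp: \<epsilon>'_def min_def field_simps)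
  obtain \<eta>2 where \<eta>2: "0 < \<eta>2" "\<And>x \<xi>. x \<in> K c \<Longrightarrow> \<xi> \<in> tangent s t x \<Longrightarrow> norm \<xi> < \<eta>2 \<Longrightarrow>
      norm (R x \<xi> - x - \<xi>) \<le> \<epsilon>' * norm \<xi>"
    using R_near[OF \<mu>(1) \<epsilon>'(1)] \<mu>(2) KM by blast
  have "\<bar>objF s \<Lambda> (R x \<xi>) - objF s \<Lambda> x - riem_metric t x (rgrad s t (objF s \<Lambda>) x) \<xi>\<bar> \<le> \<epsilon> * norm \<xi>"
    if x: "x \<in> K c" and \<xi>: "\<xi> \<in> tangent s t x" and small: "norm \<xi> < min (\<eta>1 / 2) \<eta>2" for x \<xi>
  proof -
    let ?z = "R x \<xi>"
    have err: "norm (?z - x - \<xi>) \<le> \<epsilon>' * norm \<xi>" using \<eta>2(2)[OF x \<xi>] small by simp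
    also have "\<dots> \<le> 1 * norm \<xi>" using \<epsilon>' by (intro mult_right_mono) auto
    finally have zx: "norm (?z - x) \<le> 2 * norm \<xi>"
      using norm_triangle_ineq[of "?z - x - \<xi>" \<xi>] by simp
    then have "dist ?z x < \<eta>1" using small by (simp add: dist_norm)
    then have "\<bar>objF s \<Lambda> ?z - objF s \<Lambda> x - egrad x \<bullet> (?z - x)\<bar> \<le> \<epsilon> / 4 * norm (?z - x)"
      by (rule \<eta>1(2)[OF x])
    also have "\<dots> \<le> \<epsilon> / 4 * (2 * norm \<xi>)" using zx \<epsilon> by (intro mult_left_mono) auto
    finally have 1: "\<bar>objF s \<Lambda> ?z - objF s \<Lambda> x - egrad x \<bullet> (?z - x)\<bar> \<le> \<epsilon> / 2 * norm \<xi>" by simp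
    have "\<bar>egrad x \<bullet> (?z - x - \<xi>)\<bar> \<le> norm (egrad x) * norm (?z - x - \<xi>)"
      by (rule Cauchy_Schwarz_ineq2)
    also have "\<dots> \<le> B * (\<epsilon>' * norm \<xi>)" using B err x by (intro mult_mono) auto
    also have "\<dots> \<le> \<epsilon> / 2 * norm \<xi>"
      using mult_right_mono[OF \<epsilon>'(3), of "norm \<xi>"] by (simp add: mult.assoc)
    finally have 2: "\<bar>egrad x \<bullet> (?z - x) - egrad x \<bullet> \<xi>\<bar> \<le> \<epsilon> / 2 * norm \<xi>"
      by (simp add: inner_diff_right)
    have "x \<in> manifold s t" using x KM by blast
    then have "riem_metric t x (rgrad s t (objF s \<Lambda>) x) \<xi> = egrad x \<bullet> \<xi>"
      using \<xi> by (simp add: rgrad_eq riem_of_inner)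
    then show ?thesis using 1 2 by linarith
  qed
  then show ?thesis using \<eta>1(1) \<eta>2(1) by (intro exI[of _ "min (\<eta>1 / 2) \<eta>2"]) auto
qed

lemma prp_setting_sublevel:
  "\<exists>c' C. prp_setting (K c) (tangent s t) (riem_metric t) R tproj (objF s \<Lambda>) (rgrad s t (objF s \<Lambda>)) c' C 6"
proof -
  have M: "x \<in> manifold s t" if "x \<in> K c" for x using that by (simp add: K_def)
  obtain \<mu> where \<mu>: "0 < \<mu>" "\<And>x i. x \<in> K c \<Longrightarrow> idx i \<le> t \<Longrightarrow> \<mu> \<le> pa x $ i" using K_lower by blast
  obtain A where A: "0 < A" "\<And>x. x \<in> K c \<Longrightarrow> norm x \<le> A"
    using bounded_K[of c] unfolding bounded_pos by auto
  have "prp_setting (K c) (tangent s t) (riem_metric t) R tproj (objF s \<Lambda>) (rgrad s t (objF s \<Lambda>))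
      (min 1 (1 / A\<^sup>2)) (4 + real CARD('n) * (1 / \<mu>\<^sup>2)) 6"
  proof
    show "compact (K c)" by (rule compact_K)
    show "subspace (tangent s t x)" for x :: "'n point" by (rule subspace_tangent)
    show "bilinear (riem_metric t x)" for x :: "'n point" by (rule riem_metric_bilinear)
    show "riem_metric t x \<xi> \<eta> = riem_metric t x \<eta> \<xi>" for x \<xi> \<eta> :: "'n point" by (rule riem_metric_sym)
    show "0 < min 1 (1 / A\<^sup>2)" using A by simp
    show "min 1 (1 / A\<^sup>2) * (norm \<xi>)\<^sup>2 \<le> riem_metric t x \<xi> \<xi>" if "x \<in> K c" "\<xi> \<in> tangent s t x" for x \<xi>
      using that A M by (intro riem_metric_lower) auto
    show "\<bar>riem_metric t x \<xi> \<eta>\<bar> \<le> (4 + real CARD('n) * (1 / \<mu>\<^sup>2)) * norm \<xi> * norm \<eta>" if "x \<in> K c" for x \<xi> \<eta>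
      using that \<mu> by (intro riem_metric_upper) auto
    show "rgrad s t (objF s \<Lambda>) x \<in> tangent s t x" if "x \<in> K c" for x
      using M[OF that] by (simp add: rgrad_eq riem_of_in)
    show "continuous_on (K c) (rgrad s t (objF s \<Lambda>))" by (rule rgrad_continuous)
    show "tproj x \<xi> \<in> tangent s t x" if "x \<in> K c" "\<xi> \<in> tangent s t y" for x y \<xi>
      using tproj_in[OF M] that by blast
    show "tproj x \<xi> = \<xi>" if "x \<in> K c" "\<xi> \<in> tangent s t x" for x \<xi>
      using tproj_id[OF M] that by blast
    show "norm (tproj x \<xi>) \<le> 6 * norm \<xi>" if "x \<in> K c" for x \<xi>
      using tproj_bound[OF M[OF that]] .
    show "continuous_on (K c \<times> UNIV) (\<lambda>(x, \<xi>). tproj x \<xi>)" by (rule tproj_continuous)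
    show "\<exists>\<eta>>0. \<forall>x\<in>K c. \<forall>\<xi>\<in>tangent s t x. norm \<xi> < \<eta> \<longrightarrow> norm (R x \<xi> - x) \<le> 2 * norm \<xi>"
    proof -
      obtain \<eta> where \<eta>: "0 < \<eta>" "\<And>x \<xi>. x \<in> K c \<Longrightarrow> \<xi> \<in> tangent s t x \<Longrightarrow> norm \<xi> < \<eta> \<Longrightarrow>
          norm (R x \<xi> - x - \<xi>) \<le> 1 * norm \<xi>"
        using R_near[OF \<mu>(1) zero_less_one] \<mu>(2) M by blast
      have "norm (R x \<xi> - x) \<le> 2 * norm \<xi>" if "x \<in> K c" "\<xi> \<in> tangent s t x" "norm \<xi> < \<eta>" for x \<xi>
        using \<eta>(2)[OF that] norm_triangle_ineq[of "R x \<xi> - x - \<xi>" \<xi>] by simp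
      then show ?thesis using \<eta>(1) by blast
    qed
    show "\<exists>\<eta>>0. \<forall>x\<in>K c. \<forall>\<xi>\<in>tangent s t x. norm \<xi> < \<eta> \<longrightarrow>
      \<bar>objF s \<Lambda> (R x \<xi>) - objF s \<Lambda> x - riem_metric t x (rgrad s t (objF s \<Lambda>) x) \<xi>\<bar> \<le> \<epsilon> * norm \<xi>"
      if "0 < \<epsilon>" for \<epsilon> using objF_first_order[OF that] .
    show "0 \<le> objF s \<Lambda> (R x \<xi>)" for x \<xi> by (rule objF_nonneg)
    show "R x \<xi> \<in> K c" if "x \<in> K c" "\<xi> \<in> tangent s t x" "objF s \<Lambda> (R x \<xi>) \<le> objF s \<Lambda> x" for x \<xi>
      using that R_in[of x \<xi>] by (simp add: K_def)
  qed
  then show ?thesis by blast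
qed

lemma rnorm_squared: "(rnorm t x \<xi>)\<^sup>2 = riem_metric t x \<xi> (\<xi> :: 'n point)"
proof -
  have "0 \<le> riem_metric t x \<xi> \<xi>"
    unfolding riem_metric_eq by (intro add_nonneg_nonneg sum_nonneg) auto
  then show ?thesis by (simp add: rnorm_def)
qed

end

theorem theorem6p3:
  fixes s t :: nat
    and \<Lambda> :: "('n::{finite,linorder}) cvec"
    and R :: "'n point \<Rightarrow> 'n point \<Rightarrow> 'n point"
    and \<tau> \<delta> \<alpha>star :: real
    and x g d y dt :: "nat \<Rightarrow> 'n point"
    and \<alpha> \<beta> \<theta> :: "nat \<Rightarrow> real"
  assumes spectrum: "admissible_spectrum s t \<Lambda>"
    and retraction: "is_retraction_choice R"
    and params: "0 < \<tau>" "\<tau> < 1" "0 < \<delta>" "\<delta> < 1" "0 < \<alpha>star"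
    and x_0: "x 0 \<in> manifold s t"
    and d_0: "d 0 = - g 0"
    and g: "\<And>k. g k = rgrad s t (objF s \<Lambda>) (x k)"
    and \<alpha>: "\<And>k. \<alpha> k = line_search s t R (objF s \<Lambda>) \<tau> \<delta> \<alpha>star (x k) (d k)"
    and x_Suc: "\<And>k. x (Suc k) = R (x k) (\<alpha> k *\<^sub>R d k)"
    and y: "\<And>k. y k = g (Suc k) - transport R (x k) (\<alpha> k *\<^sub>R d k) (g k)"
    and dt: "\<And>k. dt k = transport R (x k) (\<alpha> k *\<^sub>R d k) (d k)"
    and \<beta>: "\<And>k. \<beta> k = riem_metric t (x (Suc k)) (g (Suc k)) (y k) / (rnorm t (x k) (g k))\<^sup>2"
    and \<theta>: "\<And>k. \<theta> k = riem_metric t (x (Suc k)) (g (Suc k)) (dt k) / (rnorm t (x k) (g k))\<^sup>2"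
    and d_Suc: "\<And>k. d (Suc k) = - g (Suc k) + \<beta> k *\<^sub>R dt k - \<theta> k *\<^sub>R y k"
    and no_stop: "\<And>k. rnorm t (x k) (rgrad s t (objF s \<Lambda>) (x k)) > 0"
  shows "liminf (\<lambda>k. ereal (rnorm t (x k) (rgrad s t (objF s \<Lambda>) (x k)))) = 0"
proof -
  interpret spectrum_retraction s t \<Lambda> R
    by unfold_locales (rule spectrum retraction)+
  \<comment> \<open>The level of the starting point; the iterates never leave this sublevel
    set.\<close>
  define c where "c = objF s \<Lambda> (x 0)"
  obtain c' C where "prp_setting (K c) (tangent s t) (riem_metric t) R tproj (objF s \<Lambda>)
      (rgrad s t (objF s \<Lambda>)) c' C 6"
    using prp_setting_sublevel by blast
  then interpret prp_setting "K c" "tangent s t" "riem_metric t" R tproj "objF s \<Lambda>"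
    "rgrad s t (objF s \<Lambda>)" c' C 6 .
  show ?thesis unfolding rnorm_def
  proof (rule liminf_zero[where \<tau> = \<tau> and \<delta> = \<delta> and x = x and d = d and y = y and dt = dt and \<alpha> = \<alpha>
        and \<beta> = \<beta> and \<theta> = \<theta> and init = "initial_step s t (objF s \<Lambda>) \<alpha>star"])
    show "0 < \<tau>" "\<tau> < 1" "0 < \<delta>" by fact+
    show "x 0 \<in> K c" using x_0 by (simp add: K_def c_def)
    show "d 0 = - rgrad s t (objF s \<Lambda>) (x 0)" using d_0 g by simp
    \<comment> \<open>The absolute value of a quotient whose numerator is nonzero by assumption and
      whose denominator is nonzero by the case distinction, or else
      \<open>\<alpha>star\<close>.\<close>
    show "0 < initial_step s t (objF s \<Lambda>) \<alpha>star z v"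
      if "riem_metric t z v (rgrad s t (objF s \<Lambda>) z) \<noteq> 0" for z v
      using that params by (simp add: initial_step_def)
    show "\<alpha> k = (let \<alpha>0 = initial_step s t (objF s \<Lambda>) \<alpha>star (x k) (d k);
          l1 = LEAST l. decrease \<delta> (x k) (d k) (\<tau> ^ l * \<alpha>0);
          l2 = LEAST l. \<not> decrease \<delta> (x k) (d k) ((1 / \<tau>) ^ l * \<alpha>0)
      in if 0 < l1 then \<tau> ^ l1 * \<alpha>0 else (1 / \<tau>) ^ (l2 - 1) * \<alpha>0)" for k
      unfolding \<alpha> line_search_def sufficient_decrease_def rnorm_squared ..
    show "x (Suc k) = R (x k) (\<alpha> k *\<^sub>R d k)" for k by (rule x_Suc)
    \<comment> \<open>The transport along the step ends at \<open>x (Suc k)\<close>, so it is the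
      projection there.\<close>
    show "y k = rgrad s t (objF s \<Lambda>) (x (Suc k)) - tproj (x (Suc k)) (rgrad s t (objF s \<Lambda>) (x k))" for k
      by (simp add: y g transport_eq x_Suc)
    show "dt k = tproj (x (Suc k)) (d k)" for k by (simp add: dt transport_eq x_Suc)
    show "\<beta> k = riem_metric t (x (Suc k)) (rgrad s t (objF s \<Lambda>) (x (Suc k))) (y k)
        / riem_metric t (x k) (rgrad s t (objF s \<Lambda>) (x k)) (rgrad s t (objF s \<Lambda>) (x k))" for k
      unfolding \<beta> rnorm_squared g ..
    show "\<theta> k = riem_metric t (x (Suc k)) (rgrad s t (objF s \<Lambda>) (x (Suc k))) (dt k)
        / riem_metric t (x k) (rgrad s t (objF s \<Lambda>) (x k)) (rgrad s t (objF s \<Lambda>) (x k))" for k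
      unfolding \<theta> rnorm_squared g ..
    show "d (Suc k) = - rgrad s t (objF s \<Lambda>) (x (Suc k)) + \<beta> k *\<^sub>R dt k - \<theta> k *\<^sub>R y k" for k
      unfolding d_Suc g ..
    show "0 < riem_metric t (x k) (rgrad s t (objF s \<Lambda>) (x k)) (rgrad s t (objF s \<Lambda>) (x k))" for k
      using no_stop[of k] by (simp add: rnorm_def)
  qed
qed

end
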